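(* Let $H$ be a real Hilbert space and $\mathcal{A}$ a positive self-adjoint operator on $H$ with dense domain $\mathcal{D}(\mathcal{A})$, such that for some $\lambda_0>0$ one has $\|v\|\le \lambda_0\|\mathcal{A}^{1/2}v\|$ for all $v\in\mathcal{D}(\mathcal{A}^{1/2})$. Let $\tau>0$, $b>0$, $c>0$, $\alpha\in\mathbb{R}$ be constants with $\gamma:=\alpha-\frac{c^2\tau}{b}>0$. Let $g:[0,\infty)\to\mathbb{R}$ satisfy: $g\in C^1(0,\infty)\cap C[0,\infty)$, $g(t)\ge 0$, $g'(t)\le 0$ and $g''(t)\ge 0$ for $t\ge 0$, and there is a constant $c_0>0$ with $g'(t)\le -c_0 g(t)$ for $t\ge 0$. Put $G(t)=\int_0^t g(s)\,ds$. Let $\lambda\in(\frac{c^2}{b},\frac{\alpha}{\tau})$ be such that $G(+\infty)<\frac{c^2}{\lambda}$. Consider $$\tau u_{ttt}+\alpha u_{tt}+c^2\mathcal{A}u+b\mathcal{A}u_t-\int_0^t g(t-s)\mathcal{A}w(s)\,ds=0,\qquad w=\lambda u+u_t,$$ with initial data $(u(0),u_t(0),u_{tt}(0))\in\mathcal{H}:=\mathcal{D}(\mathcal{A}^{1/2})\times\mathcal{D}(\mathcal{A}^{1/2})\times H$. Then this problem has a unique weak solution $u$ with $(u,u_t,u_{tt})$ in $\mathcal{H}$, and there exist constants $C,\omega>0$ (independent of the initial data) such that $$F_3(t)\le C F_3(0)e^{-\omega t},\qquad t>0,$$ where $$F_3(t)=\|\mathcal{A}^{1/2}u_t(t)\|^2+\|\mathcal{A}^{1/2}u(t)\|^2+\|u_{tt}(t)\|^2+\int_0^t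 g(t-s)\,\|\mathcal{A}^{1/2}w(t)-\mathcal{A}^{1/2}w(s)\|^2\,ds .$$
   Context: $\|\cdot\|$ denotes the norm of $H$. The solution notion is the weak solution obtainable e.g. by Galerkin approximation. *)

theory Defs
  imports "HOL-Analysis.Analysis"
begin

text \<open>A (possibly unbounded) positive self-adjoint operator A with domain D on a real
  Hilbert space: linear on the subspace D, densely defined, symmetric, and
  D(A^*) is contained in D (so A = A^*), and positive.\<close>
definition pos_selfadj :: "'a::{real_inner,complete_space} set \<Rightarrow> ('a \<Rightarrow> 'a) \<Rightarrow> bool" where
  "pos_selfadj D A \<longleftrightarrow>
     subspace D \<and>
     (\<forall>x\<in>D. \<forall>y\<in>D. A (x + y) = A x + A y) \<and>
     (\<forall>x\<in>D. \<forall>r. A (r *\<^sub>R x) = r *\<^sub>R A x) \<and>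
     closure D = UNIV \<and>
     (\<forall>x\<in>D. \<forall>y\<in>D. A x \<bullet> y = x \<bullet> A y) \<and>
     (\<forall>y z. (\<forall>x\<in>D. A x \<bullet> y = x \<bullet> z) \<longrightarrow> y \<in> D) \<and>
     (\<forall>x\<in>D. 0 \<le> A x \<bullet> x)"

definition is_op_sqrt :: "'a::{real_inner,complete_space} set \<Rightarrow> ('a \<Rightarrow> 'a) \<Rightarrow> 'a set \<Rightarrow> ('a \<Rightarrow> 'a) \<Rightarrow> bool" where
  "is_op_sqrt D A DS S \<longleftrightarrow>
     pos_selfadj DS S \<and> D = {v \<in> DS. S v \<in> DS} \<and> (\<forall>v\<in>D. S (S v) = A v)"

text \<open>Weak solution on [0,\<infinity>) of
  tau u''' + alpha u'' + c^2 A u + b A u' - \<integral>_0^t g(t-s) A w(s) ds = 0, w = lam u + u',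
  with (u,u',u'')(0) = (u0,u1,u2), in the class
  u, u' \<in> C([0,\<infinity>); D(A^(1/2))), u'' \<in> C([0,\<infinity>); H), u \<in> C^2([0,\<infinity>); H);
  the equation holds tested against every v \<in> D(A^(1/2)), in time-integrated form.\<close>
definition weak_sol ::
  "'a set \<Rightarrow> ('a \<Rightarrow> 'a) \<Rightarrow> real \<Rightarrow> real \<Rightarrow> real \<Rightarrow> real \<Rightarrow> real \<Rightarrow> (real \<Rightarrow> real) \<Rightarrow>
   'a \<Rightarrow> 'a \<Rightarrow> 'a \<Rightarrow> (real \<Rightarrow> 'a) \<Rightarrow> (real \<Rightarrow> 'a) \<Rightarrow> (real \<Rightarrow> 'a::{real_inner,complete_space}) \<Rightarrow> bool" where
  "weak_sol DS S tau alpha b c lam g u0 u1 u2 u ud udd \<longleftrightarrow>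
     (\<forall>t\<ge>0. u t \<in> DS \<and> ud t \<in> DS) \<and>
     (\<forall>t\<ge>0. (u has_vector_derivative ud t) (at t within {0..})) \<and>
     (\<forall>t\<ge>0. (ud has_vector_derivative udd t) (at t within {0..})) \<and>
     continuous_on {0..} (\<lambda>t. S (u t)) \<and>
     continuous_on {0..} (\<lambda>t. S (ud t)) \<and>
     continuous_on {0..} udd \<and>
     u 0 = u0 \<and> ud 0 = u1 \<and> udd 0 = u2 \<and>
     (\<forall>v\<in>DS. \<forall>t\<ge>0.
        tau * (udd t \<bullet> v) + alpha * (ud t \<bullet> v)
        = tau * (u2 \<bullet> v) + alpha * (u1 \<bullet> v)
          - integral {0..t} (\<lambda>s. c\<^sup>2 * (S (u s) \<bullet> S v) + b * (S (ud s) \<bullet> S v)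
                - integral {0..s} (\<lambda>r. g (s - r) * (S (lam *\<^sub>R u r + ud r) \<bullet> S v))))"

definition F3 ::
  "('a \<Rightarrow> 'a) \<Rightarrow> real \<Rightarrow> (real \<Rightarrow> real) \<Rightarrow> (real \<Rightarrow> 'a) \<Rightarrow> (real \<Rightarrow> 'a) \<Rightarrow> (real \<Rightarrow> 'a::{real_inner,complete_space}) \<Rightarrow> real \<Rightarrow> real" where
  "F3 S lam g u ud udd t =
     (norm (S (ud t)))\<^sup>2 + (norm (S (u t)))\<^sup>2 + (norm (udd t))\<^sup>2
     + integral {0..t} (\<lambda>s. g (t - s) * (norm (S (lam *\<^sub>R u t + ud t) - S (lam *\<^sub>R u s + ud s)))\<^sup>2)"

end

theory Submission
  imports Defs
begin

text \<open>Write \<open>w = lam u + u'\<close>. Testing the equation with \<open>w'\<close> shows that the energy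
  \<open>tau \<bar>w'\<bar>\<^sup>2 + (c\<^sup>2/lam - G) \<bar>S w\<bar>\<^sup>2 + (b - c\<^sup>2/lam) \<bar>S u'\<bar>\<^sup>2 + lam (alpha - lam tau) \<bar>u'\<bar>\<^sup>2\<close>
  plus the memory term is dissipated at a rate controlling \<open>\<bar>S u'\<bar>\<^sup>2\<close>, \<open>\<bar>u''\<bar>\<^sup>2\<close> and the memory term;
  adding a small multiple of \<open>tau \<langle>w', w\<rangle>\<close> also captures \<open>\<bar>S w\<bar>\<^sup>2\<close> and gives exponential decay for
  regular solutions, with a quadratic error if the equation is forced. Weak solutions are regularised
  by the contractions \<open>(1 + e S)\<^sup>-\<^sup>1\<close>, which commute with \<open>S\<close> and tend strongly to the identity.
  Uniqueness is decay from zero data. For existence, \<open>S\<close> is replaced by its Yosida approximations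
  \<open>S (1 + e S)\<^sup>-\<^sup>1\<close>, for which the equation is a Volterra equation with bounded coefficients; since
  the approximations commute, the forced energy estimate makes the approximate solutions uniformly
  Cauchy, first for smooth data and then, by density, for all data.\<close>

section \<open>Convolution with a continuous kernel\<close>

text \<open>The range of \<open>lam\<close> makes \<open>w\<close> the right variable:
  \<open>tau u''' + alpha u'' = tau w'' + (alpha - lam tau) u''\<close> and \<open>c\<^sup>2 u + b
  u' = (c\<^sup>2 / lam) w + (b - c\<^sup>2 / lam) u'\<close>, and both remaining coefficients are
  positive. Pairing with \<open>w'\<close> therefore gives squares and time derivatives of squares,
  while the bound on the mass of \<open>g\<close> keeps the coefficient of
  \<open>\<bar>S w\<bar>\<^sup>2\<close> positive against the memory term. A weak solution cannot be
  tested with \<open>w'\<close>, which contains \<open>u''\<close>, an element of \<open>H\<close>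
  only. Decay is therefore proved for a notion that records just the two tested identities, with
  constants that do not see the regularisation. The Poincare inequality makes \<open>S\<close>
  boundedly invertible. Writing \<open>u = J p\<close> with \<open>J = S\<^sup>-\<^sup>1\<close>
  removes the domain questions, and the required functions of \<open>S\<close> become inverses of
  the bounded operators \<open>J + e\<close>, whose commutation is elementary. Two Yosida
  approximations are not close in operator norm, only on the range of a power of \<open>J\<close>;
  this is why smooth data come before general data in the existence proof.\<close>

lemma has_vector_derivative_integral_atLeast:
  fixes f :: "real \<Rightarrow> 'a::banach"
  assumes "continuous_on {0..} f" and "t \<ge> 0"
  shows "((\<lambda>t. integral {0..t} f) has_vector_derivative f t) (at t within {0..})"
proof -
  have "((\<lambda>t. integral {0..t} f) has_vector_derivative f t) (at t within {0..t+1})"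
    using assms by (intro integral_has_vector_derivative continuous_on_subset[OF assms(1)]) auto
  moreover have "at t within {0..t+1} = at t within {0..}"
    by (rule at_within_nhd[where S="{..<t+1}"]) auto
  ultimately show ?thesis by simp
qed

lemma integral_derivative_atLeast:
  fixes f :: "real \<Rightarrow> 'a::banach"
  assumes "\<And>s. s \<ge> 0 \<Longrightarrow> (f has_vector_derivative f' s) (at s within {0..})" and "t \<ge> 0"
  shows "(f' has_integral f t - f 0) {0..t}"
  using assms(2)
proof (rule fundamental_theorem_of_calculus)
  show "(f has_vector_derivative f' s) (at s within {0..t})" if "s \<in> {0..t}" for s
    using assms(1)[of s] that by (auto elim: has_vector_derivative_within_subset)
qed

lemma continuous_on_vector_derivative_atLeast:
  assumes "\<And>s. s \<ge> 0 \<Longrightarrow> (f has_vector_derivative f' s) (at s within {0..})"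
  shows "continuous_on {0..} (f :: real \<Rightarrow> 'a::real_normed_vector)"
  unfolding continuous_on_eq_continuous_within
  using assms has_vector_derivative_continuous by fastforce

definition conv :: "(real \<Rightarrow> real) \<Rightarrow> (real \<Rightarrow> 'a::real_normed_vector) \<Rightarrow> real \<Rightarrow> 'a" where
  "conv g h t = integral {0..t} (\<lambda>s. g (t - s) *\<^sub>R h s)"

lemma continuous_on_conv_integrand:
  fixes g :: "real \<Rightarrow> real"
  assumes "continuous_on {0..} g" "continuous_on {0..} h"
  shows "continuous_on {0..t} (\<lambda>s. g (t - s) *\<^sub>R h s :: 'a::real_normed_vector)"
  by (intro continuous_intros continuous_on_compose2[OF assms(1)] continuous_on_compose2[OF assms(2)])
     (auto intro!: continuous_intros)

lemma integrable_conv: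
  fixes h :: "real \<Rightarrow> 'a::banach"
  assumes "continuous_on {0..} g" "continuous_on {0..} h"
  shows "(\<lambda>s. g (t - s) *\<^sub>R h s) integrable_on {0..t}"
  by (intro integrable_continuous_real continuous_on_conv_integrand assms)

lemma conv_cong: "(\<And>s. 0 \<le> s \<Longrightarrow> s \<le> t \<Longrightarrow> h s = k s) \<Longrightarrow> conv g h t = conv g k t"
  unfolding conv_def by (rule integral_cong) simp

lemma conv_linear:
  fixes h :: "real \<Rightarrow> 'a::banach" and T :: "'a \<Rightarrow> 'b::banach"
  assumes "continuous_on {0..} g" "continuous_on {0..} h" "bounded_linear T"
  shows "conv g (\<lambda>s. T (h s)) t = T (conv g h t)"
  using integral_linear[OF integrable_conv[OF assms(1,2), of t] assms(3)]
  by (simp add: conv_def o_def linear_simps[OF assms(3)])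

lemma conv_add:
  fixes h k :: "real \<Rightarrow> 'a::banach"
  assumes "continuous_on {0..} g" "continuous_on {0..} h" "continuous_on {0..} k"
  shows "conv g (\<lambda>s. h s + k s) t = conv g h t + conv g k t"
  unfolding conv_def scaleR_add_right
  by (intro integral_add integrable_conv assms)

lemma conv_diff:
  fixes h k :: "real \<Rightarrow> 'a::banach"
  assumes "continuous_on {0..} g" "continuous_on {0..} h" "continuous_on {0..} k"
  shows "conv g (\<lambda>s. h s - k s) t = conv g h t - conv g k t"
  unfolding conv_def scaleR_diff_right
  by (intro integral_diff integrable_conv assms)

text \<open>The substitution of \<open>t - s\<close> for \<open>s\<close> moves the variable
  \<open>t\<close> from the kernel, whose derivative may be singular at the origin, to
  \<open>h\<close>.\<close>

lemma conv_eq_reflected: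
  fixes h :: "real \<Rightarrow> 'a::banach"
  shows "conv g h t = integral {0..t} (\<lambda>s. g s *\<^sub>R h (t - s))"
proof -
  \<comment> \<open>Proved for every value \<open>I\<close>, the equivalence transfers integrability
    together with the integral, so no case distinction arises.\<close>
  have "((\<lambda>s. g (t - s) *\<^sub>R h s) has_integral I) {0..t} \<longleftrightarrow>
        ((\<lambda>s. g s *\<^sub>R h (t - s)) has_integral I) {0..t}" for I
  proof -
    have "((\<lambda>s. g s *\<^sub>R h (t - s)) has_integral I) {0..t} \<longleftrightarrow>
      ((\<lambda>s. g (t + s) *\<^sub>R h (- s)) has_integral I) {-t..0}"
      using has_integral_shift_Icc_real[of "\<lambda>s. g s *\<^sub>R h (t - s)" t I "-t" 0] by (simp add: o_def)
    also have "\<dots> \<longleftrightarrow> ((\<lambda>s. g (t - s) *\<^sub>R h s) has_integral I) {0..t}"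
      using has_integral_reflect_real[of "\<lambda>s. g (t + s) *\<^sub>R h (- s)" I t 0]
        has_integral_reflect_real[of "\<lambda>s. g (t - s) *\<^sub>R h s" I t 0] by simp
    finally show ?thesis by simp
  qed
  then show ?thesis by (simp add: conv_def integral_def integrable_on_def)
qed

text \<open>Substituting \<open>s = t r\<close> turns the variable interval into
  \<open>[0, 1]\<close>, where continuity of a parameter integral applies; at \<open>t = 0\<close>
  both sides vanish.\<close>

lemma continuous_on_conv:
  fixes h :: "real \<Rightarrow> 'a::banach"
  assumes g: "continuous_on {0..} g" and h: "continuous_on {0..} h"
  shows "continuous_on {0..} (conv g h)"
proof -
  have "continuous_on {0..} (\<lambda>t. t *\<^sub>R integral (cbox 0 1) (\<lambda>r. g (t - t * r) *\<^sub>R h (t * r)))"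
  proof (intro continuous_intros integral_continuous_on_param)
    have "continuous_on ({0..} \<times> cbox (0::real) 1) (\<lambda>x. g (fst x - fst x * snd x) *\<^sub>R h (fst x * snd x))"
      by (intro continuous_intros continuous_on_compose2[OF g] continuous_on_compose2[OF h])
         (auto simp: mult_left_le)
    then show "continuous_on ({0..} \<times> cbox (0::real) 1) (\<lambda>(t,r). g (t - t * r) *\<^sub>R h (t * r))"
      by (simp add: case_prod_unfold)
  qed
  moreover have "conv g h t = t *\<^sub>R integral (cbox 0 1) (\<lambda>r. g (t - t * r) *\<^sub>R h (t * r))" if "t \<ge> 0" for t
  proof (cases "t = 0")
    case False
    with that have t: "t > 0" by simp
    have "((\<lambda>s. g (t - s) *\<^sub>R h s) has_integral conv g h t) (cbox 0 t)"
      using integrable_integral[OF integrable_conv[OF g h, of t]] by (simp add: conv_def)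
    from has_integral_affinity[OF this, of t 0] t
    have "((\<lambda>r. g (t - t * r) *\<^sub>R h (t * r)) has_integral (1/t) *\<^sub>R conv g h t) ((\<lambda>x. x / t) ` {0..t})"
      by simp
    moreover have "(\<lambda>x. x / t) ` {0..t} = cbox 0 1"
      using t by simp
    ultimately have "integral (cbox 0 1) (\<lambda>r. g (t - t * r) *\<^sub>R h (t * r)) = (1/t) *\<^sub>R conv g h t"
      by (simp add: integral_unique)
    then show ?thesis using t by simp
  qed (simp add: conv_def)
  ultimately show ?thesis by (subst continuous_on_cong[OF refl]) auto
qed

lemma conv_const:
  assumes "continuous_on {0..} g"
  shows "conv g (\<lambda>s. x :: 'a::banach) t = integral {0..t} g *\<^sub>R x"
proof -
  have "g integrable_on {0..t}"
    by (intro integrable_continuous_real continuous_on_subset[OF assms]) auto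
  then show ?thesis
    unfolding conv_eq_reflected
    using integral_linear[of g "{0..t}" "\<lambda>r. r *\<^sub>R x"] by (simp add: o_def bounded_linear_scaleR_left)
qed

text \<open>The kernel need not be differentiable: \<open>h\<close> is first reduced to a function that vanishes to
  first order at the origin, whose extension by zero may be differentiated under an integral over a
  fixed interval.\<close>

lemma has_vector_derivative_conv:
  fixes h h' :: "real \<Rightarrow> 'a::banach"
  assumes g: "continuous_on {0..} g"
    and h: "\<And>s. s \<ge> 0 \<Longrightarrow> (h has_vector_derivative h' s) (at s within {0..})"
    and h': "continuous_on {0..} h'" and t: "t \<ge> 0"
  shows "(conv g h has_vector_derivative (g t *\<^sub>R h 0 + conv g h' t)) (at t within {0..})"
proof -
  \<comment> \<open>One unit beyond \<open>t\<close>, so that the decomposition \<open>dec\<close>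
    is available on a whole neighbourhood of \<open>t\<close> in the half-line.\<close>
  define T where "T = t + 1"
  define G where "G = (\<lambda>t. integral {0..t} g)"
  define G1 where "G1 = (\<lambda>t. integral {0..t} (\<lambda>s. s * g s))"
  \<comment> \<open>First-order Taylor remainder of \<open>h\<close> at the origin, extended by
    zero. Both one-sided derivatives at 0 vanish, so \<open>k\<close> is continuously differentiable
    on the whole line.\<close>
  define k where "k = (\<lambda>s. if s \<le> 0 then 0 else h s - h 0 - s *\<^sub>R h' 0)"
  define k' where "k' = (\<lambda>s. if s \<le> 0 then 0 else h' s - h' 0)"
  have hc: "continuous_on {0..} h"
    using h by (rule continuous_on_vector_derivative_atLeast)
  have k: "(k has_vector_derivative k' s) (at s)" for s
  proof -
    have A: "((\<lambda>s. h s - h 0 - s *\<^sub>R h' 0) has_vector_derivative (h' s - h' 0)) (at s within {0..})"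
      if "s \<ge> 0"
      by (rule derivative_eq_intros h that refl | simp)+
    have "{..0} \<union> ({..0} \<inter> {0..}) = {..0::real}" "{0..} \<union> ({..0} \<inter> {0..}) = {0::real..}" by auto
    then have "((\<lambda>s. if s \<in> {..0} then 0 else h s - h 0 - s *\<^sub>R h' 0) has_vector_derivative
       (if s \<in> {..0} then 0 else h' s - h' 0)) (at s within UNIV)"
      by (intro has_vector_derivative_If_within_closures[where S="{..0}" and T="{0..}"
            and f'="\<lambda>_. 0" and g'="\<lambda>s. h' s - h' 0"]) (use A in auto)
    then show ?thesis by (simp add: k_def k'_def)
  qed
  have kc: "continuous_on UNIV k"
    using k has_vector_derivative_continuous continuous_at_imp_continuous_on by blast
  have k'c: "continuous_on UNIV k'"
  proof -
    have "continuous_on ({..0} \<union> {0..}) k'"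
      unfolding k'_def
      by (intro continuous_on_cases continuous_intros h') auto
    moreover have "{..0} \<union> {0..} = (UNIV::real set)" by auto
    ultimately show ?thesis by simp
  qed
  have Q: "((\<lambda>x. integral (cbox 0 T) (\<lambda>r. g r *\<^sub>R k (x - r))) has_vector_derivative
      integral (cbox 0 T) (\<lambda>r. g r *\<^sub>R k' (t - r))) (at t within UNIV)"
  proof (rule leibniz_rule_vector_derivative)
    fix x r assume "r \<in> cbox 0 T"
    have "((\<lambda>x. x - r) has_vector_derivative 1) (at x)"
      by (rule derivative_eq_intros refl | simp)+
    then have "((\<lambda>x. k (x - r)) has_vector_derivative k' (x - r)) (at x)"
      using vector_diff_chain_at[of "\<lambda>x. x - r" 1 x k "k' (x - r)"] k
      by (auto simp: o_def)
    then show "((\<lambda>x. g r *\<^sub>R k (x - r)) has_vector_derivative g r *\<^sub>R k' (x - r)) (at x within UNIV)"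
      by (auto intro!: derivative_eq_intros)
  next
    fix x show "(\<lambda>r. g r *\<^sub>R k (x - r)) integrable_on cbox 0 T"
      by (intro integrable_continuous continuous_intros continuous_on_compose2[OF kc]
          continuous_on_subset[OF g]) auto
  next
    show "continuous_on (UNIV \<times> cbox 0 T) (\<lambda>(x, r). g r *\<^sub>R k' (x - r))"
      unfolding case_prod_unfold
      by (intro continuous_intros continuous_on_compose2[OF k'c] continuous_on_compose2[OF g]) auto
  qed auto
  \<comment> \<open>For a function vanishing on the negative axis the fixed interval
    \<open>[0, T]\<close> may replace \<open>[0, x]\<close>; this is what makes the Leibniz rule
    applicable.\<close>
  have ext: "integral (cbox 0 T) (\<lambda>r. g r *\<^sub>R f (x - r)) = conv g f x"
    if x: "0 \<le> x" "x \<le> T" and f: "\<And>s. s \<le> 0 \<Longrightarrow> f s = 0" for x and f :: "real \<Rightarrow> 'a"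
  proof -
    have "integral (cbox 0 T) (\<lambda>r. g r *\<^sub>R f (x - r)) =
        integral (cbox 0 T) (\<lambda>r. if r \<in> {0..x} then g r *\<^sub>R f (x - r) else 0)"
      by (rule integral_cong) (auto simp: f)
    also have "\<dots> = integral {0..x} (\<lambda>r. g r *\<^sub>R f (x - r))"
      unfolding integral_restrict_Int using x by (simp add: min_def Int_absorb1)
    finally show ?thesis by (simp add: conv_eq_reflected)
  qed
  have Gd: "((\<lambda>t. G t) has_vector_derivative g t) (at t within {0..})"
    unfolding G_def by (rule has_vector_derivative_integral_atLeast[OF g t])
  have G1d: "((\<lambda>t. G1 t) has_vector_derivative (t * g t)) (at t within {0..})"
    unfolding G1_def by (rule has_vector_derivative_integral_atLeast[OF _ t]) (intro continuous_intros g)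
  have lin: "conv g (\<lambda>s. s *\<^sub>R y) x = (x * G x - G1 x) *\<^sub>R y" if "x \<ge> 0" for x and y :: 'a
  proof -
    have i: "g integrable_on {0..x}" "(\<lambda>s. s * g s) integrable_on {0..x}"
      by (intro integrable_continuous_real continuous_intros continuous_on_subset[OF g]; auto)+
    have "conv g (\<lambda>s. s) x = x * G x - G1 x"
      unfolding conv_eq_reflected G_def G1_def
      using i integral_diff[of "\<lambda>s. x * g s" "{0..x}" "\<lambda>s. s * g s"]
        integrable_on_mult_right[of g "{0..x}" x]
      by (simp add: algebra_simps)
    then show ?thesis
      using conv_linear[OF g continuous_on_id bounded_linear_scaleR_left, of y x] by simp
  qed
  have dec: "conv g h x = integral (cbox 0 T) (\<lambda>r. g r *\<^sub>R k (x - r)) + G x *\<^sub>R h 0 + (x * G x - G1 x) *\<^sub>R h' 0"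
    if "0 \<le> x" "x \<le> T" for x
  proof -
    have kc0: "continuous_on {0..} k" using kc continuous_on_subset by blast
    have "conv g h x = conv g (\<lambda>s. (k s + h 0) + s *\<^sub>R h' 0) x"
      by (rule conv_cong) (auto simp: k_def)
    also have "\<dots> = conv g (\<lambda>s. k s + h 0) x + conv g (\<lambda>s. s *\<^sub>R h' 0) x"
      by (intro conv_add g continuous_intros kc0)
    also have "conv g (\<lambda>s. k s + h 0) x = conv g k x + conv g (\<lambda>s. h 0) x"
      by (intro conv_add g continuous_intros kc0)
    finally show ?thesis
      using that ext[of x k] by (simp add: k_def conv_const[OF g] lin G_def)
  qed
  have k't: "integral (cbox 0 T) (\<lambda>r. g r *\<^sub>R k' (t - r)) = conv g h' t - G t *\<^sub>R h' 0"
  proof -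
    have "integral (cbox 0 T) (\<lambda>r. g r *\<^sub>R k' (t - r)) = conv g k' t"
      by (rule ext) (auto simp: T_def t k'_def)
    also have "\<dots> = conv g (\<lambda>s. h' s - h' 0) t"
      by (rule conv_cong) (auto simp: k'_def)
    also have "\<dots> = conv g h' t - conv g (\<lambda>s. h' 0) t"
      by (intro conv_diff g h' continuous_intros)
    finally show ?thesis by (simp add: conv_const[OF g] G_def)
  qed
  \<comment> \<open>All terms with \<open>h' 0\<close> cancel; the boundary term \<open>g t\<close>
    times \<open>h 0\<close> comes from differentiating \<open>G\<close>.\<close>
  have "((\<lambda>x. integral (cbox 0 T) (\<lambda>r. g r *\<^sub>R k (x - r)) + G x *\<^sub>R h 0 + (x * G x - G1 x) *\<^sub>R h' 0)
      has_vector_derivative (conv g h' t - G t *\<^sub>R h' 0) + g t *\<^sub>R h 0 + (G t + t * g t - t * g t) *\<^sub>R h' 0)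
      (at t within {0..})"
  proof (intro has_vector_derivative_add has_vector_derivative_at_within[OF Q[unfolded k't]])
    note d = Gd[folded has_real_derivative_iff_has_vector_derivative]
      G1d[folded has_real_derivative_iff_has_vector_derivative]
    have "((\<lambda>x. x * G x - G1 x) has_real_derivative (G t + t * g t - t * g t)) (at t within {0..})"
      by (rule derivative_eq_intros d refl | simp)+
    from has_vector_derivative_scaleR[OF this has_vector_derivative_const[of "h' 0"]]
    show "((\<lambda>x. (x * G x - G1 x) *\<^sub>R h' 0) has_vector_derivative (G t + t * g t - t * g t) *\<^sub>R h' 0)
        (at t within {0..})" by simp
    from has_vector_derivative_scaleR[OF d(1) has_vector_derivative_const[of "h 0"]]
    show "((\<lambda>x. G x *\<^sub>R h 0) has_vector_derivative g t *\<^sub>R h 0) (at t within {0..})" by simp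
  qed
  then have "((\<lambda>x. integral (cbox 0 T) (\<lambda>r. g r *\<^sub>R k (x - r)) + G x *\<^sub>R h 0 + (x * G x - G1 x) *\<^sub>R h' 0)
      has_vector_derivative (g t *\<^sub>R h 0 + conv g h' t)) (at t within {0..})"
    by (simp add: algebra_simps)
  then show ?thesis
  proof (rule has_vector_derivative_transform_within[where d=1])
    show "\<And>x'. \<lbrakk>x' \<in> {0..}; dist x' t < 1\<rbrakk> \<Longrightarrow>
      integral (cbox 0 T) (\<lambda>r. g r *\<^sub>R k (x' - r)) + G x' *\<^sub>R h 0 + (x' * G x' - G1 x') *\<^sub>R h' 0 = conv g h x'"
      using dec by (auto simp: T_def dist_real_def)
  qed (use t in auto)
qed

lemma norm_conv_le:
  fixes h :: "real \<Rightarrow> 'a::banach"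
  assumes g: "continuous_on {0..} g" and h: "continuous_on {0..} h"
    and "\<And>s. s \<ge> 0 \<Longrightarrow> g s \<ge> 0" and H: "\<And>s. 0 \<le> s \<Longrightarrow> s \<le> t \<Longrightarrow> norm (h s) \<le> H"
  shows "norm (conv g h t) \<le> integral {0..t} g * H"
proof -
  have "norm (conv g h t) \<le> integral {0..t} (\<lambda>s. g (t - s) *\<^sub>R H)"
    unfolding conv_def
    by (rule integral_norm_bound_integral)
       (use assms in \<open>auto intro!: integrable_conv[where h="\<lambda>_. H", simplified] integrable_conv
          continuous_intros mult_left_mono\<close>)
  then show ?thesis using conv_const[OF g, of H t] by (simp only: conv_def real_scaleR_def)
qed

section \<open>The memory term\<close>

text \<open>\<open>Gam\<close> stands for the total mass of the kernel. Only its role as an upper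
  bound for all partial masses enters the estimates; it becomes \<open>integral {0..} g\<close> when
  the locale is interpreted.\<close>

locale memory_kernel =
  fixes g g' :: "real \<Rightarrow> real" and c0 Gam :: real
  assumes g_cont: "continuous_on {0..} g"
    and g_deriv: "\<And>t. t > 0 \<Longrightarrow> (g has_real_derivative g' t) (at t)"
    and g_nonneg: "\<And>t. t \<ge> 0 \<Longrightarrow> g t \<ge> 0"
    and c0_pos: "c0 > 0"
    and g_decay: "\<And>t. t > 0 \<Longrightarrow> g' t \<le> - c0 * g t"
    and G_le: "\<And>t. t \<ge> 0 \<Longrightarrow> integral {0..t} g \<le> Gam"
begin

lemma G_nonneg: "0 \<le> integral {0..t} g"
  by (intro integral_nonneg integrable_continuous_real continuous_on_subset[OF g_cont])
     (auto intro: g_nonneg)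

lemma Gam_nonneg: "0 \<le> Gam"
  using G_le[of 0] by simp

lemma norm_conv_le_Gam:
  fixes h :: "real \<Rightarrow> 'a::banach"
  assumes "continuous_on {0..} h" and H: "\<And>s. 0 \<le> s \<Longrightarrow> s \<le> t \<Longrightarrow> norm (h s) \<le> H" and "t \<ge> 0"
  shows "norm (conv g h t) \<le> Gam * H"
proof -
  have "0 \<le> H" using H[of 0] \<open>t \<ge> 0\<close> norm_ge_zero order_trans by blast
  have "norm (conv g h t) \<le> integral {0..t} g * H"
    by (rule norm_conv_le[OF g_cont assms(1) g_nonneg H])
  also have "\<dots> \<le> Gam * H"
    by (intro mult_right_mono G_le \<open>0 \<le> H\<close> \<open>t \<ge> 0\<close>)
  finally show ?thesis .
qed

text \<open>Integration by parts would give \<open>\<integral> g' (t - s) h s\<close> on the left. As \<open>g'\<close> may be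
  singular at the origin, a monotone auxiliary function is used instead.\<close>

lemma memory_dissipation:
  assumes t: "t \<ge> 0"
    and h: "\<And>s. s \<ge> 0 \<Longrightarrow> (h has_real_derivative h' s) (at s within {0..})"
    and h': "continuous_on {0..} h'" and h0: "\<And>s. h s \<ge> 0" and ht: "h t = 0"
  shows "g t * h 0 + conv g h' t \<le> - c0 * conv g h t"
proof -
  define k where "k = (\<lambda>r. g (t - r) * (h' r + c0 * h r))"
  \<comment> \<open>Chosen so that the \<open>h'\<close> terms cancel and the derivative is
    \<open>(- g' - c0 g) h\<close>, which is nonnegative. Monotonicity asks for the derivative only
    in the open interval and for continuity at the ends, so a singularity of \<open>g'\<close> at
    \<open>s = t\<close> is harmless. The endpoint values are \<open>g t * h 0\<close> and, since
    \<open>h t = 0\<close>, minus the integral of \<open>k\<close>.\<close>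
  define \<phi> where "\<phi> = (\<lambda>s. g (t - s) * h s - integral {0..s} k)"
  have hc: "continuous_on {0..} h"
    using h by (intro continuous_on_vector_derivative_atLeast) (simp add: has_real_derivative_iff_has_vector_derivative)
  have kc: "continuous_on {0..t} k"
    unfolding k_def real_scaleR_def[symmetric]
    by (intro continuous_on_conv_integrand g_cont continuous_intros h' hc)
  have "\<phi> 0 \<le> \<phi> t"
  proof (rule DERIV_nonneg_imp_increasing_open[OF t])
    fix s assume s: "0 < s" "s < t"
    have "((\<lambda>s. integral {0..s} k) has_real_derivative k s) (at s within {0..t})"
      by (rule integral_has_real_derivative[OF kc]) (use s in auto)
    then have 1: "((\<lambda>s. integral {0..s} k) has_real_derivative k s) (at s)"
      using s by (simp add: at_within_Icc_at)
    have "at s within {0..} = at s"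
      using s by (intro at_within_interior) auto
    then have 2: "(h has_real_derivative h' s) (at s)"
      using h[of s] s by simp
    have 3: "((\<lambda>s. g (t - s)) has_real_derivative - g' (t - s)) (at s)"
      using DERIV_chain2[of g "g' (t - s)" "\<lambda>s. t - s" s "-1" UNIV]
        DERIV_diff[OF DERIV_const[of t] DERIV_ident, of s UNIV] g_deriv[of "t - s"] s
      by simp
    have "(\<phi> has_real_derivative (- g' (t - s) * h s + g (t - s) * h' s - k s)) (at s)"
      unfolding \<phi>_def using DERIV_diff[OF DERIV_mult[OF 3 2] 1] by (simp add: algebra_simps)
    moreover have "- g' (t - s) * h s + g (t - s) * h' s - k s = (- c0 * g (t - s) - g' (t - s)) * h s"
      by (simp add: k_def algebra_simps)
    moreover have "0 \<le> (- c0 * g (t - s) - g' (t - s)) * h s"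
      using g_decay[of "t - s"] h0 s by (intro mult_nonneg_nonneg) auto
    ultimately show "\<exists>y. (\<phi> has_real_derivative y) (at s) \<and> 0 \<le> y" by metis
  next
    have "continuous_on {0..t} (\<lambda>s. integral {0..s} k)"
      by (rule indefinite_integral_continuous_1[OF integrable_continuous_real[OF kc]])
    moreover have "continuous_on {0..t} (\<lambda>s. g (t - s) * h s)"
      using continuous_on_conv_integrand[OF g_cont hc, of t] by simp
    ultimately show "continuous_on {0..t} \<phi>"
      unfolding \<phi>_def by (intro continuous_on_diff)
  qed
  moreover have "integral {0..t} k = conv g h' t + c0 * conv g h t"
  proof -
    have "integral {0..t} k = conv g (\<lambda>s. h' s + c0 * h s) t"
      by (simp add: conv_def k_def)
    also have "\<dots> = conv g h' t + conv g (\<lambda>s. c0 * h s) t"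
      by (intro conv_add g_cont h' continuous_intros hc)
    finally show ?thesis
      using conv_linear[OF g_cont hc bounded_linear_mult_right[of c0], of t] by simp
  qed
  ultimately show ?thesis by (simp add: \<phi>_def ht)
qed

section \<open>The memory functional: differential inequality and Young estimate\<close>

definition memory :: "(real \<Rightarrow> 'a::real_inner) \<Rightarrow> real \<Rightarrow> real" where
  "memory q t = integral {0..t} (\<lambda>s. g (t - s) * (norm (q t - q s))\<^sup>2)"

lemma memory_nonneg:
  assumes "continuous_on {0..} q"
  shows "0 \<le> memory q t"
  unfolding memory_def real_scaleR_def[symmetric]
proof (rule integral_nonneg)
  show "(\<lambda>s. g (t - s) *\<^sub>R (norm (q t - q s))\<^sup>2) integrable_on {0..t}"
    by (intro integrable_conv g_cont continuous_intros assms)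
qed (simp add: g_nonneg)

lemma conv_inner_right:
  fixes h :: "real \<Rightarrow> 'a::{real_inner,banach}"
  assumes "continuous_on {0..} h"
  shows "conv g (\<lambda>s. x \<bullet> h s) t = x \<bullet> conv g h t"
  by (rule conv_linear[OF g_cont assms bounded_linear_inner_right])

text \<open>Expanding the square identifies the functional differentiated in
  \<open>memory_derivative\<close> as half the memory minus half of \<open>integral {0..t} g\<close>
  times \<open>\<bar>q t\<bar>\<^sup>2\<close>. The subtracted part is what lowers the coefficient
  of \<open>\<bar>S w\<bar>\<^sup>2\<close> in the energy.\<close>

lemma memory_eq:
  fixes q :: "real \<Rightarrow> 'a::{real_inner,banach}"
  assumes q: "continuous_on {0..} q"
  shows "memory q t = integral {0..t} g * (norm (q t))\<^sup>2 - 2 * (q t \<bullet> conv g q t) + conv g (\<lambda>s. (norm (q s))\<^sup>2) t"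
proof -
  have "memory q t = conv g (\<lambda>s. ((norm (q t))\<^sup>2 - (2 *\<^sub>R q t) \<bullet> q s) + (norm (q s))\<^sup>2) t"
    unfolding memory_def conv_def
    unfolding power2_norm_eq_inner
    by (rule integral_cong) (simp add: inner_diff_left inner_diff_right inner_commute)
  also have "\<dots> = conv g (\<lambda>s. (norm (q t))\<^sup>2 - (2 *\<^sub>R q t) \<bullet> q s) t + conv g (\<lambda>s. (norm (q s))\<^sup>2) t"
    by (intro conv_add g_cont continuous_intros q)
  also have "conv g (\<lambda>s. (norm (q t))\<^sup>2 - (2 *\<^sub>R q t) \<bullet> q s) t =
      conv g (\<lambda>s. (norm (q t))\<^sup>2) t - conv g (\<lambda>s. (2 *\<^sub>R q t) \<bullet> q s) t"
    by (intro conv_diff g_cont continuous_intros q)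
  finally show ?thesis
    by (simp only: conv_const[OF g_cont] conv_inner_right[OF q]) simp
qed

text \<open>Differentiating the convolutions leaves, besides \<open>q' \<bullet> conv g q\<close>,
  half of the left side of \<open>memory_dissipation\<close> for
  \<open>h s = \<bar>q s - q t\<bar>\<^sup>2\<close>, which vanishes at \<open>s = t\<close>; a
  nonnegative term \<open>g t * \<bar>q t\<bar>\<^sup>2\<close> is discarded. The term
  \<open>- (q' \<bullet> conv g q)\<close> is made to cancel the memory term of the equation tested
  with \<open>w'\<close>.\<close>

lemma memory_derivative:
  fixes q q' :: "real \<Rightarrow> 'a::{real_inner,banach}"
  assumes q: "\<And>s. s \<ge> 0 \<Longrightarrow> (q has_vector_derivative q' s) (at s within {0..})"
    and q': "continuous_on {0..} q'" and t: "t \<ge> 0"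
  obtains D where
    "((\<lambda>t. conv g (\<lambda>s. (norm (q s))\<^sup>2) t / 2 - q t \<bullet> conv g q t) has_real_derivative D) (at t within {0..})"
    "D \<le> - (q' t \<bullet> conv g q t) - c0 / 2 * memory q t"
proof -
  have qc: "continuous_on {0..} q"
    using q by (rule continuous_on_vector_derivative_atLeast)
  have sq: "((\<lambda>s. (norm (q s - a))\<^sup>2) has_real_derivative 2 * ((q s - a) \<bullet> q' s)) (at s within {0..})"
    if "s \<ge> 0" for s a
  proof -
    have "((\<lambda>s. q s - a) has_vector_derivative q' s) (at s within {0..})"
      by (rule derivative_eq_intros q that refl | simp)+
    from bounded_bilinear.has_vector_derivative[OF bounded_bilinear_inner this this]
    show ?thesis
      by (simp add: power2_norm_eq_inner has_real_derivative_iff_has_vector_derivative inner_commute)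
  qed
  have 1: "(conv g (\<lambda>s. (norm (q s))\<^sup>2) has_vector_derivative
     (g t * (norm (q 0))\<^sup>2 + conv g (\<lambda>s. 2 * (q s \<bullet> q' s)) t)) (at t within {0..})"
  proof -
    have "continuous_on {0..} (\<lambda>s. 2 * (q s \<bullet> q' s))"
      by (intro continuous_intros qc q')
    then show ?thesis
      using has_vector_derivative_conv[OF g_cont, of "\<lambda>s. (norm (q s))\<^sup>2" "\<lambda>s. 2 * (q s \<bullet> q' s)" t] sq[of _ 0] t
      by (simp add: has_real_derivative_iff_has_vector_derivative)
  qed
  have 2: "(conv g q has_vector_derivative (g t *\<^sub>R q 0 + conv g q' t)) (at t within {0..})"
    by (rule has_vector_derivative_conv[OF g_cont q q' t])
  have 3: "((\<lambda>t. q t \<bullet> conv g q t) has_vector_derivative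
      (q t \<bullet> (g t *\<^sub>R q 0 + conv g q' t) + q' t \<bullet> conv g q t)) (at t within {0..})"
    by (rule bounded_bilinear.has_vector_derivative[OF bounded_bilinear_inner q[OF t] 2])
  define D where "D = (g t * (norm (q 0))\<^sup>2 + conv g (\<lambda>s. 2 * (q s \<bullet> q' s)) t) / 2 -
    (q t \<bullet> (g t *\<^sub>R q 0 + conv g q' t) + q' t \<bullet> conv g q t)"
  have "((\<lambda>t. conv g (\<lambda>s. (norm (q s))\<^sup>2) t / 2 - q t \<bullet> conv g q t) has_real_derivative D) (at t within {0..})"
    unfolding D_def
    by (intro DERIV_diff DERIV_cdivide 1[folded has_real_derivative_iff_has_vector_derivative]
        3[folded has_real_derivative_iff_has_vector_derivative])
  moreover have "D \<le> - (q' t \<bullet> conv g q t) - c0 / 2 * memory q t"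
  proof -
    have "conv g (\<lambda>s. (norm (q s - q t))\<^sup>2) t = memory q t"
      by (simp add: memory_def conv_def norm_minus_commute)
    moreover have "continuous_on {0..} (\<lambda>s. 2 * ((q s - q t) \<bullet> q' s))"
      by (intro continuous_intros qc q')
    ultimately have "g t * (norm (q 0 - q t))\<^sup>2 + conv g (\<lambda>s. 2 * ((q s - q t) \<bullet> q' s)) t \<le>
       - c0 * memory q t"
      using memory_dissipation[OF t sq, of "q t"] by simp
    moreover have "conv g (\<lambda>s. 2 * ((q s - q t) \<bullet> q' s)) t =
        conv g (\<lambda>s. 2 * (q s \<bullet> q' s)) t - 2 * (q t \<bullet> conv g q' t)"
    proof -
      have "conv g (\<lambda>s. 2 * ((q s - q t) \<bullet> q' s)) t = conv g (\<lambda>s. 2 * (q s \<bullet> q' s) - (2 *\<^sub>R q t) \<bullet> q' s) t"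
        by (simp add: inner_diff_left algebra_simps)
      also have "\<dots> = conv g (\<lambda>s. 2 * (q s \<bullet> q' s)) t - conv g (\<lambda>s. (2 *\<^sub>R q t) \<bullet> q' s) t"
        by (intro conv_diff g_cont continuous_intros qc q')
      finally show ?thesis by (simp only: conv_inner_right[OF q']) simp
    qed
    moreover have "g t * (norm (q 0 - q t))\<^sup>2 = g t * (norm (q 0))\<^sup>2 - 2 * (g t * (q t \<bullet> q 0)) + g t * (norm (q t))\<^sup>2"
      unfolding power2_norm_eq_inner
      by (simp add: inner_diff_left inner_diff_right inner_commute algebra_simps)
    moreover have "0 \<le> g t * (norm (q t))\<^sup>2" by (simp add: g_nonneg t)
    moreover have "X + Y \<le> - c0 * N \<Longrightarrow> Y = C - 2 * Q \<Longrightarrow> X = A - 2 * B + Z \<Longrightarrow> 0 \<le> Z \<Longrightarrow>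
      (A + C) / 2 - (B + Q + R) \<le> - R - c0 / 2 * N" for X Y N C Q A B Z R :: real
      by (simp add: field_simps)
    ultimately show ?thesis
      unfolding D_def inner_add_right inner_scaleR_right by blast
  qed
  ultimately show ?thesis by (rule that)
qed

text \<open>The difference \<open>q s - q t\<close> is separated from \<open>q s\<close> before
  Young's inequality is used. The part with \<open>integral {0..t} g\<close> stays exact, because it
  must be balanced by \<open>c\<^sup>2 / lam\<close> without loss; the weight \<open>\<mu>\<close>
  makes the other multiple of \<open>\<bar>q t\<bar>\<^sup>2\<close> as small as desired.\<close>

lemma memory_young:
  fixes q :: "real \<Rightarrow> 'a::{real_inner,banach}"
  assumes q: "continuous_on {0..} q" and mu: "\<mu> > 0" and t: "t \<ge> 0"
  shows "q t \<bullet> conv g q t \<le> integral {0..t} g * (norm (q t))\<^sup>2 + memory q t / (2 * \<mu>) + \<mu> / 2 * Gam * (norm (q t))\<^sup>2"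
proof -
  have "q t \<bullet> conv g q t - integral {0..t} g * (norm (q t))\<^sup>2
      = conv g (\<lambda>s. q t \<bullet> q s - (norm (q t))\<^sup>2) t"
    using conv_diff[OF g_cont continuous_on_inner[OF continuous_on_const q] continuous_on_const,
        of "q t" "(norm (q t))\<^sup>2" t]
    by (simp add: conv_inner_right[OF q] conv_const[OF g_cont])
  also have "\<dots> \<le> conv g (\<lambda>s. (1 / (2 * \<mu>)) * (norm (q t - q s))\<^sup>2 + \<mu> / 2 * (norm (q t))\<^sup>2) t"
    unfolding conv_def
  proof (rule integral_le)
    fix s assume s: "s \<in> {0..t}"
    have "0 \<le> (norm ((q t - q s) + \<mu> *\<^sub>R q t))\<^sup>2" by simp
    also have "\<dots> = (norm (q t - q s))\<^sup>2 + 2 * \<mu> * ((norm (q t))\<^sup>2 - q t \<bullet> q s) + \<mu>\<^sup>2 * (norm (q t))\<^sup>2"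
      unfolding power2_norm_eq_inner
      by (simp add: inner_commute[of "q s" "q t"] inner_add_left inner_diff_left inner_add_right inner_diff_right
          algebra_simps power2_eq_square del: dot_square_norm)
    finally have "0 \<le> (norm (q t - q s))\<^sup>2 + 2 * \<mu> * ((norm (q t))\<^sup>2 - q t \<bullet> q s) + \<mu>\<^sup>2 * (norm (q t))\<^sup>2" .
    moreover have "0 \<le> a + 2 * \<mu> * (b - c) + \<mu>\<^sup>2 * b \<Longrightarrow> c - b \<le> (1 / (2 * \<mu>)) * a + \<mu> / 2 * b" for a b c
      using mu by (simp add: field_simps power2_eq_square)
    ultimately have "(q t \<bullet> q s - (norm (q t))\<^sup>2) \<le> (1 / (2 * \<mu>)) * (norm (q t - q s))\<^sup>2 + \<mu> / 2 * (norm (q t))\<^sup>2"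
      by blast
    then show "g (t - s) *\<^sub>R (q t \<bullet> q s - (norm (q t))\<^sup>2) \<le>
      g (t - s) *\<^sub>R ((1 / (2 * \<mu>)) * (norm (q t - q s))\<^sup>2 + \<mu> / 2 * (norm (q t))\<^sup>2)"
      using g_nonneg[of "t - s"] s by (simp add: mult_left_mono)
  qed (intro integrable_conv g_cont continuous_intros q)+
  also have "\<dots> = (1 / (2 * \<mu>)) * memory q t + integral {0..t} g * (\<mu> / 2 * (norm (q t))\<^sup>2)"
  proof -
    have "conv g (\<lambda>s. (1 / (2 * \<mu>)) * (norm (q t - q s))\<^sup>2) t = (1 / (2 * \<mu>)) * conv g (\<lambda>s. (norm (q t - q s))\<^sup>2) t"
      by (rule conv_linear[OF g_cont _ bounded_linear_mult_right]) (intro continuous_intros q)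
    moreover have "conv g (\<lambda>s. (norm (q t - q s))\<^sup>2) t = memory q t"
      by (simp add: conv_def memory_def)
    moreover have "conv g (\<lambda>s. (1 / (2 * \<mu>)) * (norm (q t - q s))\<^sup>2 + \<mu> / 2 * (norm (q t))\<^sup>2) t =
      conv g (\<lambda>s. (1 / (2 * \<mu>)) * (norm (q t - q s))\<^sup>2) t + conv g (\<lambda>s. \<mu> / 2 * (norm (q t))\<^sup>2) t"
      by (intro conv_add g_cont continuous_intros q)
    ultimately show ?thesis
      using conv_const[OF g_cont, of "\<mu> / 2 * (norm (q t))\<^sup>2" t] by simp
  qed
  also have "\<dots> \<le> memory q t / (2 * \<mu>) + \<mu> / 2 * Gam * (norm (q t))\<^sup>2"
    using mult_right_mono[OF G_le[OF t], of "\<mu> / 2 * (norm (q t))\<^sup>2"] mu by (simp add: algebra_simps)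
  finally show ?thesis by simp
qed

end

section \<open>The energy estimate\<close>

lemma young_real:
  fixes x y e :: real
  assumes "e > 0"
  shows "x * y \<le> e * x\<^sup>2 + y\<^sup>2 / (4 * e)"
proof -
  have "0 \<le> (2 * e * x - y)\<^sup>2 / (4 * e)" using assms by simp
  also have "\<dots> = e * x\<^sup>2 + y\<^sup>2 / (4 * e) - x * y"
    using assms by (simp add: field_simps power2_eq_square)
  finally show ?thesis by simp
qed

lemma square_sum_le:
  fixes x y z :: real
  assumes "0 \<le> z" "z \<le> x + y"
  shows "z\<^sup>2 \<le> 2 * x\<^sup>2 + 2 * y\<^sup>2"
proof -
  have "z\<^sup>2 \<le> (x + y)\<^sup>2" using assms by (intro power_mono) auto
  also have "\<dots> \<le> 2 * x\<^sup>2 + 2 * y\<^sup>2"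
    using sum_squares_bound[of x y] by (simp add: power2_sum)
  finally show ?thesis .
qed

text \<open>Subtracting the equilibrium \<open>K / om\<close> makes the inequality homogeneous, so
  \<open>exp (om * t) * (L t - K / om)\<close> is nonincreasing.\<close>

lemma gronwall_exp:
  fixes L :: "real \<Rightarrow> real"
  assumes L: "\<And>t. t \<ge> 0 \<Longrightarrow> \<exists>D. (L has_real_derivative D) (at t within {0..}) \<and> D \<le> - om * L t + K"
    and om: "om > 0" and t: "t \<ge> 0" and K: "K \<ge> 0"
  shows "L t \<le> L 0 * exp (- om * t) + K / om"
proof -
  define E where "E = (\<lambda>t. exp (om * t) * (L t - K / om))"
  have "E 0 \<ge> E t"
  proof (rule DERIV_nonpos_imp_decreasing_open[OF t])
    fix s assume s: "0 < s" "s < t"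
    obtain D where D: "(L has_real_derivative D) (at s within {0..})" "D \<le> - om * L s + K"
      using L[of s] s by auto
    have "at s within {0..} = at s" using s by (intro at_within_interior) auto
    with D have Ds: "(L has_real_derivative D) (at s)" by simp
    have "(E has_real_derivative (exp (om * s) * om * (L s - K / om) + exp (om * s) * D)) (at s)"
    proof -
      have "((\<lambda>t. exp (om * t)) has_real_derivative exp (om * s) * om) (at s)"
        by (auto intro!: derivative_eq_intros)
      moreover have "((\<lambda>t. L t - K / om) has_real_derivative D) (at s)"
        using DERIV_diff[OF Ds DERIV_const] by simp
      ultimately show ?thesis
        unfolding E_def mult.commute[of "exp (om * s)" D] by (rule DERIV_mult)
    qed
    moreover have "exp (om * s) * om * (L s - K / om) + exp (om * s) * D = exp (om * s) * (om * L s - K + D)"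
      using om by (simp add: algebra_simps)
    moreover have "\<dots> \<le> 0" using D(2) by (simp add: mult_nonneg_nonpos)
    ultimately show "\<exists>y. (E has_real_derivative y) (at s) \<and> y \<le> 0" by metis
  next
    have "continuous_on {0..} L"
      unfolding continuous_on_eq_continuous_within
    proof
      fix s :: real assume "s \<in> {0..}"
      then obtain D where "(L has_real_derivative D) (at s within {0..})" using L[of s] by auto
      then show "continuous (at s within {0..}) L" by (rule DERIV_continuous)
    qed
    then have "continuous_on {0..t} L" by (rule continuous_on_subset) auto
    then show "continuous_on {0..t} E"
      unfolding E_def by (intro continuous_intros)
  qed
  then have "exp (om * t) * (L t - K / om) \<le> L 0 - K / om" by (simp add: E_def)
  also have "\<dots> \<le> L 0" using K om by simp
  finally have "exp (- om * t) * (exp (om * t) * (L t - K / om)) \<le> exp (- om * t) * L 0"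
    by (intro mult_left_mono) auto
  moreover have e1: "exp (- om * t) * (exp (om * t) * x) = x" for x
    by (simp flip: exp_add mult.assoc)
  ultimately have "L t - K / om \<le> exp (- om * t) * L 0" by (simp only: e1)
  then show ?thesis by (simp add: mult.commute)
qed


section \<open>Energy, Lyapunov functional and dissipation\<close>

locale mgt_memory = memory_kernel +
  fixes tau alpha b c lam :: real
  assumes tau_pos: "tau > 0" and lam_pos: "lam > 0" and lam_tau: "lam * tau < alpha"
    and b_gt: "c\<^sup>2 / lam < b" and Gam_less: "Gam < c\<^sup>2 / lam"
begin

text \<open>This is \<open>F3\<close> with the images under \<open>S\<close> supplied as separate
  functions, so that it applies equally to solutions regularised or approximated by bounded
  operators.\<close>

definition energy :: "(real \<Rightarrow> 'a::real_inner) \<Rightarrow> (real \<Rightarrow> 'a) \<Rightarrow> (real \<Rightarrow> 'a) \<Rightarrow> real \<Rightarrow> real" where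
  "energy p pd vdd t = (norm (pd t))\<^sup>2 + (norm (p t))\<^sup>2 + (norm (vdd t))\<^sup>2
     + memory (\<lambda>s. lam *\<^sub>R p s + pd s) t"

text \<open>In applications \<open>p\<close>, \<open>pd\<close>, \<open>pdd\<close> are the images of \<open>v\<close>, \<open>v'\<close>, \<open>v''\<close> under the square
  root of the operator (or an approximation of it), and \<open>k\<close> is a Poincare constant.
  The equation is only tested with \<open>w'\<close> and \<open>w\<close>, where \<open>w = lam v + v'\<close>.\<close>

definition strong_sol ::
  "real \<Rightarrow> (real \<Rightarrow> 'a::real_inner) \<Rightarrow> (real \<Rightarrow> 'a) \<Rightarrow> (real \<Rightarrow> 'a) \<Rightarrow> (real \<Rightarrow> 'a) \<Rightarrow> (real \<Rightarrow> 'a) \<Rightarrow>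
   (real \<Rightarrow> 'a) \<Rightarrow> (real \<Rightarrow> 'a) \<Rightarrow> (real \<Rightarrow> 'a) \<Rightarrow> bool" where
  "strong_sol k f v vd vdd vddd p pd pdd \<longleftrightarrow>
     (\<forall>t\<ge>0. (v has_vector_derivative vd t) (at t within {0..}) \<and>
            (vd has_vector_derivative vdd t) (at t within {0..}) \<and>
            (vdd has_vector_derivative vddd t) (at t within {0..}) \<and>
            (p has_vector_derivative pd t) (at t within {0..}) \<and>
            (pd has_vector_derivative pdd t) (at t within {0..}) \<and>
            norm (vd t) \<le> k * norm (pd t) \<and>
            norm (lam *\<^sub>R v t + vd t) \<le> k * norm (lam *\<^sub>R p t + pd t) \<and>
            (tau *\<^sub>R vddd t + alpha *\<^sub>R vdd t - f t) \<bullet> (lam *\<^sub>R vd t + vdd t)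
              + (c\<^sup>2 *\<^sub>R p t + b *\<^sub>R pd t - conv g (\<lambda>s. lam *\<^sub>R p s + pd s) t) \<bullet> (lam *\<^sub>R pd t + pdd t) = 0 \<and>
            (tau *\<^sub>R vddd t + alpha *\<^sub>R vdd t - f t) \<bullet> (lam *\<^sub>R v t + vd t)
              + (c\<^sup>2 *\<^sub>R p t + b *\<^sub>R pd t - conv g (\<lambda>s. lam *\<^sub>R p s + pd s) t) \<bullet> (lam *\<^sub>R p t + pd t) = 0) \<and>
     continuous_on {0..} pdd"

text \<open>In terms of \<open>w\<close> the equation reads \<open>tau w'' + eta u'' + (c\<^sup>2 /
  lam) A w + del A u' - g * A w = 0\<close>, with \<open>*\<close> the convolution.
  \<open>kap\<close> is what the memory leaves of the coefficient of
  \<open>\<bar>S w\<bar>\<^sup>2\<close> in the worst case.\<close>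

definition "eta = alpha - lam * tau"
definition "del = b - c\<^sup>2 / lam"
definition "kap = c\<^sup>2 / lam - Gam"

lemma const_pos: "eta > 0" "del > 0" "kap > 0" "c\<^sup>2 / lam > 0"
  using lam_tau b_gt Gam_less Gam_nonneg by (auto simp: eta_def del_def kap_def)

text \<open>The first five summands decrease along solutions up to forcing; the last one is the
  perturbation that makes the dissipation control \<open>q\<close> as well.\<close>

definition lyapunov :: "real \<Rightarrow> (real \<Rightarrow> 'a::real_inner) \<Rightarrow> (real \<Rightarrow> 'a) \<Rightarrow> (real \<Rightarrow> 'a) \<Rightarrow> (real \<Rightarrow> 'a) \<Rightarrow> (real \<Rightarrow> 'a) \<Rightarrow> real \<Rightarrow> real" where
  "lyapunov \<epsilon> v vd vdd p pd t =
     tau / 2 * (norm (lam *\<^sub>R vd t + vdd t))\<^sup>2 + c\<^sup>2 / lam / 2 * (norm (lam *\<^sub>R p t + pd t))\<^sup>2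
     + del / 2 * (norm (pd t))\<^sup>2 + lam * eta / 2 * (norm (vd t))\<^sup>2
     + (conv g (\<lambda>s. (norm (lam *\<^sub>R p s + pd s))\<^sup>2) t / 2
        - (lam *\<^sub>R p t + pd t) \<bullet> conv g (\<lambda>s. lam *\<^sub>R p s + pd s) t)
     + \<epsilon> * (tau * ((lam *\<^sub>R vd t + vdd t) \<bullet> (lam *\<^sub>R v t + vd t)))"

text \<open>Every term is differentiated exactly, except the memory functional, for which only an
  upper bound is available. The tested identities eliminate \<open>w''\<close>: pairing with
  \<open>w'\<close> serves the energy part and pairing with \<open>w\<close> the
  perturbation.\<close>

lemma lyapunov_derivative:
  fixes v vd vdd vddd p pd pdd f :: "real \<Rightarrow> 'a::{real_inner,banach}"
  assumes sol: "strong_sol k f v vd vdd vddd p pd pdd" and t: "t \<ge> 0"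
  obtains D where
    "(lyapunov \<epsilon> v vd vdd p pd has_real_derivative D) (at t within {0..})"
    "D \<le> f t \<bullet> (lam *\<^sub>R vd t + vdd t) - eta * (norm (vdd t))\<^sup>2 - del * lam * (norm (pd t))\<^sup>2
       - c0 / 2 * memory (\<lambda>s. lam *\<^sub>R p s + pd s) t
       + \<epsilon> * (tau * (norm (lam *\<^sub>R vd t + vdd t))\<^sup>2 + f t \<bullet> (lam *\<^sub>R v t + vd t)
          - eta * (vdd t \<bullet> (lam *\<^sub>R v t + vd t)) - c\<^sup>2 / lam * (norm (lam *\<^sub>R p t + pd t))\<^sup>2
          - del * (pd t \<bullet> (lam *\<^sub>R p t + pd t))
          + (lam *\<^sub>R p t + pd t) \<bullet> conv g (\<lambda>s. lam *\<^sub>R p s + pd s) t)"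
proof -
  define w wd wdd q qd where "w = (\<lambda>t. lam *\<^sub>R v t + vd t)" and "wd = (\<lambda>t. lam *\<^sub>R vd t + vdd t)"
    and "wdd = (\<lambda>t. lam *\<^sub>R vdd t + vddd t)" and "q = (\<lambda>t. lam *\<^sub>R p t + pd t)"
    and "qd = (\<lambda>t. lam *\<^sub>R pd t + pdd t)"
  note defs = w_def wd_def wdd_def q_def qd_def
  define m where "m = conv g q t"
  note s = sol[unfolded strong_sol_def]
  have vd: "(vd has_vector_derivative vdd t) (at t within {0..})"
    and pd: "(pd has_vector_derivative pdd t) (at t within {0..})"
    using s t by auto
  have w: "(w has_vector_derivative wd t) (at t within {0..})"
    unfolding defs using s t
    by (intro has_vector_derivative_add bounded_linear.has_vector_derivative[OF bounded_linear_scaleR_right]) auto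
  have wd: "(wd has_vector_derivative wdd t) (at t within {0..})"
    unfolding defs using s t
    by (intro has_vector_derivative_add bounded_linear.has_vector_derivative[OF bounded_linear_scaleR_right]) auto
  have q: "(q has_vector_derivative qd t) (at t within {0..})" if "t \<ge> 0" for t
    unfolding defs using s that
    by (intro has_vector_derivative_add bounded_linear.has_vector_derivative[OF bounded_linear_scaleR_right]) auto
  have qdc: "continuous_on {0..} qd"
    unfolding defs using s
    by (intro continuous_intros continuous_on_vector_derivative_atLeast[of pd pdd]) auto
  obtain D0 where D0: "((\<lambda>t. conv g (\<lambda>s. (norm (q s))\<^sup>2) t / 2 - q t \<bullet> conv g q t) has_real_derivative D0) (at t within {0..})"
    "D0 \<le> - (qd t \<bullet> conv g q t) - c0 / 2 * memory q t"
    using memory_derivative[OF q qdc t] by blast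
  have sq: "((\<lambda>s. (norm (x s))\<^sup>2) has_real_derivative 2 * (x t \<bullet> x')) (at t within {0..})"
    if "(x has_vector_derivative x') (at t within {0..})" for x :: "real \<Rightarrow> 'a" and x'
    unfolding power2_norm_eq_inner has_real_derivative_iff_has_vector_derivative
    using bounded_bilinear.has_vector_derivative[OF bounded_bilinear_inner that that]
    by (simp add: inner_commute)
  have wdw: "((\<lambda>s. wd s \<bullet> w s) has_real_derivative (wd t \<bullet> wd t + wdd t \<bullet> w t)) (at t within {0..})"
    unfolding has_real_derivative_iff_has_vector_derivative
    by (rule bounded_bilinear.has_vector_derivative[OF bounded_bilinear_inner wd w])
  define D where "D = tau / 2 * (2 * (wd t \<bullet> wdd t)) + c\<^sup>2 / lam / 2 * (2 * (q t \<bullet> qd t)) + del / 2 * (2 * (pd t \<bullet> pdd t))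
    + lam * eta / 2 * (2 * (vd t \<bullet> vdd t)) + D0 + \<epsilon> * (tau * (wd t \<bullet> wd t + wdd t \<bullet> w t))"
  have lyap: "lyapunov \<epsilon> v vd vdd p pd = (\<lambda>t. tau / 2 * (norm (wd t))\<^sup>2 + c\<^sup>2 / lam / 2 * (norm (q t))\<^sup>2
     + del / 2 * (norm (pd t))\<^sup>2 + lam * eta / 2 * (norm (vd t))\<^sup>2
     + (conv g (\<lambda>s. (norm (q s))\<^sup>2) t / 2 - q t \<bullet> conv g q t) + \<epsilon> * (tau * (wd t \<bullet> w t)))"
    by (simp add: lyapunov_def defs fun_eq_iff)
  have "(lyapunov \<epsilon> v vd vdd p pd has_real_derivative D) (at t within {0..})"
    unfolding lyap D_def
    by (intro DERIV_add DERIV_cmult D0(1) sq wd q t pd vd wdw)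
  moreover have "D \<le> f t \<bullet> wd t - eta * (norm (vdd t))\<^sup>2 - del * lam * (norm (pd t))\<^sup>2
       - c0 / 2 * memory q t + \<epsilon> * (tau * (norm (wd t))\<^sup>2 + f t \<bullet> w t - eta * (vdd t \<bullet> w t)
        - c\<^sup>2 / lam * (norm (q t))\<^sup>2 - del * (pd t \<bullet> q t) + q t \<bullet> m)"
  proof -
    have "tau *\<^sub>R vddd t + alpha *\<^sub>R vdd t - f t = tau *\<^sub>R wdd t + eta *\<^sub>R vdd t - f t"
      by (simp add: defs eta_def algebra_simps)
    moreover have "c\<^sup>2 *\<^sub>R p t + b *\<^sub>R pd t - m = (c\<^sup>2 / lam) *\<^sub>R q t + del *\<^sub>R pd t - m"
      using lam_pos by (simp add: defs del_def algebra_simps)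
    moreover have "(tau *\<^sub>R vddd t + alpha *\<^sub>R vdd t - f t) \<bullet> wd t + (c\<^sup>2 *\<^sub>R p t + b *\<^sub>R pd t - m) \<bullet> qd t = 0"
      "(tau *\<^sub>R vddd t + alpha *\<^sub>R vdd t - f t) \<bullet> w t + (c\<^sup>2 *\<^sub>R p t + b *\<^sub>R pd t - m) \<bullet> q t = 0"
      using s t unfolding defs m_def by auto
    ultimately have e: "(tau *\<^sub>R wdd t + eta *\<^sub>R vdd t - f t) \<bullet> wd t + ((c\<^sup>2 / lam) *\<^sub>R q t + del *\<^sub>R pd t - m) \<bullet> qd t = 0"
      "(tau *\<^sub>R wdd t + eta *\<^sub>R vdd t - f t) \<bullet> w t + ((c\<^sup>2 / lam) *\<^sub>R q t + del *\<^sub>R pd t - m) \<bullet> q t = 0"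
      by simp_all
    \<comment> \<open>Splitting \<open>w'\<close> and its image here releases the dissipation
      \<open>eta \<bar>u''\<bar>\<^sup>2\<close> and
      \<open>del lam \<bar>S u'\<bar>\<^sup>2\<close>; what remains are derivatives of quadratic
      terms already present in the functional.\<close>
    have v1: "vdd t \<bullet> wd t = lam * (vd t \<bullet> vdd t) + (norm (vdd t))\<^sup>2"
      unfolding power2_norm_eq_inner defs by (simp add: inner_add_right inner_commute del: dot_square_norm)
    have v2: "pd t \<bullet> qd t = lam * (norm (pd t))\<^sup>2 + pd t \<bullet> pdd t"
      unfolding power2_norm_eq_inner defs by (simp add: inner_add_right inner_commute del: dot_square_norm)
    have e1: "tau * (wd t \<bullet> wdd t) = f t \<bullet> wd t - eta * (lam * (vd t \<bullet> vdd t) + (norm (vdd t))\<^sup>2)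
        - c\<^sup>2 / lam * (q t \<bullet> qd t) - del * (lam * (norm (pd t))\<^sup>2 + pd t \<bullet> pdd t) + qd t \<bullet> m"
      using e(1) unfolding inner_add_left inner_diff_left inner_scaleR_left v1 v2
      by (simp add: inner_commute algebra_simps)
    have e2: "tau * (wdd t \<bullet> w t) = f t \<bullet> w t - eta * (vdd t \<bullet> w t)
        - c\<^sup>2 / lam * (norm (q t))\<^sup>2 - del * (pd t \<bullet> q t) + q t \<bullet> m"
      using e(2) unfolding inner_add_left inner_diff_left inner_scaleR_left power2_norm_eq_inner
      by (simp add: inner_commute algebra_simps del: dot_square_norm)
    have "D = f t \<bullet> wd t - eta * (norm (vdd t))\<^sup>2 - del * lam * (norm (pd t))\<^sup>2 + qd t \<bullet> m + D0
       + \<epsilon> * (tau * (norm (wd t))\<^sup>2 + tau * (wdd t \<bullet> w t))"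
      using e1 unfolding D_def by (simp add: dot_square_norm algebra_simps)
    then show ?thesis using D0(2) unfolding e2 m_def by (simp add: algebra_simps)
  qed
  ultimately show ?thesis
    using that unfolding defs m_def by blast
qed


text \<open>Coercivity as an inequality between real numbers: \<open>W = \<bar>w'\<bar>\<close>,
  \<open>Q = \<bar>S w\<bar>\<close>, \<open>P = \<bar>S u'\<bar>\<close>,
  \<open>Y = \<bar>u''\<bar>\<close>, \<open>N\<close> is the memory,
  \<open>Z = w' \<bullet> w\<close> and \<open>G\<close> the mass of \<open>g\<close> up to the
  current time. The cross term \<open>Z\<close> costs at most half of the \<open>W\<close> term and
  half of \<open>kap / 2 * Q\<^sup>2\<close>; \<open>Y\<close> is recovered from \<open>W\<close>
  and \<open>P\<close> by the triangle inequality, whence the factor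
  \<open>1 + 2 * (lam * k)\<^sup>2\<close>.\<close>

lemma lyapunov_lower:
  fixes W Q P Y N Z G k \<epsilon> :: real
  assumes k: "k > 0" and eps: "0 < \<epsilon>" "\<epsilon> \<le> 1/2" "\<epsilon> * (tau * k\<^sup>2) \<le> kap / 2"
    and nn: "0 \<le> W" "0 \<le> Q" "0 \<le> P" "0 \<le> Y" "0 \<le> N" and G: "G \<le> Gam"
    and Z: "\<bar>Z\<bar> \<le> W * (k * Q)" and Y: "Y \<le> W + lam * k * P"
  shows "min (min (kap / 4) (tau / 8)) (min (del / (2 * (1 + 2 * (lam * k)\<^sup>2))) (1/2)) * (Q\<^sup>2 + P\<^sup>2 + Y\<^sup>2 + N)
     \<le> tau / 2 * W\<^sup>2 + (c\<^sup>2 / lam - G) / 2 * Q\<^sup>2 + del / 2 * P\<^sup>2 + N / 2 + \<epsilon> * (tau * Z)"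
    (is "?a * _ \<le> ?L")
proof -
  have a: "?a \<le> kap / 4" "?a \<le> tau / 8" "?a \<le> del / (2 * (1 + 2 * (lam * k)\<^sup>2))" "?a \<le> 1/2"
    by (simp_all only: min_le_iff_disj order_refl simp_thms)
  have pos: "1 + 2 * (lam * k)\<^sup>2 > 0" by (simp add: add_pos_nonneg)
  have a0: "0 < ?a" using const_pos tau_pos pos by simp
  have "- (\<epsilon> * (tau * Z)) \<le> \<epsilon> * (tau * (W * (k * Q)))"
  proof -
    have "- Z \<le> W * (k * Q)" using Z by simp
    then have "\<epsilon> * tau * (- Z) \<le> \<epsilon> * tau * (W * (k * Q))"
      using eps tau_pos by (intro mult_left_mono) auto
    then show ?thesis by (simp add: algebra_simps)
  qed
  also have "\<dots> \<le> \<epsilon> * (tau * (W\<^sup>2 / 2 + (k * Q)\<^sup>2 / 2))"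
    using sum_squares_bound[of W "k * Q"] eps tau_pos by (intro mult_left_mono) auto
  also have "\<dots> = \<epsilon> * (tau / 2 * W\<^sup>2) + \<epsilon> * (tau * k\<^sup>2) * (Q\<^sup>2 / 2)"
    by (simp add: power_mult_distrib algebra_simps)
  also have "\<dots> \<le> 1/2 * (tau / 2 * W\<^sup>2) + kap / 2 * (Q\<^sup>2 / 2)"
    using eps tau_pos by (intro add_mono mult_right_mono) auto
  finally have 1: "- (\<epsilon> * (tau * Z)) \<le> tau / 4 * W\<^sup>2 + kap / 4 * Q\<^sup>2" by simp
  have "kap * Q\<^sup>2 \<le> (c\<^sup>2 / lam - G) * Q\<^sup>2"
    using G by (intro mult_right_mono) (auto simp: kap_def)
  then have 2: "kap / 2 * Q\<^sup>2 \<le> (c\<^sup>2 / lam - G) / 2 * Q\<^sup>2" by simp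
  have Y2: "Y\<^sup>2 \<le> 2 * W\<^sup>2 + 2 * ((lam * k)\<^sup>2 * P\<^sup>2)"
    using square_sum_le[OF nn(4) Y] by (simp add: power_mult_distrib)
  have "?a * (Q\<^sup>2 + P\<^sup>2 + Y\<^sup>2 + N) \<le> ?a * (Q\<^sup>2 + (1 + 2 * (lam * k)\<^sup>2) * P\<^sup>2 + 2 * W\<^sup>2 + N)"
  proof (rule mult_left_mono)
    show "Q\<^sup>2 + P\<^sup>2 + Y\<^sup>2 + N \<le> Q\<^sup>2 + (1 + 2 * (lam * k)\<^sup>2) * P\<^sup>2 + 2 * W\<^sup>2 + N"
      using Y2 by (simp add: algebra_simps)
  qed (use a0 in linarith)
  also have "\<dots> = ?a * Q\<^sup>2 + ?a * (1 + 2 * (lam * k)\<^sup>2) * P\<^sup>2 + ?a * 2 * W\<^sup>2 + ?a * N"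
  proof -
    have "x * (q + y * p + 2 * w + n) = x * q + x * y * p + x * 2 * w + x * n" for x y q p w n :: real
      by (simp add: algebra_simps)
    then show ?thesis .
  qed
  also have "\<dots> \<le> kap / 4 * Q\<^sup>2 + del / 2 * P\<^sup>2 + tau / 4 * W\<^sup>2 + 1/2 * N"
  proof (intro add_mono mult_right_mono)
    show "?a * (1 + 2 * (lam * k)\<^sup>2) \<le> del / 2"
    proof -
      have "?a * (1 + 2 * (lam * k)\<^sup>2) \<le> del / (2 * (1 + 2 * (lam * k)\<^sup>2)) * (1 + 2 * (lam * k)\<^sup>2)"
        by (rule mult_right_mono[OF a(3)]) (use pos in simp)
      also have "x > 0 \<Longrightarrow> del / (2 * x) * x = del / 2" for x by simp
      from this[OF pos] have "del / (2 * (1 + 2 * (lam * k)\<^sup>2)) * (1 + 2 * (lam * k)\<^sup>2) = del / 2" .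
      finally show ?thesis .
    qed
    show "?a * 2 \<le> tau / 4" using mult_right_mono[OF a(2), of 2] by simp
  qed (rule a nn zero_le_power2)+
  also have "\<dots> \<le> ?L" using 1 2 by argo
  finally show ?thesis .
qed

text \<open>Letters as in \<open>lyapunov_lower\<close>, with \<open>V = \<bar>u'\<bar>\<close>.
  Here \<open>W\<close> is traded for \<open>P\<close> and \<open>Y\<close>, and \<open>V\<close>
  for \<open>P\<close> by the Poincare inequality; the constant is a crude sum of all coefficients
  that occur.\<close>

lemma lyapunov_upper:
  fixes W Q P Y N Z G k \<epsilon> :: real
  assumes k: "k > 0" and eps: "0 < \<epsilon>" "\<epsilon> \<le> 1/2"
    and nn: "0 \<le> W" "0 \<le> Q" "0 \<le> P" "0 \<le> Y" "0 \<le> N" "0 \<le> V" and G: "0 \<le> G"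
    and Z: "\<bar>Z\<bar> \<le> W * (k * Q)" and V: "V \<le> k * P" and W: "W \<le> lam * k * P + Y"
  shows "tau / 2 * W\<^sup>2 + (c\<^sup>2 / lam - G) / 2 * Q\<^sup>2 + del / 2 * P\<^sup>2 + lam * eta / 2 * V\<^sup>2 + N / 2 + \<epsilon> * (tau * Z)
    \<le> (2 * tau * (lam * k)\<^sup>2 + 2 * tau + c\<^sup>2 / lam + tau * k\<^sup>2 + del + lam * eta * k\<^sup>2 + 1) * (Q\<^sup>2 + P\<^sup>2 + Y\<^sup>2 + N)"
    (is "?L \<le> ?a * ?X")
proof -
  have "tau * Z \<le> tau * (W * (k * Q))"
    using Z tau_pos by (intro mult_left_mono) auto
  also have "\<dots> \<le> tau * (W\<^sup>2 / 2 + (k * Q)\<^sup>2 / 2)"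
    using sum_squares_bound[of W "k * Q"] tau_pos by (intro mult_left_mono) auto
  finally have Z': "tau * Z \<le> tau * (W\<^sup>2 / 2 + (k * Q)\<^sup>2 / 2)" .
  have "\<epsilon> * (tau * Z) \<le> \<epsilon> * (tau * (W\<^sup>2 / 2 + (k * Q)\<^sup>2 / 2))"
    by (rule mult_left_mono[OF Z']) (use eps in simp)
  also have "\<dots> \<le> 1 * (tau * (W\<^sup>2 / 2 + (k * Q)\<^sup>2 / 2))"
    using eps tau_pos by (intro mult_right_mono) auto
  finally have 1: "\<epsilon> * (tau * Z) \<le> tau / 2 * W\<^sup>2 + tau * k\<^sup>2 / 2 * Q\<^sup>2"
    by (simp add: power_mult_distrib algebra_simps)
  have "tau * W\<^sup>2 \<le> tau * (2 * ((lam * k)\<^sup>2 * P\<^sup>2) + 2 * Y\<^sup>2)"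
    using square_sum_le[OF nn(1) W] tau_pos by (intro mult_left_mono) (auto simp: power_mult_distrib)
  then have 2: "tau * W\<^sup>2 \<le> 2 * tau * (lam * k)\<^sup>2 * P\<^sup>2 + 2 * tau * Y\<^sup>2"
    by (simp add: algebra_simps)
  have "lam * eta / 2 * V\<^sup>2 \<le> lam * eta / 2 * (k * P)\<^sup>2"
    using V nn lam_pos const_pos by (intro mult_left_mono power_mono) auto
  then have 3: "lam * eta / 2 * V\<^sup>2 \<le> lam * eta * k\<^sup>2 / 2 * P\<^sup>2"
    by (simp add: power_mult_distrib algebra_simps)
  have 4: "(c\<^sup>2 / lam - G) / 2 * Q\<^sup>2 \<le> c\<^sup>2 / lam / 2 * Q\<^sup>2"
    using G by (intro mult_right_mono) auto
  have "?L \<le> (c\<^sup>2 / lam / 2 + tau * k\<^sup>2 / 2) * Q\<^sup>2 + (2 * tau * (lam * k)\<^sup>2 + del / 2 + lam * eta * k\<^sup>2 / 2) * P\<^sup>2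
      + 2 * tau * Y\<^sup>2 + 1/2 * N"
  proof -
    have "z \<le> tau / 2 * X + a1 \<Longrightarrow> tau * X \<le> a2 \<Longrightarrow> y \<le> a3 \<Longrightarrow> x \<le> a4 \<Longrightarrow>
      tau / 2 * X + x + a5 + y + a6 + z \<le> a4 + a1 + (a2 + a5 + a3) + a6" for a1 a2 a3 a4 a5 a6 x y z X :: real
      by simp
    from this[OF 1 2 3 4, of "del / 2 * P\<^sup>2" "N / 2"] show ?thesis unfolding distrib_right by simp
  qed
  also have "\<dots> \<le> ?a * Q\<^sup>2 + ?a * P\<^sup>2 + ?a * Y\<^sup>2 + ?a * N"
  proof -
    have "0 \<le> tau * (lam * k)\<^sup>2" "0 \<le> tau * k\<^sup>2" "0 \<le> lam * eta * k\<^sup>2" "0 \<le> tau" "0 \<le> del" "0 \<le> c\<^sup>2 / lam"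
      using tau_pos lam_pos const_pos by auto
    moreover define a where "a = ?a"
    ultimately have "c\<^sup>2 / lam / 2 + tau * k\<^sup>2 / 2 \<le> a" "2 * tau * (lam * k)\<^sup>2 + del / 2 + lam * eta * k\<^sup>2 / 2 \<le> a"
      "2 * tau \<le> a" "1/2 \<le> a"
      by argo+
    then show ?thesis
      unfolding a_def[symmetric] using nn(5) by (intro add_mono mult_right_mono zero_le_power2)
  qed
  also have "\<dots> = ?a * ?X" by (simp only: distrib_left)
  finally show ?thesis .
qed

text \<open>The weight for which the Young error of the memory term costs at most
  \<open>kap / 4\<close>; the summand 1 keeps the quotient meaningful when
  \<open>Gam = 0\<close>.\<close>

definition "young_mu = kap / (2 * (Gam + 1))"

text \<open>Sum of the coefficients of \<open>P\<^sup>2\<close>, \<open>Y\<^sup>2\<close>,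
  \<open>N\<close> and \<open>F\<^sup>2\<close> that remain when the cross terms of the perturbation
  are absorbed into multiples of \<open>\<bar>S w\<bar>\<^sup>2\<close>; the factors
  \<open>3 / kap\<close> come from Young's inequality with weight \<open>kap / 12\<close>.\<close>

definition dissip_const :: "real \<Rightarrow> real" where
  "dissip_const k = 2 * tau * (lam * k)\<^sup>2 + 3 * del\<^sup>2 / kap + 2 * tau + 3 * (eta * k)\<^sup>2 / kap
     + 1 / (2 * young_mu) + 3 * k\<^sup>2 / kap"

lemma young_mu_pos: "young_mu > 0"
  using const_pos Gam_nonneg by (simp add: young_mu_def)

lemma young_mu_bound: "young_mu / 2 * Gam \<le> kap / 4"
proof -
  have "young_mu / 2 * Gam \<le> young_mu / 2 * (Gam + 1)"
    using young_mu_pos by simp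
  also have "\<dots> = kap / 4" using Gam_nonneg by (simp add: young_mu_def field_simps)
  finally show ?thesis .
qed

lemma dissip_const_pos: "dissip_const k > 0"
proof -
  have "0 \<le> 2 * tau * (lam * k)\<^sup>2" "0 \<le> 3 * del\<^sup>2 / kap" "0 \<le> 3 * (eta * k)\<^sup>2 / kap"
    "0 < 1 / (2 * young_mu)" "0 \<le> 3 * k\<^sup>2 / kap"
    using const_pos young_mu_pos tau_pos by (auto intro!: divide_nonneg_pos)
  then show ?thesis unfolding dissip_const_def using tau_pos by linarith
qed

text \<open>Budget argument. Of the dissipation in \<open>P\<close> and \<open>Y\<close>, half
  absorbs the forcing paired with \<open>w'\<close>, a quarter the perturbation errors of size
  \<open>\<epsilon> * C2\<close>, and a quarter survives; the memory dissipation is split evenly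
  between these errors and the final bound. Further letters: \<open>F = \<bar>f\<bar>\<close>,
  \<open>fwd = f \<bullet> w'\<close>, \<open>fw = f \<bullet> w\<close>,
  \<open>yw = u'' \<bullet> w\<close>, \<open>pq = S u' \<bullet> S w\<close>, and \<open>mq\<close>
  is \<open>S w\<close> paired with the convolution of \<open>g\<close> and
  \<open>S w\<close>.\<close>

lemma dissipation:
  fixes W Q P Y N F fw fwd yw pq mq k \<epsilon> :: real
  assumes k: "k > 0" and eps: "0 < \<epsilon>" "\<epsilon> \<le> 1/2" and C2: "C2 = dissip_const k"
    and eC: "\<epsilon> * C2 \<le> del * lam / 4" "\<epsilon> * C2 \<le> eta / 4" "\<epsilon> * C2 \<le> c0 / 4"
    and nn: "0 \<le> W" "0 \<le> Q" "0 \<le> P" "0 \<le> Y" "0 \<le> N" "0 \<le> F" and G: "G \<le> Gam"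
    and W: "W \<le> lam * k * P + Y"
    and fwd: "fwd \<le> F * W" and fw: "fw \<le> F * (k * Q)" and yw: "- yw \<le> Y * (k * Q)" and pq: "- pq \<le> P * Q"
    and mq: "mq \<le> G * Q\<^sup>2 + N / (2 * young_mu) + young_mu / 2 * Gam * Q\<^sup>2"
  shows "fwd - eta * Y\<^sup>2 - del * lam * P\<^sup>2 - c0 / 2 * N
    + \<epsilon> * (tau * W\<^sup>2 + fw - eta * yw - c\<^sup>2 / lam * Q\<^sup>2 - del * pq + mq)
    \<le> - min (min (eta / 4) (del * lam / 4)) (min (c0 / 4) (\<epsilon> * kap / 2)) * (Q\<^sup>2 + P\<^sup>2 + Y\<^sup>2 + N)
      + ((lam * k)\<^sup>2 / (2 * (del * lam)) + 1 / (2 * eta) + C2) * F\<^sup>2"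
    (is "?L \<le> - ?a * ?X + _")
proof -
  define C3 where "C3 = (lam * k)\<^sup>2 / (2 * (del * lam)) + 1 / (2 * eta)"
  have dl: "del * lam > 0" using const_pos lam_pos by simp
  \<comment> \<open>\<open>w'\<close> is split into \<open>u'\<close> and \<open>u''\<close> parts
    because only these are dissipated without the help of \<open>\<epsilon>\<close>.\<close>
  have "fwd \<le> F * (lam * k * P + Y)"
    using fwd mult_left_mono[OF W nn(6)] by simp
  also have "\<dots> = P * (lam * k * F) + Y * F" by (simp add: algebra_simps)
  also have "\<dots> \<le> (del * lam / 2 * P\<^sup>2 + (lam * k * F)\<^sup>2 / (4 * (del * lam / 2))) + (eta / 2 * Y\<^sup>2 + F\<^sup>2 / (4 * (eta / 2)))"
    using dl const_pos by (intro add_mono young_real) auto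
  also have "\<dots> = del * lam / 2 * P\<^sup>2 + eta / 2 * Y\<^sup>2 + C3 * F\<^sup>2"
  proof -
    have "(lam * k * F)\<^sup>2 / (4 * (del * lam / 2)) = (lam * k)\<^sup>2 / (2 * (del * lam)) * F\<^sup>2"
      by (simp add: power_mult_distrib)
    moreover have "F\<^sup>2 / (4 * (eta / 2)) = 1 / (2 * eta) * F\<^sup>2" by simp
    moreover have "x = u * F\<^sup>2 \<Longrightarrow> y = v * F\<^sup>2 \<Longrightarrow> (a + x) + (a' + y) = a + a' + (u + v) * F\<^sup>2" for x y u v a a' :: real
      by (simp add: distrib_right)
    ultimately show ?thesis unfolding C3_def by blast
  qed
  finally have 1: "fwd \<le> del * lam / 2 * P\<^sup>2 + eta / 2 * Y\<^sup>2 + C3 * F\<^sup>2" .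
  \<comment> \<open>After the memory term has been estimated, \<open>3 * kap / 4\<close> of the
    coercivity in \<open>Q\<^sup>2\<close> is left. Three cross terms at \<open>kap / 12\<close>
    each reduce this to \<open>kap / 2\<close>.\<close>
  have k12: "kap / 12 > 0" using const_pos by simp
  have "Q * (k * F) \<le> kap / 12 * Q\<^sup>2 + (k * F)\<^sup>2 / (4 * (kap / 12))"
    by (rule young_real[OF k12])
  moreover have "(k * F)\<^sup>2 / (4 * (kap / 12)) = 3 * k\<^sup>2 / kap * F\<^sup>2" by (simp add: power_mult_distrib)
  moreover have "F * (k * Q) = Q * (k * F)" by simp
  ultimately have y1: "fw \<le> kap / 12 * Q\<^sup>2 + 3 * k\<^sup>2 / kap * F\<^sup>2"
    using fw by argo
  have "Q * (eta * k * Y) \<le> kap / 12 * Q\<^sup>2 + (eta * k * Y)\<^sup>2 / (4 * (kap / 12))"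
    by (rule young_real[OF k12])
  moreover have "- (eta * yw) \<le> eta * (Y * (k * Q))"
    using mult_left_mono[OF yw, of eta] const_pos by simp
  moreover have "(eta * k * Y)\<^sup>2 / (4 * (kap / 12)) = 3 * (eta * k)\<^sup>2 / kap * Y\<^sup>2" by (simp add: power_mult_distrib)
  moreover have "eta * (Y * (k * Q)) = Q * (eta * k * Y)" by simp
  ultimately have y2: "- (eta * yw) \<le> kap / 12 * Q\<^sup>2 + 3 * (eta * k)\<^sup>2 / kap * Y\<^sup>2"
    by argo
  have "Q * (del * P) \<le> kap / 12 * Q\<^sup>2 + (del * P)\<^sup>2 / (4 * (kap / 12))"
    by (rule young_real[OF k12])
  moreover have "- (del * pq) \<le> del * (P * Q)"
    using mult_left_mono[OF pq, of del] const_pos by simp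
  moreover have "(del * P)\<^sup>2 / (4 * (kap / 12)) = 3 * del\<^sup>2 / kap * P\<^sup>2" by (simp add: power_mult_distrib)
  moreover have "del * (P * Q) = Q * (del * P)" by simp
  ultimately have y3: "- (del * pq) \<le> kap / 12 * Q\<^sup>2 + 3 * del\<^sup>2 / kap * P\<^sup>2"
    by argo
  have "tau * W\<^sup>2 \<le> tau * (2 * ((lam * k)\<^sup>2 * P\<^sup>2) + 2 * Y\<^sup>2)"
    using square_sum_le[OF nn(1) W] tau_pos by (intro mult_left_mono) (auto simp: power_mult_distrib)
  then have y4: "tau * W\<^sup>2 \<le> 2 * tau * (lam * k)\<^sup>2 * P\<^sup>2 + 2 * tau * Y\<^sup>2"
    by (simp add: algebra_simps)
  have Q2: "c\<^sup>2 / lam * Q\<^sup>2 = kap * Q\<^sup>2 + Gam * Q\<^sup>2"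
    by (simp add: kap_def algebra_simps)
  have muG: "young_mu / 2 * Gam * Q\<^sup>2 \<le> kap / 4 * Q\<^sup>2"
    by (intro mult_right_mono young_mu_bound) simp
  have GQ: "G * Q\<^sup>2 \<le> Gam * Q\<^sup>2" using G by (intro mult_right_mono) auto
  have y5: "mq - c\<^sup>2 / lam * Q\<^sup>2 \<le> - (3 * kap / 4) * Q\<^sup>2 + 1 / (2 * young_mu) * N"
  proof -
    have "x1 \<le> kap / 4 * X \<Longrightarrow> x2 \<le> x3 \<Longrightarrow> x4 \<le> x2 + n + x1 \<Longrightarrow> x5 = kap * X + x3 \<Longrightarrow>
      x4 - x5 \<le> - (3 * kap / 4) * X + n" for x1 x2 x3 x4 x5 X n :: real by simp
    from this[OF muG GQ mq Q2] show ?thesis by simp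
  qed
  have "tau * W\<^sup>2 + fw - eta * yw - c\<^sup>2 / lam * Q\<^sup>2 - del * pq + mq \<le>
     - (kap / 2) * Q\<^sup>2 + (2 * tau * (lam * k)\<^sup>2 + 3 * del\<^sup>2 / kap) * P\<^sup>2 + (2 * tau + 3 * (eta * k)\<^sup>2 / kap) * Y\<^sup>2
     + 1 / (2 * young_mu) * N + 3 * k\<^sup>2 / kap * F\<^sup>2"
  proof -
    have "a1 \<le> kap / 12 * X + b1 \<Longrightarrow> a2 \<le> kap / 12 * X + b2 \<Longrightarrow> a3 \<le> kap / 12 * X + b3 \<Longrightarrow> a4 \<le> b4 + b5 \<Longrightarrow>
      a5 - a6 \<le> - (3 * kap / 4) * X + b6 \<Longrightarrow>
      a4 + a1 + a2 - a6 + a3 + a5 \<le> - (kap / 2) * X + (b4 + b3) + (b5 + b2) + b6 + b1"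
      for a1 a2 a3 a4 a5 a6 b1 b2 b3 b4 b5 b6 X :: real by simp
    from this[OF y1 y2 y3 y4 y5] show ?thesis unfolding distrib_right by simp
  qed
  also have "\<dots> \<le> - (kap / 2) * Q\<^sup>2 + C2 * P\<^sup>2 + C2 * Y\<^sup>2 + C2 * N + C2 * F\<^sup>2"
  proof -
    have "0 \<le> 2 * tau * (lam * k)\<^sup>2" "0 \<le> 3 * del\<^sup>2 / kap" "0 \<le> 3 * (eta * k)\<^sup>2 / kap"
      "0 \<le> 1 / (2 * young_mu)" "0 \<le> 3 * k\<^sup>2 / kap" "0 \<le> 2 * tau"
      using const_pos young_mu_pos tau_pos by (auto intro!: divide_nonneg_pos)
    then have "2 * tau * (lam * k)\<^sup>2 + 3 * del\<^sup>2 / kap \<le> C2" "2 * tau + 3 * (eta * k)\<^sup>2 / kap \<le> C2"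
      "1 / (2 * young_mu) \<le> C2" "3 * k\<^sup>2 / kap \<le> C2"
      unfolding C2 dissip_const_def by linarith+
    then show ?thesis
      using nn(5) by (intro add_mono mult_right_mono order_refl zero_le_power2)
  qed
  finally have "\<epsilon> * (tau * W\<^sup>2 + fw - eta * yw - c\<^sup>2 / lam * Q\<^sup>2 - del * pq + mq)
     \<le> \<epsilon> * (- (kap / 2) * Q\<^sup>2 + C2 * P\<^sup>2 + C2 * Y\<^sup>2 + C2 * N + C2 * F\<^sup>2)"
    by (rule mult_left_mono) (use eps in simp)
  also have "\<dots> = - (\<epsilon> * kap / 2) * Q\<^sup>2 + (\<epsilon> * C2) * P\<^sup>2 + (\<epsilon> * C2) * Y\<^sup>2 + (\<epsilon> * C2) * N + (\<epsilon> * C2) * F\<^sup>2"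
    unfolding distrib_left by simp
  also have "\<dots> \<le> - (\<epsilon> * kap / 2) * Q\<^sup>2 + (del * lam / 4) * P\<^sup>2 + (eta / 4) * Y\<^sup>2 + (c0 / 4) * N + C2 * F\<^sup>2"
  proof (intro add_mono mult_right_mono order_refl zero_le_power2 eC nn(5))
    show "\<epsilon> * C2 \<le> C2" using eps dissip_const_pos[of k] C2 by simp
  qed
  finally have 2: "\<epsilon> * (tau * W\<^sup>2 + fw - eta * yw - c\<^sup>2 / lam * Q\<^sup>2 - del * pq + mq) \<le> \<dots>" .
  have "?a * ?X = ?a * Q\<^sup>2 + ?a * P\<^sup>2 + ?a * Y\<^sup>2 + ?a * N" by (simp only: distrib_left)
  also have "\<dots> \<le> (\<epsilon> * kap / 2) * Q\<^sup>2 + (del * lam / 4) * P\<^sup>2 + (eta / 4) * Y\<^sup>2 + (c0 / 4) * N"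
    using nn(5) by (intro add_mono mult_right_mono zero_le_power2)
      (simp_all only: min_le_iff_disj order_refl simp_thms)
  finally have 3: "?a * ?X \<le> (\<epsilon> * kap / 2) * Q\<^sup>2 + (del * lam / 4) * P\<^sup>2 + (eta / 4) * Y\<^sup>2 + (c0 / 4) * N" .
  have 4: "(C3 + C2) * F\<^sup>2 = C3 * F\<^sup>2 + C2 * F\<^sup>2" by (simp add: distrib_right)
  have 5: "x1 \<le> A + B + x2 \<Longrightarrow> x3 \<le> - (\<epsilon> * kap / 2) * Q\<^sup>2 + A' + B' + N' + x4 \<Longrightarrow>
     x5 \<le> (\<epsilon> * kap / 2) * Q\<^sup>2 + A' + B' + N' \<Longrightarrow> A'' = A + 2 * A' \<Longrightarrow> B'' = B + 2 * B' \<Longrightarrow> N'' = 2 * N' \<Longrightarrow>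
     x1 - B'' - A'' - N'' + x3 \<le> - x5 + (x2 + x4)" for x1 x2 x3 x4 x5 A A' A'' B B' B'' N' N'' :: real
    by simp
  have A: "del * lam * P\<^sup>2 = del * lam / 2 * P\<^sup>2 + 2 * (del * lam / 4 * P\<^sup>2)" by simp
  have B: "eta * Y\<^sup>2 = eta / 2 * Y\<^sup>2 + 2 * (eta / 4 * Y\<^sup>2)" by simp
  have N: "c0 / 2 * N = 2 * (c0 / 4 * N)" by simp
  have "?L \<le> - (?a * ?X) + (C3 * F\<^sup>2 + C2 * F\<^sup>2)"
    by (rule 5[OF 1 2 3 A B N])
  also have "- (?a * ?X) = - ?a * ?X" by (rule mult_minus_left[symmetric])
  also have "C3 * F\<^sup>2 + C2 * F\<^sup>2 = (C3 + C2) * F\<^sup>2" by (rule 4[symmetric])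
  finally show ?thesis by (simp only: C3_def)
qed

text \<open>Constants are uniform in the solution and the forcing. With \<open>f = 0\<close> this is exponential decay; with
  zero initial data it is continuous dependence on the forcing.\<close>

lemma energy_estimate:
  assumes k: "k > 0"
  shows "\<exists>C>0. \<exists>\<omega>>0. \<forall>(f::real \<Rightarrow> 'a::{real_inner,banach}) M v vd vdd vddd p pd pdd.
    strong_sol k f v vd vdd vddd p pd pdd \<longrightarrow> (\<forall>t\<ge>0. norm (f t) \<le> M) \<longrightarrow>
    (\<forall>t\<ge>0. energy p pd vdd t \<le> C * (energy p pd vdd 0 * exp (- \<omega> * t) + M\<^sup>2))"
proof -
  define C2 where "C2 = dissip_const k"
  have C2: "C2 > 0" by (simp add: C2_def dissip_const_pos)
  have dl: "del * lam > 0" using const_pos lam_pos by simp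
  \<comment> \<open>The first two bounds give coercivity of the functional; the last three make the
    perturbation errors \<open>e * C2\<close> fit into a quarter of each dissipation
    constant.\<close>
  define e where "e = min (min (1/2) (kap / (2 * (tau * k\<^sup>2)))) (min (del * lam / (4 * C2)) (min (eta / (4 * C2)) (c0 / (4 * C2))))"
  have tk: "tau * k\<^sup>2 > 0" using tau_pos k by simp
  have e0: "e > 0" using C2 dl const_pos c0_pos tk by (simp add: e_def)
  have le: "e \<le> 1/2" "e \<le> kap / (2 * (tau * k\<^sup>2))" "e \<le> del * lam / (4 * C2)" "e \<le> eta / (4 * C2)" "e \<le> c0 / (4 * C2)"
    unfolding e_def by (simp_all only: min_le_iff_disj order_refl simp_thms)
  have mult: "e \<le> x / (n * y) \<Longrightarrow> y > 0 \<Longrightarrow> n > 0 \<Longrightarrow> e * y \<le> x / n" for x y n :: real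
    by (simp add: field_simps)
  have e1: "e * (tau * k\<^sup>2) \<le> kap / 2" using mult[OF le(2) tk] by simp
  have e2: "e * C2 \<le> del * lam / 4" "e * C2 \<le> eta / 4" "e * C2 \<le> c0 / 4"
    using mult[OF le(3) C2] mult[OF le(4) C2] mult[OF le(5) C2] by simp_all
  define a1 where "a1 = min (min (kap / 4) (tau / 8)) (min (del / (2 * (1 + 2 * (lam * k)\<^sup>2))) (1/2))"
  define a2 where "a2 = 2 * tau * (lam * k)\<^sup>2 + 2 * tau + c\<^sup>2 / lam + tau * k\<^sup>2 + del + lam * eta * k\<^sup>2 + 1"
  define a3 where "a3 = min (min (eta / 4) (del * lam / 4)) (min (c0 / 4) (e * kap / 2))"
  define a4 where "a4 = (lam * k)\<^sup>2 / (2 * (del * lam)) + 1 / (2 * eta) + C2"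
  have a1: "a1 > 0" using const_pos tau_pos by (simp add: a1_def add_pos_nonneg)
  have a2: "a2 > 0"
    unfolding a2_def using const_pos tau_pos lam_pos tk
    by (intro add_nonneg_pos add_nonneg_nonneg mult_nonneg_nonneg) auto
  have a3: "a3 > 0" using const_pos dl c0_pos e0 by (simp add: a3_def)
  have a4: "a4 > 0" unfolding a4_def using const_pos dl C2 by (intro add_nonneg_pos add_nonneg_nonneg) auto
  \<comment> \<open>The dissipation is at least \<open>a3 * X\<close> up to forcing, and the
    functional is at most \<open>a2 * X\<close>.\<close>
  define \<omega> where "\<omega> = a3 / a2"
  have om: "\<omega> > 0" using a2 a3 by (simp add: \<omega>_def)
  \<comment> \<open>\<open>d1\<close> and \<open>d2\<close> convert between the energy, which
    contains \<open>p\<close>, and the quantity \<open>X\<close> below, which contains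
    \<open>lam p + pd\<close> in its place.\<close>
  define d1 where "d1 = 1 + 2 / lam\<^sup>2"
  define d2 where "d2 = 2 * lam\<^sup>2 + 3"
  have d: "d1 > 0" "d2 > 0" using lam_pos by (auto simp: d1_def d2_def add_pos_nonneg add_nonneg_pos)
  define C where "C = d1 / a1 * (a2 * d2 + a4 / \<omega>)"
  have C: "C > 0" using a1 a2 a4 d om by (simp add: C_def add_pos_pos)
  have main: "energy p pd vdd t \<le> C * (energy p pd vdd 0 * exp (- \<omega> * t) + M\<^sup>2)"
    if sol: "strong_sol k f v vd vdd vddd p pd pdd" and M: "\<And>t. t \<ge> 0 \<Longrightarrow> norm (f t) \<le> M" and t: "t \<ge> 0"
    for f v vd vdd vddd p pd pdd :: "real \<Rightarrow> 'a" and M t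
  proof -
    note s = sol[unfolded strong_sol_def]
    define q w wd where "q = (\<lambda>t. lam *\<^sub>R p t + pd t)" and "w = (\<lambda>t. lam *\<^sub>R v t + vd t)"
      and "wd = (\<lambda>t. lam *\<^sub>R vd t + vdd t)"
    have qc: "continuous_on {0..} q"
      unfolding q_def using s
      by (intro continuous_intros continuous_on_vector_derivative_atLeast[of pd pdd]
          continuous_on_vector_derivative_atLeast[of p pd]) auto
    define X where "X = (\<lambda>t. (norm (q t))\<^sup>2 + (norm (pd t))\<^sup>2 + (norm (vdd t))\<^sup>2 + memory q t)"
    define L where "L = lyapunov e v vd vdd p pd"
    have mem: "0 \<le> memory q t" for t by (rule memory_nonneg[OF qc])
    have vdk: "norm (vd t) \<le> k * norm (pd t)" and wk: "norm (w t) \<le> k * norm (q t)" if "t \<ge> 0" for t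
      using s that by (auto simp: w_def q_def)
    have lamvd: "norm (lam *\<^sub>R vd t) \<le> lam * k * norm (pd t)" if "t \<ge> 0" for t
      using mult_left_mono[OF vdk[OF that], of lam] lam_pos by simp
    have wdle: "norm (wd t) \<le> lam * k * norm (pd t) + norm (vdd t)" if "t \<ge> 0" for t
      using norm_triangle_ineq[of "lam *\<^sub>R vd t" "vdd t"] lamvd[OF that] by (simp add: wd_def)
    have vddle: "norm (vdd t) \<le> norm (wd t) + lam * k * norm (pd t)" if "t \<ge> 0" for t
    proof -
      have "vdd t = wd t - lam *\<^sub>R vd t" by (simp add: wd_def)
      then show ?thesis using norm_triangle_ineq4[of "wd t" "lam *\<^sub>R vd t"] lamvd[OF that] by simp
    qed
    have Z: "\<bar>wd t \<bullet> w t\<bar> \<le> norm (wd t) * (k * norm (q t))" if "t \<ge> 0" for t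
      using Cauchy_Schwarz_ineq2[of "wd t" "w t"] mult_left_mono[OF wk[OF that], of "norm (wd t)"] by simp
    have Leq: "L t = tau / 2 * (norm (wd t))\<^sup>2 + (c\<^sup>2 / lam - integral {0..t} g) / 2 * (norm (q t))\<^sup>2 + del / 2 * (norm (pd t))\<^sup>2
       + lam * eta / 2 * (norm (vd t))\<^sup>2 + memory q t / 2 + e * (tau * (wd t \<bullet> w t))" for t
    proof -
      have "L t = tau / 2 * (norm (wd t))\<^sup>2 + c\<^sup>2 / lam / 2 * (norm (q t))\<^sup>2 + del / 2 * (norm (pd t))\<^sup>2
         + lam * eta / 2 * (norm (vd t))\<^sup>2 + (conv g (\<lambda>s. (norm (q s))\<^sup>2) t / 2 - q t \<bullet> conv g q t)
         + e * (tau * (wd t \<bullet> w t))"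
        by (simp only: L_def lyapunov_def q_def w_def wd_def)
      moreover have "conv g (\<lambda>s. (norm (q s))\<^sup>2) t / 2 - q t \<bullet> conv g q t =
          memory q t / 2 - integral {0..t} g / 2 * (norm (q t))\<^sup>2"
        unfolding memory_eq[OF qc] by argo
      moreover have "(x - y) / 2 * z = x / 2 * z - y / 2 * z" for x y z :: real
        by (simp add: algebra_simps diff_divide_distrib)
      ultimately show ?thesis by simp
    qed
    have lower: "a1 * X t \<le> L t" if "t \<ge> 0" for t
    proof -
      have "0 \<le> lam * eta / 2 * (norm (vd t))\<^sup>2" using lam_pos const_pos by simp
      moreover have "a1 * X t \<le> tau / 2 * (norm (wd t))\<^sup>2 + (c\<^sup>2 / lam - integral {0..t} g) / 2 * (norm (q t))\<^sup>2 + del / 2 * (norm (pd t))\<^sup>2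
         + memory q t / 2 + e * (tau * (wd t \<bullet> w t))"
        unfolding a1_def X_def
        by (rule lyapunov_lower[OF k e0 le(1) e1]) (use that mem G_le Z vddle in auto)
      ultimately show ?thesis unfolding Leq by linarith
    qed
    have upper: "L t \<le> a2 * X t" if "t \<ge> 0" for t
      unfolding Leq a2_def X_def
      by (rule lyapunov_upper[OF k e0 le(1)]) (use that mem G_nonneg Z vdk wdle in auto)
    have "L t \<le> L 0 * exp (- \<omega> * t) + (a4 * M\<^sup>2) / \<omega>"
    proof (rule gronwall_exp[OF _ om t])
      fix t :: real assume t: "t \<ge> 0"
      obtain D where D: "(L has_real_derivative D) (at t within {0..})"
        "D \<le> f t \<bullet> wd t - eta * (norm (vdd t))\<^sup>2 - del * lam * (norm (pd t))\<^sup>2 - c0 / 2 * memory q t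
         + e * (tau * (norm (wd t))\<^sup>2 + f t \<bullet> w t - eta * (vdd t \<bullet> w t) - c\<^sup>2 / lam * (norm (q t))\<^sup>2
          - del * (pd t \<bullet> q t) + q t \<bullet> conv g q t)"
        using lyapunov_derivative[OF sol t, of e] unfolding L_def q_def w_def wd_def by blast
      have cs: "x \<bullet> y \<le> norm x * norm y" "- (x \<bullet> y) \<le> norm x * norm y" for x y :: 'a
        using Cauchy_Schwarz_ineq2[of x y] by auto
      have wk': "norm x * norm (w t) \<le> norm x * (k * norm (q t))" for x :: 'a
        by (intro mult_left_mono wk t) auto
      have "D \<le> - a3 * X t + a4 * (norm (f t))\<^sup>2"
        unfolding a3_def a4_def X_def
        by (rule order_trans[OF D(2)], rule dissipation[OF k e0 le(1) C2_def e2, where G="integral {0..t} g"])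
           (use t mem G_le wdle cs wk' order_trans[OF cs(1) wk'] order_trans[OF cs(2) wk']
             memory_young[OF qc young_mu_pos] in auto)
      also have "\<dots> \<le> - \<omega> * L t + a4 * M\<^sup>2"
      proof (intro add_mono mult_left_mono power_mono M t)
        have "\<omega> * L t \<le> \<omega> * (a2 * X t)" using upper[OF t] om by (intro mult_left_mono) auto
        also have "\<dots> = a3 * X t" using a2 by (simp add: \<omega>_def)
        finally show "- a3 * X t \<le> - \<omega> * L t" by simp
      qed (use a4 in auto)
      finally show "\<exists>D. (L has_real_derivative D) (at t within {0..}) \<and> D \<le> - \<omega> * L t + a4 * M\<^sup>2"
        using D(1) by blast
    qed (use a4 in auto)
    moreover have "X 0 \<le> d2 * energy p pd vdd 0"
    proof -
      have "norm (q 0) \<le> lam * norm (p 0) + norm (pd 0)"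
        using norm_triangle_ineq[of "lam *\<^sub>R p 0" "pd 0"] lam_pos by (simp add: q_def)
      from square_sum_le[OF norm_ge_zero this]
      have "(norm (q 0))\<^sup>2 \<le> 2 * lam\<^sup>2 * (norm (p 0))\<^sup>2 + 2 * (norm (pd 0))\<^sup>2"
        by (simp add: power_mult_distrib)
      moreover have "0 \<le> lam\<^sup>2 * (norm (pd 0))\<^sup>2" "0 \<le> lam\<^sup>2 * (norm (vdd 0))\<^sup>2"
        "0 \<le> (norm (pd 0))\<^sup>2" "0 \<le> (norm (vdd 0))\<^sup>2" "0 \<le> (norm (p 0))\<^sup>2" by simp_all
      moreover have eq: "X 0 = (norm (q 0))\<^sup>2 + (norm (pd 0))\<^sup>2 + (norm (vdd 0))\<^sup>2"
        "energy p pd vdd 0 = (norm (pd 0))\<^sup>2 + (norm (p 0))\<^sup>2 + (norm (vdd 0))\<^sup>2"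
        by (simp_all add: X_def energy_def memory_def)
      ultimately show ?thesis
        unfolding eq d2_def distrib_left distrib_right by argo
    qed
    moreover have "energy p pd vdd t \<le> d1 * X t"
    proof -
      have "lam *\<^sub>R p t = q t - pd t" by (simp add: q_def)
      then have "norm (lam *\<^sub>R p t) \<le> norm (q t) + norm (pd t)"
        using norm_triangle_ineq4[of "q t" "pd t"] by simp
      from square_sum_le[OF norm_ge_zero this]
      have "lam\<^sup>2 * (norm (p t))\<^sup>2 \<le> 2 * ((norm (q t))\<^sup>2 + (norm (pd t))\<^sup>2)"
        by (simp add: power_mult_distrib)
      also have "\<dots> \<le> 2 * X t" using mem[of t] by (simp add: X_def)
      finally have "(norm (p t))\<^sup>2 \<le> 2 / lam\<^sup>2 * X t" using lam_pos by (simp add: field_simps)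
      moreover have "(norm (pd t))\<^sup>2 + (norm (vdd t))\<^sup>2 + memory q t \<le> X t" by (simp add: X_def)
      ultimately show ?thesis
        unfolding energy_def d1_def q_def[symmetric] by (simp add: distrib_right)
    qed
    ultimately have *: "L t \<le> L 0 * exp (- \<omega> * t) + (a4 * M\<^sup>2) / \<omega>" "X 0 \<le> d2 * energy p pd vdd 0"
      "energy p pd vdd t \<le> d1 * X t" by auto
    have E0: "0 \<le> energy p pd vdd 0" by (simp add: energy_def memory_def)
    have "a1 * X t \<le> L 0 * exp (- \<omega> * t) + (a4 * M\<^sup>2) / \<omega>"
      using lower[OF t] *(1) by simp
    also have "\<dots> \<le> (a2 * (d2 * energy p pd vdd 0)) * exp (- \<omega> * t) + (a4 * M\<^sup>2) / \<omega>"
    proof (intro add_mono mult_right_mono order_refl)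
      show "L 0 \<le> a2 * (d2 * energy p pd vdd 0)"
        by (rule order_trans[OF upper mult_left_mono[OF *(2)]]) (use a2 in auto)
    qed simp
    finally have "a1 * X t \<le> a2 * d2 * (energy p pd vdd 0 * exp (- \<omega> * t)) + a4 / \<omega> * M\<^sup>2"
      by (simp add: algebra_simps)
    also have "\<dots> \<le> (a2 * d2 + a4 / \<omega>) * (energy p pd vdd 0 * exp (- \<omega> * t)) + (a2 * d2 + a4 / \<omega>) * M\<^sup>2"
      using E0 a2 a4 om d by (intro add_mono mult_right_mono) auto
    finally have "X t \<le> (a2 * d2 + a4 / \<omega>) * (energy p pd vdd 0 * exp (- \<omega> * t) + M\<^sup>2) / a1"
      unfolding pos_le_divide_eq[OF a1] by (simp add: distrib_left mult.commute)
    then have "d1 * X t \<le> d1 * ((a2 * d2 + a4 / \<omega>) * (energy p pd vdd 0 * exp (- \<omega> * t) + M\<^sup>2) / a1)"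
      using d by (intro mult_left_mono) auto
    then show ?thesis using *(3) by (simp add: C_def)
  qed
  show ?thesis using C om main by blast
qed

end

section \<open>Inverses of coercive self-adjoint operators\<close>

text \<open>Projection onto the closure of \<open>M\<close> by a minimising sequence. The sequence
  itself is returned with its limit, since \<open>M\<close> need not be closed and the approximants
  have to be preimages under an operator later.\<close>

lemma orthogonal_projection_sequence:
  fixes M :: "'a::{real_inner,complete_space} set"
  assumes M: "subspace M"
  obtains m z where "\<And>n::nat. m n \<in> M" "m \<longlonglongrightarrow> z" "\<And>x. x \<in> M \<Longrightarrow> (y - z) \<bullet> x = 0"
proof -
  define d where "d = infdist y M"
  have ne: "M \<noteq> {}" using subspace_0[OF M] by blast
  have d0: "0 \<le> d" by (simp add: d_def infdist_nonneg)
  have d_le: "d\<^sup>2 \<le> (norm (y - x))\<^sup>2" if "x \<in> M" for x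
    using infdist_le[OF that, of y] d0 by (intro power_mono) (auto simp: d_def dist_norm)
  have "\<exists>x\<in>M. norm (y - x) < d + inverse (real (Suc n))" for n
  proof -
    have "(INF x\<in>M. dist y x) < d + inverse (real (Suc n))"
      using ne by (simp add: d_def infdist_def)
    then show ?thesis
      using cInf_lessD[of "dist y ` M" "d + inverse (real (Suc n))"] ne by (auto simp: dist_norm)
  qed
  then obtain m where m: "\<And>n. m n \<in> M" "\<And>n. norm (y - m n) < d + inverse (real (Suc n))" by metis
  have lim: "(\<lambda>n. norm (y - m n)) \<longlonglongrightarrow> d"
  proof (rule tendsto_sandwich[of "\<lambda>_. d"])
    show "\<forall>\<^sub>F n in sequentially. d \<le> norm (y - m n)"
      using infdist_le[OF m(1), of y] by (auto simp: d_def dist_norm intro!: always_eventually)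
    show "\<forall>\<^sub>F n in sequentially. norm (y - m n) \<le> d + inverse (real (Suc n))"
      using m(2) less_imp_le by (auto intro!: always_eventually)
    show "(\<lambda>n. d + inverse (real (Suc n))) \<longlonglongrightarrow> d"
      using tendsto_add[OF tendsto_const LIMSEQ_inverse_real_of_nat, of d] by simp
  qed simp
  have "(\<lambda>n. (norm (y - m n))\<^sup>2 - d\<^sup>2) \<longlonglongrightarrow> d\<^sup>2 - d\<^sup>2"
    by (intro tendsto_intros lim)
  then have a: "(\<lambda>n. (norm (y - m n))\<^sup>2 - d\<^sup>2) \<longlonglongrightarrow> 0" by simp
  have par: "(norm (m i - m j))\<^sup>2 \<le> 2 * ((norm (y - m i))\<^sup>2 - d\<^sup>2) + 2 * ((norm (y - m j))\<^sup>2 - d\<^sup>2)" for i j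
  proof -
    \<comment> \<open>The midpoint lies in \<open>M\<close>, so its distance to \<open>y\<close> is
      at least \<open>d\<close>; the parallelogram law then forces the Cauchy property.\<close>
    define x where "x = (1/2) *\<^sub>R (m i + m j)"
    have "x \<in> M" unfolding x_def by (intro subspace_scale subspace_add M m)
    have "(norm (m i - m j))\<^sup>2 = 2 * (norm (y - m i))\<^sup>2 + 2 * (norm (y - m j))\<^sup>2 - 4 * (norm (y - x))\<^sup>2"
      unfolding power2_norm_eq_inner x_def
      by (simp add: inner_diff_left inner_diff_right inner_add_left inner_add_right inner_commute
          algebra_simps del: dot_square_norm)
    then show ?thesis using d_le[OF \<open>x \<in> M\<close>] by simp
  qed
  have "Cauchy m"
  proof (rule CauchyI)
    fix e :: real assume e: "0 < e"
    then have "\<forall>\<^sub>F n in sequentially. (norm (y - m n))\<^sup>2 - d\<^sup>2 < e\<^sup>2 / 4"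
      by (intro order_tendstoD(2)[OF a]) simp
    then obtain N where N: "\<And>n. n \<ge> N \<Longrightarrow> (norm (y - m n))\<^sup>2 - d\<^sup>2 < e\<^sup>2 / 4"
      by (auto simp: eventually_sequentially)
    have "norm (m i - m j) < e" if "i \<ge> N" "j \<ge> N" for i j
    proof -
      have "(norm (m i - m j))\<^sup>2 < e\<^sup>2" using par[of i j] N[OF that(1)] N[OF that(2)] by simp
      then show ?thesis using e by (simp add: power2_less_imp_less)
    qed
    then show "\<exists>N. \<forall>i\<ge>N. \<forall>j\<ge>N. norm (m i - m j) < e" by blast
  qed
  then obtain z where z: "m \<longlonglongrightarrow> z"
    using Cauchy_convergent convergent_def by blast
  have dz: "norm (y - z) = d"
  proof (rule LIMSEQ_unique[OF _ lim])
    show "(\<lambda>n. norm (y - m n)) \<longlonglongrightarrow> norm (y - z)" by (intro tendsto_intros z)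
  qed
  have "(y - z) \<bullet> x = 0" if x: "x \<in> M" for x
  proof -
    have ge: "d\<^sup>2 \<le> (norm (y - z - s *\<^sub>R x))\<^sup>2" for s
    proof (rule LIMSEQ_le_const)
      show "(\<lambda>n. (norm (y - (m n + s *\<^sub>R x)))\<^sup>2) \<longlonglongrightarrow> (norm (y - z - s *\<^sub>R x))\<^sup>2"
        unfolding diff_diff_eq by (intro tendsto_intros z)
      show "\<exists>N. \<forall>n\<ge>N. d\<^sup>2 \<le> (norm (y - (m n + s *\<^sub>R x)))\<^sup>2"
        by (intro exI[of _ 0] allI impI d_le subspace_add subspace_scale M m x)
    qed
    define r where "r = (y - z) \<bullet> x"
    have eq: "(norm (y - z - s *\<^sub>R x))\<^sup>2 = d\<^sup>2 - 2 * s * r + s\<^sup>2 * (norm x)\<^sup>2" for s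
    proof -
      have "(norm (a - s *\<^sub>R x))\<^sup>2 = (norm a)\<^sup>2 - 2 * s * (a \<bullet> x) + s\<^sup>2 * (norm x)\<^sup>2" for a
        unfolding power2_norm_eq_inner
        by (simp add: inner_diff_left inner_diff_right inner_commute algebra_simps power2_eq_square
            del: dot_square_norm)
      from this[of "y - z"] show ?thesis by (simp add: dz r_def)
    qed
    show ?thesis
    proof (cases "x = 0")
      case False
      then have nx: "(norm x)\<^sup>2 > 0" by simp
      \<comment> \<open>The minimiser of the quadratic polynomial in \<open>s\<close> given by
        \<open>eq\<close>.\<close>
      from ge[of "r / (norm x)\<^sup>2"] have "2 * (r / (norm x)\<^sup>2) * r \<le> (r / (norm x)\<^sup>2)\<^sup>2 * (norm x)\<^sup>2"
        unfolding eq by simp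
      also have "\<dots> = (r / (norm x)\<^sup>2) * r" using nx by (simp add: power2_eq_square)
      finally have "r * r / (norm x)\<^sup>2 \<le> 0" by simp
      then have "r * r \<le> 0" using nx by (simp add: divide_le_0_iff)
      then have "r * r = 0" by (intro antisym zero_le_square)
      then show ?thesis by (simp add: r_def)
    qed simp
  qed
  then show ?thesis using that m(1) z by blast
qed

lemma dense_orthogonal_eq_0:
  fixes z :: "'a::real_inner"
  assumes "closure D = UNIV" "\<And>x. x \<in> D \<Longrightarrow> x \<bullet> z = 0"
  shows "z = 0"
proof -
  have "closed {x. x \<bullet> z = 0}" by (intro closed_Collect_eq continuous_intros)
  then have "closure D \<subseteq> {x. x \<bullet> z = 0}" using assms(2) by (intro closure_minimal) auto
  then have "z \<in> {x. x \<bullet> z = 0}" unfolding assms(1) by blast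
  then show ?thesis by simp
qed

text \<open>A vector orthogonal to the range satisfies the defining relation of the adjoint with
  value 0, so maximality of the domain and the lower bound make it zero; hence the range is dense.
  By the lower bound preimages of a convergent sequence are Cauchy, and maximality applied once more
  puts their limit into the domain.\<close>

lemma selfadjoint_surj:
  fixes T :: "'a::{real_inner,complete_space} \<Rightarrow> 'a"
  assumes sa: "pos_selfadj D T" and k: "\<And>v. v \<in> D \<Longrightarrow> norm v \<le> k * norm (T v)"
  shows "\<exists>v\<in>D. T v = y"
proof -
  note s = sa[unfolded pos_selfadj_def]
  have D: "subspace D" and dense: "closure D = UNIV" by (rule s[THEN conjunct1], use s in blast)
  have add: "T (u + v) = T u + T v" and sym: "T u \<bullet> v = u \<bullet> T v" if "u \<in> D" "v \<in> D" for u v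
    using s that by blast+
  have scale: "T (r *\<^sub>R u) = r *\<^sub>R T u" if "u \<in> D" for u r using s that by blast
  have adj: "v \<in> D" if "\<And>x. x \<in> D \<Longrightarrow> T x \<bullet> v = x \<bullet> z" for v z using s that by blast
  have T0: "T 0 = 0" using scale[of 0 0] subspace_0[OF D] by simp
  have diff: "T (u - v) = T u - T v" if "u \<in> D" "v \<in> D" for u v
    using add[of u "-1 *\<^sub>R v"] scale[of v "-1"] subspace_scale[OF D that(2), of "-1"] that by simp
  have "subspace (T ` D)"
    unfolding subspace_def
  proof (intro conjI ballI allI)
    show "0 \<in> T ` D" using T0 subspace_0[OF D] by force
    show "x + y \<in> T ` D" if "x \<in> T ` D" "y \<in> T ` D" for x y
    proof -
      from that obtain u v where uv: "u \<in> D" "v \<in> D" "x = T u" "y = T v" by blast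
      then have "x + y = T (u + v)" by (simp add: add)
      then show ?thesis using subspace_add[OF D uv(1,2)] by blast
    qed
    show "r *\<^sub>R x \<in> T ` D" if "x \<in> T ` D" for r x
    proof -
      from that obtain u where u: "u \<in> D" "x = T u" by blast
      then have "r *\<^sub>R x = T (r *\<^sub>R u)" by (simp add: scale)
      then show ?thesis using subspace_scale[OF D u(1)] by blast
    qed
  qed
  then obtain m z where m: "\<And>n::nat. m n \<in> T ` D" "m \<longlonglongrightarrow> z" "\<And>x. x \<in> T ` D \<Longrightarrow> (y - z) \<bullet> x = 0"
    using orthogonal_projection_sequence[of "T ` D" y] by blast
  define w where "w = y - z"
  have w0: "T x \<bullet> w = 0" if "x \<in> D" for x
    using m(3)[of "T x"] that by (simp add: w_def inner_commute)
  have wD: "w \<in> D" by (rule adj[of w 0]) (simp add: w0)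
  have "T w = 0"
    by (rule dense_orthogonal_eq_0[OF dense]) (use w0 sym wD in auto)
  then have "w = 0" using k[OF wD] by simp
  then have my: "m \<longlonglongrightarrow> y" using m(2) by (simp add: w_def)
  obtain v where v: "\<And>n. v n \<in> D" "\<And>n. m n = T (v n)" using m(1) unfolding image_iff by metis
  have "Cauchy v"
  proof (rule CauchyI)
    fix e :: real assume e: "0 < e"
    have "Cauchy m" using my convergent_Cauchy convergent_def by blast
    then obtain N where N: "\<And>i j. i \<ge> N \<Longrightarrow> j \<ge> N \<Longrightarrow> norm (m i - m j) < e / (\<bar>k\<bar> + 1)"
      using CauchyD[of m "e / (\<bar>k\<bar> + 1)"] e by auto
    have "norm (v i - v j) < e" if "i \<ge> N" "j \<ge> N" for i j
    proof -
      have "norm (v i - v j) \<le> k * norm (m i - m j)"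
        using k[OF subspace_diff[OF D v(1) v(1)], of i j] by (simp add: diff v)
      also have "\<dots> \<le> (\<bar>k\<bar> + 1) * norm (m i - m j)" by (intro mult_right_mono) auto
      also have "\<dots> < (\<bar>k\<bar> + 1) * (e / (\<bar>k\<bar> + 1))"
        by (intro mult_strict_left_mono N that) auto
      also have "\<dots> = e" by (simp add: add_nonneg_eq_0_iff)
      finally show ?thesis .
    qed
    then show "\<exists>N. \<forall>i\<ge>N. \<forall>j\<ge>N. norm (v i - v j) < e" by blast
  qed
  then obtain l where l: "v \<longlonglongrightarrow> l" using Cauchy_convergent convergent_def by blast
  have eq: "T x \<bullet> l = x \<bullet> y" if "x \<in> D" for x
  proof (rule LIMSEQ_unique)
    show "(\<lambda>n. T x \<bullet> v n) \<longlonglongrightarrow> T x \<bullet> l" by (intro tendsto_intros l)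
    have "(\<lambda>n. T x \<bullet> v n) = (\<lambda>n. x \<bullet> m n)" using sym[OF that v(1)] v(2) by simp
    then show "(\<lambda>n. T x \<bullet> v n) \<longlonglongrightarrow> x \<bullet> y" using my by (simp add: tendsto_intros)
  qed
  have lD: "l \<in> D" by (rule adj[OF eq])
  have "T l - y = 0"
    by (rule dense_orthogonal_eq_0[OF dense]) (use eq sym lD in \<open>auto simp: inner_diff_right\<close>)
  then show ?thesis using lD by auto
qed

text \<open>The lower bound gives injectivity and the norm bound of the inverse; symmetry and
  positivity carry over by inserting \<open>J x\<close> into those of \<open>T\<close>.\<close>

lemma selfadjoint_inverse:
  fixes T :: "'a::{real_inner,complete_space} \<Rightarrow> 'a"
  assumes sa: "pos_selfadj D T" and k: "\<And>v. v \<in> D \<Longrightarrow> norm v \<le> k * norm (T v)"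
  shows "\<exists>J. bounded_linear J \<and> (\<forall>x. J x \<in> D \<and> T (J x) = x \<and> 0 \<le> J x \<bullet> x \<and> norm (J x) \<le> k * norm x) \<and>
    (\<forall>v\<in>D. J (T v) = v) \<and> (\<forall>x y. J x \<bullet> y = x \<bullet> J y)"
proof -
  note s = sa[unfolded pos_selfadj_def]
  have D: "subspace D" by (rule s[THEN conjunct1])
  have add: "T (u + v) = T u + T v" and sym: "T u \<bullet> v = u \<bullet> T v" if "u \<in> D" "v \<in> D" for u v
    using s that by blast+
  have scale: "T (r *\<^sub>R u) = r *\<^sub>R T u" and pos: "0 \<le> T u \<bullet> u" if "u \<in> D" for u r using s that by blast+
  have inj: "u = v" if "u \<in> D" "v \<in> D" "T u = T v" for u v
  proof -
    have "T (u - v) = T u - T v"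
      using add[of u "-1 *\<^sub>R v"] scale[of v "-1"] subspace_scale[OF D that(2), of "-1"] that by simp
    then show ?thesis using k[OF subspace_diff[OF D that(1,2)]] that(3) by simp
  qed
  have "\<forall>x. \<exists>v. v \<in> D \<and> T v = x" using selfadjoint_surj[OF sa k] by blast
  then obtain J where J: "\<And>x. J x \<in> D" "\<And>x. T (J x) = x" by metis
  have JT: "J (T v) = v" if "v \<in> D" for v by (rule inj) (use that J in auto)
  have nJ: "norm (J x) \<le> k * norm x" for x using k[OF J(1)[of x]] J(2) by simp
  have "bounded_linear J"
  proof (rule bounded_linear_intro)
    show "J (x + y) = J x + J y" for x y
      by (rule inj) (auto simp: J add subspace_add[OF D])
    show "J (r *\<^sub>R x) = r *\<^sub>R J x" for r x
      by (rule inj) (auto simp: J scale subspace_scale[OF D])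
    show "norm (J x) \<le> norm x * k" for x using nJ[of x] by (simp add: mult.commute)
  qed
  moreover have "J x \<bullet> y = x \<bullet> J y" for x y
    using sym[OF J(1)[of x] J(1)[of y]] by (simp add: J(2))
  moreover have "0 \<le> J x \<bullet> x" for x
    using pos[OF J(1)[of x]] by (simp add: J(2) inner_commute)
  ultimately show ?thesis using J JT nJ by (intro exI[of _ J]) simp
qed

text \<open>For \<open>J\<close> the inverse of a positive self-adjoint operator \<open>S\<close>, \<open>yos e\<close> is the Yosida
  approximation \<open>S (1 + e S)\<^sup>-\<^sup>1\<close>.\<close>

locale positive_operator =
  fixes J :: "'a::{real_inner,complete_space} \<Rightarrow> 'a" and lam0 :: real
  assumes J_bl: "bounded_linear J"
    and J_sym: "\<And>x y. J x \<bullet> y = x \<bullet> J y"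
    and J_pos: "\<And>x. 0 \<le> J x \<bullet> x"
    and J_norm: "\<And>x. norm (J x) \<le> lam0 * norm x"
    and J_dense: "closure (range J) = UNIV"
    and lam0_pos: "lam0 > 0"
begin

text \<open>Since \<open>1 + e S = (J + e) S\<close>, the approximation
  \<open>S (1 + e S)\<^sup>-\<^sup>1\<close> is the inverse of \<open>J + e\<close>, which involves
  bounded operators only. Accordingly \<open>J (yos e x)\<close> is the contraction
  \<open>(1 + e S)\<^sup>-\<^sup>1\<close> applied to \<open>x\<close>.\<close>

definition yos :: "real \<Rightarrow> 'a \<Rightarrow> 'a" where
  "yos e = inv (\<lambda>x. J x + e *\<^sub>R x)"

lemmas J_lin = linear_simps[OF J_bl]

text \<open>Positivity of \<open>J\<close> makes \<open>J + e\<close> bounded below by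
  \<open>e\<close>, so it is a self-adjoint operator on the full space to which the inversion lemma
  applies.\<close>

lemma yos_basic:
  assumes e: "e > 0"
  shows yos_bl: "bounded_linear (yos e)"
    and J_yos: "J (yos e x) + e *\<^sub>R yos e x = x"
    and yos_sym: "yos e x \<bullet> y = x \<bullet> yos e y"
    and yos_J': "yos e (J x + e *\<^sub>R x) = x"
proof -
  let ?T = "\<lambda>x. J x + e *\<^sub>R x"
  have psa: "pos_selfadj UNIV ?T"
    unfolding pos_selfadj_def
  proof (intro conjI ballI allI impI)
    show "0 \<le> ?T x \<bullet> x" for x using e J_pos[of x] by (simp add: inner_add_left)
  qed (simp_all add: J_lin scaleR_add_right mult.commute inner_add_left inner_add_right J_sym)
  have bound: "norm v \<le> 1 / e * norm (?T v)" if "v \<in> UNIV" for v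
  proof -
    have "e * norm v * norm v = e *\<^sub>R v \<bullet> v"
      by (simp add: dot_square_norm power2_eq_square)
    also have "\<dots> \<le> ?T v \<bullet> v" using J_pos by (simp add: inner_add_left)
    also have "\<dots> \<le> norm (?T v) * norm v" by (rule norm_cauchy_schwarz)
    finally have "e * norm v \<le> norm (?T v)"
      by (cases "v = 0") auto
    then show ?thesis using e by (simp add: field_simps)
  qed
  from selfadjoint_inverse[OF psa bound] obtain B where
    "bounded_linear B \<and> (\<forall>x. B x \<in> UNIV \<and> ?T (B x) = x \<and> 0 \<le> B x \<bullet> x \<and> norm (B x) \<le> 1 / e * norm x) \<and>
    (\<forall>v\<in>UNIV. B (?T v) = v) \<and> (\<forall>x y. B x \<bullet> y = x \<bullet> B y)" ..
  then have B: "bounded_linear B" "\<And>x. ?T (B x) = x" "\<And>v. B (?T v) = v" "\<And>x y. B x \<bullet> y = x \<bullet> B y"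
    by blast+
  have "yos e = B" unfolding yos_def by (rule inv_equality) (simp_all only: B(2,3))
  then show "bounded_linear (yos e)" "J (yos e x) + e *\<^sub>R yos e x = x" "yos e x \<bullet> y = x \<bullet> yos e y"
    "yos e (J x + e *\<^sub>R x) = x"
    by (simp_all only: B)
qed

lemma yos_J: assumes e: "e > 0" shows "yos e (J x) = J (yos e x)"
proof -
  have "yos e (J x) + e *\<^sub>R yos e x = J (yos e x) + e *\<^sub>R yos e x"
    using yos_J'[OF e, of x] J_yos[OF e, of x] by (simp add: linear_simps[OF yos_bl[OF e]])
  then show ?thesis by simp
qed

text \<open>With \<open>y = yos e x\<close>, the cross term in the square of
  \<open>\<bar>J y + e y\<bar>\<close> is nonnegative.\<close>

lemma norm_J_yos_le: assumes e: "e > 0" shows "norm (J (yos e x)) \<le> norm x"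
proof -
  have "(norm x)\<^sup>2 = (norm (J (yos e x) + e *\<^sub>R yos e x))\<^sup>2" by (simp add: J_yos[OF e])
  also have "\<dots> = (norm (J (yos e x)))\<^sup>2 + 2 * e * (J (yos e x) \<bullet> yos e x) + e\<^sup>2 * (norm (yos e x))\<^sup>2"
    unfolding power2_norm_eq_inner
    by (simp add: inner_add_left inner_add_right inner_commute algebra_simps power2_eq_square del: dot_square_norm)
  finally have "(norm (J (yos e x)))\<^sup>2 \<le> (norm x)\<^sup>2" using e J_pos[of "yos e x"] by simp
  then show ?thesis by (rule power2_le_imp_le) simp
qed

text \<open>The Poincare inequality for the approximations of \<open>S\<close>, with a constant that
  is uniform for bounded \<open>e\<close>.\<close>

lemma norm_le_yos: assumes e: "e > 0" shows "norm x \<le> (lam0 + e) * norm (yos e x)"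
proof -
  have "norm x = norm (J (yos e x) + e *\<^sub>R yos e x)" by (simp add: J_yos[OF e])
  also have "\<dots> \<le> lam0 * norm (yos e x) + e * norm (yos e x)"
    using norm_triangle_ineq[of "J (yos e x)" "e *\<^sub>R yos e x"] J_norm[of "yos e x"] e by simp
  finally show ?thesis by (simp add: distrib_right)
qed

lemma yos_commute: assumes e: "e > 0" and d: "d > 0" shows "yos e (yos d x) = yos d (yos e x)"
proof -
  have "yos d (yos e x) = yos e (J (yos d (yos e x)) + e *\<^sub>R yos d (yos e x))"
    by (simp add: yos_J'[OF e])
  also have "J (yos d (yos e x)) + e *\<^sub>R yos d (yos e x) = yos d (J (yos e x) + e *\<^sub>R yos e x)"
    by (simp add: yos_J[OF d] linear_simps[OF yos_bl[OF d]])
  also have "\<dots> = yos d x" by (simp add: J_yos[OF e])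
  finally show ?thesis by simp
qed

text \<open>Resolvent identity. The factor \<open>d - e\<close> becomes the Cauchy rate of the
  approximate solutions; the price is a second Yosida factor.\<close>

lemma yos_diff: assumes e: "e > 0" and d: "d > 0"
  shows "yos e x - yos d x = (d - e) *\<^sub>R yos e (yos d x)"
proof -
  have "yos e x = yos e (J (yos d x) + d *\<^sub>R yos d x)" by (simp add: J_yos[OF d])
  moreover have "yos d x = yos e (J (yos d x) + e *\<^sub>R yos d x)" by (simp add: yos_J'[OF e])
  ultimately show ?thesis by (simp add: linear_simps[OF yos_bl[OF e]] algebra_simps)
qed

text \<open>On the range of \<open>J\<close> the deviation is \<open>e J (yos e y)\<close>, of norm
  at most \<open>e \<bar>y\<bar>\<close>; contractivity extends the convergence from this dense
  range to all \<open>x\<close>.\<close>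

lemma J_yos_tendsto:
  assumes e: "\<And>n. e n > 0" "e \<longlonglongrightarrow> 0"
  shows "(\<lambda>n. J (yos (e n) x)) \<longlonglongrightarrow> x"
proof (rule LIMSEQ_I)
  fix r :: real assume r: "0 < r"
  have "x \<in> closure (range J)" by (simp add: J_dense)
  then obtain y where y: "dist (J y) x < r / 3"
    using r closure_approachable[of x "range J"] by (metis divide_pos_pos rangeE zero_less_numeral)
  have "(\<lambda>n. e n * norm y) \<longlonglongrightarrow> 0 * norm y" by (intro tendsto_intros e)
  then have "\<forall>\<^sub>F n in sequentially. e n * norm y < r / 3"
    using r by (intro order_tendstoD(2)[where y=0]) auto
  then obtain N where N: "\<And>n. n \<ge> N \<Longrightarrow> e n * norm y < r / 3" by (auto simp: eventually_sequentially)
  have "norm (J (yos (e n) x) - x) < r" if "n \<ge> N" for n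
  proof -
    note yl = linear_simps[OF yos_bl[OF e(1)[of n]]]
    have 1: "norm (J (yos (e n) (x - J y))) \<le> norm (x - J y)" by (rule norm_J_yos_le[OF e(1)])
    have "J y - J (yos (e n) (J y)) = e n *\<^sub>R J (yos (e n) y)"
      using J_yos[OF e(1), of n "J y"] by (simp add: yos_J[OF e(1)] algebra_simps)
    then have 2: "norm (J (yos (e n) (J y)) - J y) \<le> e n * norm y"
      using norm_J_yos_le[OF e(1)[of n], of y] e(1)[of n] by (simp add: norm_minus_commute)
    have "J (yos (e n) x) - x = J (yos (e n) (x - J y)) + (J (yos (e n) (J y)) - J y) + (J y - x)"
      by (simp add: yl J_lin)
    also have "norm \<dots> \<le> norm (x - J y) + e n * norm y + norm (J y - x)"
      by (intro norm_triangle_mono 1 2 order_refl)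
    finally show ?thesis using y N[OF that] by (simp add: dist_norm norm_minus_commute)
  qed
  then show "\<exists>N. \<forall>n\<ge>N. norm (J (yos (e n) x) - x) < r" by blast
qed

text \<open>Density of the range of every power of \<open>J\<close>; each step passes through the
  dense range of \<open>J\<close> and the continuity of \<open>J\<close>.\<close>

lemma J_power_approx:
  assumes "r > 0"
  shows "\<exists>y. norm (x - (J ^^ n) y) < r"
  using assms
proof (induction n arbitrary: x r)
  case 0
  then show ?case by (intro exI[of _ x]) simp
next
  case (Suc n)
  have "x \<in> closure (range J)" by (simp add: J_dense)
  then obtain y where y: "dist (J y) x < r / 2"
    using Suc(2) closure_approachable[of x "range J"] by (metis half_gt_zero rangeE)
  obtain z where z: "norm (y - (J ^^ n) z) < r / (2 * lam0)"
    using Suc(1)[of "r / (2 * lam0)" y] Suc(2) lam0_pos by auto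
  have "norm (J (y - (J ^^ n) z)) < r / 2"
  proof -
    have "norm (J (y - (J ^^ n) z)) \<le> lam0 * norm (y - (J ^^ n) z)" by (rule J_norm)
    also have "\<dots> < lam0 * (r / (2 * lam0))" using z lam0_pos by (intro mult_strict_left_mono)
    finally show ?thesis using lam0_pos by simp
  qed
  moreover have eq: "x - (J ^^ Suc n) z = (x - J y) + J (y - (J ^^ n) z)" by (simp add: J_lin)
  have "norm (x - (J ^^ Suc n) z) \<le> norm (x - J y) + norm (J (y - (J ^^ n) z))"
    unfolding eq by (rule norm_triangle_ineq)
  moreover have "norm (x - J y) < r / 2" using y by (simp add: dist_norm norm_minus_commute)
  ultimately have "norm (x - (J ^^ Suc n) z) < r" by linarith
  then show ?case by blast
qed

end

section \<open>Linear Volterra equations with bounded coefficients\<close>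

context memory_kernel
begin

text \<open>Banach's fixed point theorem in the space of continuous functions with norm
  \<open>sup \<bar>exp (- k t) X t\<bar>\<close>, for large \<open>k\<close>.\<close>

lemma volterra_exists:
  fixes L M :: "'b::banach \<Rightarrow> 'b"
  assumes L: "bounded_linear L" and M: "bounded_linear M"
  shows "\<exists>X. X 0 = X0 \<and> (\<forall>t\<ge>0. (X has_vector_derivative (L (X t) + conv g (\<lambda>s. M (X s)) t)) (at t within {0..}))"
proof -
  obtain KL where KL: "KL > 0" "\<And>x. norm (L x) \<le> norm x * KL" using bounded_linear.pos_bounded[OF L] by blast
  obtain KM where KM: "KM > 0" "\<And>x. norm (M x) \<le> norm x * KM" using bounded_linear.pos_bounded[OF M] by blast
  \<comment> \<open>With this exponent the integral operator at most halves the weighted norm: the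
    integrand is bounded by \<open>A * (k / 2) * exp (k * s)\<close>, and integration divides by
    \<open>k\<close>.\<close>
  define k where "k = 2 * (KL + Gam * KM)"
  have k: "k > 0" using KL KM Gam_nonneg by (simp add: k_def add_pos_nonneg)
  define R where "R = (\<lambda>Z s. L (Z s) + conv g (\<lambda>r. M (Z r)) s)"
  have Rc: "continuous_on {0..} (R Z)" if "continuous_on {0..} Z" for Z
    unfolding R_def using that
    by (intro continuous_on_add continuous_on_conv g_cont bounded_linear.continuous_on[OF L]
        bounded_linear.continuous_on[OF M])
  have Rint: "R Z integrable_on {0..t}" if "continuous_on {0..} Z" for Z t
    by (intro integrable_continuous_real continuous_on_subset[OF Rc[OF that]]) auto
  have Rdiff: "R (\<lambda>s. Z s - Z' s) s = R Z s - R Z' s" if "continuous_on {0..} Z" "continuous_on {0..} Z'" for Z Z' s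
  proof -
    have "conv g (\<lambda>r. M (Z r - Z' r)) s = conv g (\<lambda>r. M (Z r) - M (Z' r)) s"
      by (simp add: linear_simps[OF M])
    also have "\<dots> = conv g (\<lambda>r. M (Z r)) s - conv g (\<lambda>r. M (Z' r)) s"
      using that by (intro conv_diff g_cont bounded_linear.continuous_on[OF M])
    finally show ?thesis by (simp add: R_def linear_simps[OF L])
  qed
  have expint: "((\<lambda>s. exp (k * s)) has_integral (exp (k * t) / k - exp (k * 0) / k)) {0..t}" if "t \<ge> 0" for t
    using that
  proof (rule fundamental_theorem_of_calculus)
    fix x assume "x \<in> {0..t}"
    have "((\<lambda>s. exp (k * s) / k) has_real_derivative exp (k * x)) (at x within {0..t})"
      using k by (auto intro!: derivative_eq_intros)
    then show "((\<lambda>s. exp (k * s) / k) has_vector_derivative exp (k * x)) (at x within {0..t})"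
      by (simp add: has_real_derivative_iff_has_vector_derivative)
  qed
  have bound: "norm (integral {0..t} (R Z)) \<le> A / 2 * exp (k * t)"
    if Z: "continuous_on {0..} Z" and A: "\<And>s. s \<ge> 0 \<Longrightarrow> norm (Z s) \<le> A * exp (k * s)" and t: "t \<ge> 0" for Z A t
  proof -
    have A0: "0 \<le> A" using A[of 0] norm_ge_zero[of "Z 0"] by (simp del: norm_ge_zero)
    have "norm (R Z s) \<le> A * (k / 2) * exp (k * s)" if s: "s \<in> {0..t}" for s
    proof -
      have "norm (conv g (\<lambda>r. M (Z r)) s) \<le> Gam * (A * exp (k * s) * KM)"
      proof (rule norm_conv_le_Gam)
        fix r assume r: "0 \<le> r" "r \<le> s"
        have "norm (M (Z r)) \<le> norm (Z r) * KM" by (rule KM)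
        also have "\<dots> \<le> A * exp (k * r) * KM" using A[OF r(1)] KM by (intro mult_right_mono) auto
        also have "\<dots> \<le> A * exp (k * s) * KM"
          using r k A0 KM by (intro mult_right_mono mult_left_mono) auto
        finally show "norm (M (Z r)) \<le> A * exp (k * s) * KM" .
      qed (use s Z in \<open>auto intro!: bounded_linear.continuous_on[OF M]\<close>)
      moreover have "norm (L (Z s)) \<le> A * exp (k * s) * KL"
        by (rule order_trans[OF KL(2) mult_right_mono[OF A]]) (use s KL(1) in auto)
      ultimately have "norm (R Z s) \<le> A * exp (k * s) * KL + Gam * (A * exp (k * s) * KM)"
        unfolding R_def by (intro norm_triangle_mono)
      then show ?thesis by (simp add: k_def algebra_simps)
    qed
    then have "norm (integral {0..t} (R Z)) \<le> integral {0..t} (\<lambda>s. A * (k / 2) * exp (k * s))"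
      by (intro integral_norm_bound_integral Rint[OF Z])
         (auto intro!: integrable_continuous_real continuous_intros)
    also have "\<dots> = A * (k / 2) * ((exp (k * t) - 1) / k)"
      using integral_unique[OF expint[OF t]] by (simp add: diff_divide_distrib)
    also have "\<dots> = A / 2 * (exp (k * t) - 1)" using k by simp
    also have "\<dots> \<le> A / 2 * exp (k * t)" using A0 by (intro mult_left_mono) auto
    finally show ?thesis .
  qed
  \<comment> \<open>\<open>W Y\<close> removes the exponential weight from \<open>Y\<close>. The
    fixed point is sought among bounded continuous functions on the whole line, hence the
    \<open>max 0 t\<close> in \<open>P\<close>, which freezes the function for negative
    times.\<close>
  define W where "W = (\<lambda>(Y::real \<Rightarrow>\<^sub>C 'b) s. exp (k * s) *\<^sub>R apply_bcontfun Y s)"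
  have Wc: "continuous_on {0..} (W Y)" for Y
    unfolding W_def by (intro continuous_intros continuous_on_apply_bcontfun)
  define P where "P = (\<lambda>Y t. exp (- (k * max 0 t)) *\<^sub>R (X0 + integral {0..max 0 t} (R (W Y))))"
  have PB: "P Y \<in> bcontfun" for Y
    unfolding bcontfun_def
  proof (intro CollectI conjI)
    have "continuous_on {0..} (\<lambda>t. integral {0..t} (R (W Y)))"
      by (rule continuous_on_vector_derivative_atLeast[OF has_vector_derivative_integral_atLeast[OF Rc[OF Wc]]])
    moreover have m: "continuous_on UNIV (\<lambda>t::real. max 0 t)" by (intro continuous_intros)
    ultimately have "continuous_on UNIV (\<lambda>t. integral {0..max 0 t} (R (W Y)))"
      by (rule continuous_on_compose2) auto
    then show "continuous_on UNIV (P Y)"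
      unfolding P_def
      by (intro continuous_on_scaleR continuous_on_add continuous_on_const continuous_on_exp
          continuous_on_minus continuous_on_mult m)
    obtain A where A: "\<And>s. norm (apply_bcontfun Y s) \<le> A"
      using bounded_apply_bcontfun[of Y] unfolding bounded_iff by blast
    have "norm (P Y t) \<le> norm X0 + A / 2" for t
    proof -
      define s where "s = max 0 t"
      have s: "s \<ge> 0" by (simp add: s_def)
      have "norm (integral {0..s} (R (W Y))) \<le> A / 2 * exp (k * s)"
        by (rule bound[OF Wc _ s]) (simp add: W_def A mult.commute)
      then have "norm (X0 + integral {0..s} (R (W Y))) \<le> norm X0 + A / 2 * exp (k * s)"
        by (intro norm_triangle_mono order_refl)
      also have "\<dots> \<le> norm X0 * exp (k * s) + A / 2 * exp (k * s)"
        using mult_left_mono[of 1 "exp (k * s)" "norm X0"] k s by simp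
      finally have "exp (- (k * s)) * norm (X0 + integral {0..s} (R (W Y))) \<le>
          exp (- (k * s)) * ((norm X0 + A / 2) * exp (k * s))"
        by (intro mult_left_mono) (auto simp: distrib_right)
      also have "\<dots> = norm X0 + A / 2" by (simp add: exp_minus)
      finally show ?thesis by (simp add: P_def s_def)
    qed
    then show "bounded (range (P Y))" unfolding bounded_iff by auto
  qed
  have lip: "dist (Bcontfun (P Y)) (Bcontfun (P Y')) \<le> 1/2 * dist Y Y'" for Y Y'
  proof (rule dist_bound)
    fix t :: real
    define s where "s = max 0 t"
    have s: "s \<ge> 0" by (simp add: s_def)
    have "integral {0..s} (R (W Y)) - integral {0..s} (R (W Y')) = integral {0..s} (R (\<lambda>s. W Y s - W Y' s))"
    proof -
      have "R (\<lambda>s. W Y s - W Y' s) = (\<lambda>s. R (W Y) s - R (W Y') s)"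
        by (rule ext) (rule Rdiff[OF Wc Wc])
      then show ?thesis using integral_diff[OF Rint[OF Wc] Rint[OF Wc], of s Y Y'] by simp
    qed
    also have "norm \<dots> \<le> dist Y Y' / 2 * exp (k * s)"
    proof (rule bound[OF _ _ s])
      show "continuous_on {0..} (\<lambda>s. W Y s - W Y' s)" by (intro continuous_intros Wc)
      fix r :: real
      have "norm (W Y r - W Y' r) = exp (k * r) * dist (apply_bcontfun Y r) (apply_bcontfun Y' r)"
        by (simp add: W_def dist_norm flip: scaleR_diff_right)
      also have "\<dots> \<le> exp (k * r) * dist Y Y'" by (intro mult_left_mono dist_bounded) auto
      finally show "norm (W Y r - W Y' r) \<le> dist Y Y' * exp (k * r)" by (simp add: mult.commute)
    qed
    finally have "exp (- (k * s)) * norm (integral {0..s} (R (W Y)) - integral {0..s} (R (W Y')))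
        \<le> exp (- (k * s)) * (dist Y Y' / 2 * exp (k * s))"
      by (intro mult_left_mono) auto
    also have "\<dots> = 1/2 * dist Y Y'" by (simp add: exp_minus)
    finally show "dist (apply_bcontfun (Bcontfun (P Y)) t) (apply_bcontfun (Bcontfun (P Y')) t) \<le> 1/2 * dist Y Y'"
      unfolding Bcontfun_inverse[OF PB] dist_norm[of "P Y t"]
      by (simp add: P_def s_def flip: scaleR_diff_right)
  qed
  have "\<exists>!Y. Bcontfun (P Y) = Y"
    by (rule banach_fix_type[of "1/2"]) (use lip in auto)
  then obtain Y where "Bcontfun (P Y) = Y" by blast
  then have Y: "apply_bcontfun Y t = P Y t" for t using Bcontfun_inverse[OF PB, of Y] by simp
  have X: "W Y t = X0 + integral {0..t} (R (W Y))" if "t \<ge> 0" for t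
  proof -
    have "W Y t = exp (k * t) *\<^sub>R P Y t" by (simp add: W_def Y)
    also have "\<dots> = X0 + integral {0..t} (R (W Y))" using that by (simp add: P_def flip: exp_add)
    finally show ?thesis .
  qed
  have "(W Y has_vector_derivative R (W Y) t) (at t within {0..})" if t: "t \<ge> 0" for t
  proof (rule has_vector_derivative_transform[OF _ X])
    have "((\<lambda>t. X0 + integral {0..t} (R (W Y))) has_vector_derivative 0 + R (W Y) t) (at t within {0..})"
      by (intro has_vector_derivative_add has_vector_derivative_const
          has_vector_derivative_integral_atLeast Rc Wc t)
    then show "((\<lambda>t. X0 + integral {0..t} (R (W Y))) has_vector_derivative R (W Y) t) (at t within {0..})"
      by simp
  qed (use t in auto)
  moreover have "W Y 0 = X0" using X[of 0] by simp
  ultimately show ?thesis unfolding R_def by blast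
qed

end

section \<open>Decay of weak solutions\<close>

text \<open>\<open>S\<close> enters as the inverse of \<open>J\<close> between the whole space and
  \<open>DS\<close>; symmetry, positivity and boundedness are recorded for \<open>J\<close>.\<close>

locale mgt_hilbert = mgt_memory g g' c0 Gam tau alpha b c lam + positive_operator J lam0
  for g g' c0 Gam tau alpha b c lam and J :: "'a::{real_inner,banach} \<Rightarrow> 'a" and lam0 +
  fixes DS :: "'a set" and S :: "'a \<Rightarrow> 'a"
  assumes J_DS: "\<And>x. J x \<in> DS" and S_J: "\<And>x. S (J x) = x" and J_S: "\<And>v. v \<in> DS \<Longrightarrow> J (S v) = v"
begin

abbreviation "wsol \<equiv> weak_sol DS S tau alpha b c lam g"

text \<open>With \<open>p = S u\<close> and \<open>pd = S u'\<close> the equation becomes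
  \<open>tau u''' + alpha u'' + S (flux p pd) = 0\<close>, as \<open>A\<close> is the square of
  \<open>S\<close>: this is the part to which one factor \<open>S\<close> has yet to be
  applied.\<close>

definition flux :: "(real \<Rightarrow> 'a) \<Rightarrow> (real \<Rightarrow> 'a) \<Rightarrow> real \<Rightarrow> 'a" where
  "flux p pd t = c\<^sup>2 *\<^sub>R p t + b *\<^sub>R pd t - conv g (\<lambda>s. lam *\<^sub>R p s + pd s) t"

lemma continuous_on_flux:
  assumes "continuous_on {0..} p" "continuous_on {0..} pd"
  shows "continuous_on {0..} (flux p pd)"
  unfolding flux_def by (intro continuous_intros continuous_on_conv g_cont assms)

lemma flux_integrable:
  assumes "continuous_on {0..} p" "continuous_on {0..} pd"
  shows "flux p pd integrable_on {0..t}"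
  by (intro integrable_continuous_real continuous_on_subset[OF continuous_on_flux[OF assms]]) auto

lemma flux_linear:
  assumes "continuous_on {0..} p" "continuous_on {0..} pd" and T: "bounded_linear T"
  shows "flux (\<lambda>t. T (p t)) (\<lambda>t. T (pd t)) t = T (flux p pd t)"
proof -
  have "conv g (\<lambda>s. lam *\<^sub>R T (p s) + T (pd s)) t = conv g (\<lambda>s. T (lam *\<^sub>R p s + pd s)) t"
    by (simp add: linear_simps[OF T])
  also have "\<dots> = T (conv g (\<lambda>s. lam *\<^sub>R p s + pd s) t)"
    by (intro conv_linear g_cont T continuous_intros assms)
  finally show ?thesis by (simp add: flux_def linear_simps[OF T])
qed

lemma flux_diff:
  assumes "continuous_on {0..} p" "continuous_on {0..} pd" "continuous_on {0..} p'" "continuous_on {0..} pd'"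
  shows "flux (\<lambda>t. p t - p' t) (\<lambda>t. pd t - pd' t) t = flux p pd t - flux p' pd' t"
proof -
  have "conv g (\<lambda>s. lam *\<^sub>R (p s - p' s) + (pd s - pd' s)) t =
      conv g (\<lambda>s. (lam *\<^sub>R p s + pd s) - (lam *\<^sub>R p' s + pd' s)) t"
    by (simp add: algebra_simps)
  also have "\<dots> = conv g (\<lambda>s. lam *\<^sub>R p s + pd s) t - conv g (\<lambda>s. lam *\<^sub>R p' s + pd' s) t"
    by (intro conv_diff g_cont continuous_intros assms)
  finally show ?thesis by (simp add: flux_def algebra_simps)
qed

lemma norm_flux_le:
  assumes "continuous_on {0..} p" "continuous_on {0..} pd"
    and "\<And>s. s \<ge> 0 \<Longrightarrow> norm (p s) \<le> R" "\<And>s. s \<ge> 0 \<Longrightarrow> norm (pd s) \<le> R" and t: "t \<ge> 0"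
  shows "norm (flux p pd t) \<le> (c\<^sup>2 + b + Gam * (lam + 1)) * R"
proof -
  have "b > 0" using b_gt const_pos(4) by simp
  have 1: "norm (conv g (\<lambda>s. lam *\<^sub>R p s + pd s) t) \<le> Gam * ((lam + 1) * R)"
  proof (rule norm_conv_le_Gam)
    fix s :: real assume s: "0 \<le> s"
    have "norm (lam *\<^sub>R p s + pd s) \<le> lam * R + R"
      using assms(3,4)[OF s] lam_pos by (intro norm_triangle_mono) auto
    then show "norm (lam *\<^sub>R p s + pd s) \<le> (lam + 1) * R" by (simp add: distrib_right)
  qed (use t assms in \<open>auto intro!: continuous_intros\<close>)
  have 2: "norm (c\<^sup>2 *\<^sub>R p t + b *\<^sub>R pd t) \<le> c\<^sup>2 * R + b * R"
    using assms(3,4)[OF t] \<open>b > 0\<close> by (intro norm_triangle_mono) (auto intro!: mult_left_mono)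
  show ?thesis
    unfolding flux_def using norm_triangle_ineq4[of "c\<^sup>2 *\<^sub>R p t + b *\<^sub>R pd t" "conv g (\<lambda>s. lam *\<^sub>R p s + pd s) t"] 1 2
    by (simp add: algebra_simps)
qed

text \<open>Testing with \<open>v = J y\<close> turns the weak formulation into an identity in \<open>H\<close>.\<close>

lemma weak_form_iff:
  assumes p: "continuous_on {0..} p" and pd: "continuous_on {0..} pd"
    and u: "\<And>t. t \<ge> 0 \<Longrightarrow> u t = J (p t)" and ud: "\<And>t. t \<ge> 0 \<Longrightarrow> ud t = J (pd t)"
  shows "(\<forall>v\<in>DS. \<forall>t\<ge>0.
        tau * (udd t \<bullet> v) + alpha * (ud t \<bullet> v)
        = tau * (u2 \<bullet> v) + alpha * (u1 \<bullet> v)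
          - integral {0..t} (\<lambda>s. c\<^sup>2 * (S (u s) \<bullet> S v) + b * (S (ud s) \<bullet> S v)
                - integral {0..s} (\<lambda>r. g (s - r) * (S (lam *\<^sub>R u r + ud r) \<bullet> S v))))
    \<longleftrightarrow> (\<forall>t\<ge>0. tau *\<^sub>R J (udd t - u2) + alpha *\<^sub>R J (ud t - u1) = - integral {0..t} (flux p pd))"
    (is "?weak \<longleftrightarrow> ?vec")
proof -
  define q where "q = (\<lambda>r. lam *\<^sub>R p r + pd r)"
  have qc: "continuous_on {0..} q" unfolding q_def by (intro continuous_intros p pd)
  have int: "integral {0..t} (\<lambda>s. c\<^sup>2 * (S (u s) \<bullet> y) + b * (S (ud s) \<bullet> y)
                - integral {0..s} (\<lambda>r. g (s - r) * (S (lam *\<^sub>R u r + ud r) \<bullet> y))) = y \<bullet> integral {0..t} (flux p pd)"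
    for t y
  proof -
    have "integral {0..t} (\<lambda>s. c\<^sup>2 * (S (u s) \<bullet> y) + b * (S (ud s) \<bullet> y)
                - integral {0..s} (\<lambda>r. g (s - r) * (S (lam *\<^sub>R u r + ud r) \<bullet> y))) = integral {0..t} (\<lambda>s. y \<bullet> flux p pd s)"
    proof (rule integral_cong)
      fix s assume s: "s \<in> {0..t}"
      have "integral {0..s} (\<lambda>r. g (s - r) * (S (lam *\<^sub>R u r + ud r) \<bullet> y)) = conv g (\<lambda>r. y \<bullet> q r) s"
        unfolding conv_def
      proof (rule integral_cong)
        fix r assume r: "r \<in> {0..s}"
        have "lam *\<^sub>R u r + ud r = J (q r)" using r by (simp add: u ud q_def J_lin)
        then show "g (s - r) * (S (lam *\<^sub>R u r + ud r) \<bullet> y) = g (s - r) *\<^sub>R (y \<bullet> q r)"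
          by (simp add: S_J inner_commute)
      qed
      also have "\<dots> = y \<bullet> conv g q s" by (rule conv_inner_right[OF qc])
      finally show "c\<^sup>2 * (S (u s) \<bullet> y) + b * (S (ud s) \<bullet> y)
                - integral {0..s} (\<lambda>r. g (s - r) * (S (lam *\<^sub>R u r + ud r) \<bullet> y)) = y \<bullet> flux p pd s"
        using s by (simp add: flux_def q_def u ud S_J inner_add_right inner_diff_right inner_commute)
    qed
    also have "\<dots> = y \<bullet> integral {0..t} (flux p pd)"
      using integral_linear[OF flux_integrable[OF p pd] bounded_linear_inner_right, of t y] by (simp add: o_def)
    finally show ?thesis .
  qed
  have "?weak \<longleftrightarrow> (\<forall>y. \<forall>t\<ge>0. tau * (udd t \<bullet> J y) + alpha * (ud t \<bullet> J y)
        = tau * (u2 \<bullet> J y) + alpha * (u1 \<bullet> J y) - y \<bullet> integral {0..t} (flux p pd))"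
  proof (rule iffI)
    assume weak: ?weak
    show "\<forall>y. \<forall>t\<ge>0. tau * (udd t \<bullet> J y) + alpha * (ud t \<bullet> J y)
        = tau * (u2 \<bullet> J y) + alpha * (u1 \<bullet> J y) - y \<bullet> integral {0..t} (flux p pd)"
    proof
      fix y
      from bspec[OF weak J_DS[of y]] show "\<forall>t\<ge>0. tau * (udd t \<bullet> J y) + alpha * (ud t \<bullet> J y)
        = tau * (u2 \<bullet> J y) + alpha * (u1 \<bullet> J y) - y \<bullet> integral {0..t} (flux p pd)"
        by (simp only: int S_J)
    qed
  next
    assume R: "\<forall>y. \<forall>t\<ge>0. tau * (udd t \<bullet> J y) + alpha * (ud t \<bullet> J y)
        = tau * (u2 \<bullet> J y) + alpha * (u1 \<bullet> J y) - y \<bullet> integral {0..t} (flux p pd)"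
    show ?weak
    proof
      fix v assume v: "v \<in> DS"
      from spec[OF R, of "S v"] show "\<forall>t\<ge>0. tau * (udd t \<bullet> v) + alpha * (ud t \<bullet> v)
        = tau * (u2 \<bullet> v) + alpha * (u1 \<bullet> v)
          - integral {0..t} (\<lambda>s. c\<^sup>2 * (S (u s) \<bullet> S v) + b * (S (ud s) \<bullet> S v)
                - integral {0..s} (\<lambda>r. g (s - r) * (S (lam *\<^sub>R u r + ud r) \<bullet> S v)))"
        by (simp only: int J_S[OF v])
    qed
  qed
  also have "\<dots> \<longleftrightarrow> (\<forall>t\<ge>0. \<forall>y. (tau *\<^sub>R J (udd t - u2) + alpha *\<^sub>R J (ud t - u1)) \<bullet> y = (- integral {0..t} (flux p pd)) \<bullet> y)"
    by (auto simp: inner_add_left inner_diff_left J_sym algebra_simps inner_commute[of "integral _ _"])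
  also have "\<dots> \<longleftrightarrow> ?vec" by (simp only: vector_eq_rdot)
  finally show ?thesis .
qed

lemma weak_solD:
  assumes w: "wsol u0 u1 u2 u ud udd"
  shows "continuous_on {0..} (\<lambda>t. S (u t))" "continuous_on {0..} (\<lambda>t. S (ud t))" "continuous_on {0..} udd"
    and "\<And>t. t \<ge> 0 \<Longrightarrow> u t = J (S (u t))" "\<And>t. t \<ge> 0 \<Longrightarrow> ud t = J (S (ud t))"
    and "\<And>t. t \<ge> 0 \<Longrightarrow> (u has_vector_derivative ud t) (at t within {0..})"
      "\<And>t. t \<ge> 0 \<Longrightarrow> (ud has_vector_derivative udd t) (at t within {0..})"
    and "u 0 = u0" "ud 0 = u1" "udd 0 = u2"
    and "\<And>t. t \<ge> 0 \<Longrightarrow> tau *\<^sub>R J (udd t - u2) + alpha *\<^sub>R J (ud t - u1) = - integral {0..t} (flux (\<lambda>t. S (u t)) (\<lambda>t. S (ud t)))"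
proof -
  note d = w[unfolded weak_sol_def]
  show p: "continuous_on {0..} (\<lambda>t. S (u t))" and pd: "continuous_on {0..} (\<lambda>t. S (ud t))" and "continuous_on {0..} udd"
    and "\<And>t. t \<ge> 0 \<Longrightarrow> (u has_vector_derivative ud t) (at t within {0..})"
      "\<And>t. t \<ge> 0 \<Longrightarrow> (ud has_vector_derivative udd t) (at t within {0..})"
    and "u 0 = u0" "ud 0 = u1" "udd 0 = u2"
    using d by blast+
  show u: "u t = J (S (u t))" and ud: "ud t = J (S (ud t))" if "t \<ge> 0" for t
    using d that J_S[of "u t"] J_S[of "ud t"] by auto
  show "tau *\<^sub>R J (udd t - u2) + alpha *\<^sub>R J (ud t - u1) = - integral {0..t} (flux (\<lambda>t. S (u t)) (\<lambda>t. S (ud t)))"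
    if "t \<ge> 0" for t
    using weak_form_iff[OF p pd u ud, of udd u2 u1] d that by blast
qed

lemma F3_eq_energy:
  assumes w: "wsol u0 u1 u2 u ud udd" and t: "t \<ge> 0"
  shows "F3 S lam g u ud udd t = energy (\<lambda>t. S (u t)) (\<lambda>t. S (ud t)) udd t"
proof -
  have S: "S (lam *\<^sub>R u s + ud s) = lam *\<^sub>R S (u s) + S (ud s)" if "s \<ge> 0" for s
  proof -
    have "lam *\<^sub>R u s + ud s = J (lam *\<^sub>R S (u s) + S (ud s))"
      using weak_solD(4,5)[OF w that] by (simp add: J_lin)
    then show ?thesis by (simp add: S_J)
  qed
  have "integral {0..t} (\<lambda>s. g (t - s) * (norm (S (lam *\<^sub>R u t + ud t) - S (lam *\<^sub>R u s + ud s)))\<^sup>2)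
     = memory (\<lambda>s. lam *\<^sub>R S (u s) + S (ud s)) t"
    unfolding memory_def by (rule integral_cong) (use t in \<open>simp add: S\<close>)
  then show ?thesis by (simp add: F3_def energy_def)
qed

text \<open>Applying the bounded operator \<open>yos e\<close> to the integrated identity shows that
  the regularised \<open>u''\<close> is differentiable in time, because the right side is the
  integral of a continuous function. The image of this \<open>u''\<close> under \<open>S\<close> is
  \<open>yos e (udd t)\<close>, so testing with \<open>w'\<close> is legitimate, and the two terms
  of the tested identity cancel by symmetry of \<open>J\<close>.\<close>

lemma strong_sol_yosida:
  assumes w: "wsol u0 u1 u2 u ud udd" and e: "e > 0"
  shows "strong_sol (lam0 + 1) (\<lambda>_. 0) (\<lambda>t. J (yos e (u t))) (\<lambda>t. J (yos e (ud t))) (\<lambda>t. J (yos e (udd t)))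
    (\<lambda>t. (1 / tau) *\<^sub>R (- alpha *\<^sub>R J (yos e (udd t)) - yos e (flux (\<lambda>t. S (u t)) (\<lambda>t. S (ud t)) t)))
    (\<lambda>t. yos e (u t)) (\<lambda>t. yos e (ud t)) (\<lambda>t. yos e (udd t))"
proof -
  note W = weak_solD[OF w]
  define h where "h = flux (\<lambda>t. S (u t)) (\<lambda>t. S (ud t))"
  define K where "K = (\<lambda>x. J (yos e x))"
  note B = yos_bl[OF e]
  have K: "bounded_linear K" unfolding K_def by (rule bounded_linear_compose[OF J_bl B])
  have KS: "yos e x = K (S x)" if "x = J (S x)" for x
    using arg_cong[OF that, of "yos e"] by (simp add: K_def yos_J[OF e])
  have Ku: "yos e (u t) = K (S (u t))" "yos e (ud t) = K (S (ud t))" if "t \<ge> 0" for t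
    using KS[OF W(4)[OF that]] KS[OF W(5)[OF that]] by auto
  have hc: "continuous_on {0..} h" unfolding h_def by (intro continuous_on_flux W)
  have fl: "flux (\<lambda>t. yos e (u t)) (\<lambda>t. yos e (ud t)) t = K (h t)" if t: "t \<ge> 0" for t
  proof -
    have "conv g (\<lambda>s. lam *\<^sub>R yos e (u s) + yos e (ud s)) t = conv g (\<lambda>s. lam *\<^sub>R K (S (u s)) + K (S (ud s))) t"
      by (rule conv_cong) (simp add: Ku)
    then have "flux (\<lambda>t. yos e (u t)) (\<lambda>t. yos e (ud t)) t = flux (\<lambda>t. K (S (u t))) (\<lambda>t. K (S (ud t))) t"
      using t by (simp add: flux_def Ku)
    also have "\<dots> = K (h t)" unfolding h_def by (intro flux_linear W K)
    finally show ?thesis .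
  qed
  have vdd: "((\<lambda>t. K (udd t)) has_vector_derivative (1 / tau) *\<^sub>R (- alpha *\<^sub>R K (udd t) - yos e (h t))) (at t within {0..})"
    if t: "t \<ge> 0" for t
  proof -
    define a where "a = tau *\<^sub>R K u2 + alpha *\<^sub>R K u1"
    have eq: "K (udd t) = (1 / tau) *\<^sub>R (a - alpha *\<^sub>R K (ud t) - yos e (integral {0..t} h))" if "t \<ge> 0" for t
    proof -
      have "tau *\<^sub>R (K (udd t) - K u2) + alpha *\<^sub>R (K (ud t) - K u1) = - yos e (integral {0..t} h)"
        using arg_cong[OF W(11)[OF that], of "yos e"]
        by (simp add: K_def h_def linear_simps[OF B] yos_J[OF e] J_lin)
      then have "tau *\<^sub>R K (udd t) = a - alpha *\<^sub>R K (ud t) - yos e (integral {0..t} h)"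
        by (simp add: a_def algebra_simps add_eq_0_iff)
      then have "(1 / tau) *\<^sub>R (tau *\<^sub>R K (udd t)) = (1 / tau) *\<^sub>R (a - alpha *\<^sub>R K (ud t) - yos e (integral {0..t} h))"
        by simp
      then show ?thesis using tau_pos by simp
    qed
    have 1: "((\<lambda>t. alpha *\<^sub>R K (ud t)) has_vector_derivative alpha *\<^sub>R K (udd t)) (at t within {0..})"
      by (intro bounded_linear.has_vector_derivative[OF bounded_linear_scaleR_right]
          bounded_linear.has_vector_derivative[OF K] W(7) t)
    have 2: "((\<lambda>t. yos e (integral {0..t} h)) has_vector_derivative yos e (h t)) (at t within {0..})"
      by (intro bounded_linear.has_vector_derivative[OF B] has_vector_derivative_integral_atLeast hc t)
    have "((\<lambda>t. (1 / tau) *\<^sub>R (a - alpha *\<^sub>R K (ud t) - yos e (integral {0..t} h))) has_vector_derivative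
       (1 / tau) *\<^sub>R (0 - alpha *\<^sub>R K (udd t) - yos e (h t))) (at t within {0..})"
      by (intro bounded_linear.has_vector_derivative[OF bounded_linear_scaleR_right] has_vector_derivative_diff
          has_vector_derivative_const 1 2)
    then have "((\<lambda>t. (1 / tau) *\<^sub>R (a - alpha *\<^sub>R K (ud t) - yos e (integral {0..t} h))) has_vector_derivative
       (1 / tau) *\<^sub>R (- alpha *\<^sub>R K (udd t) - yos e (h t))) (at t within {0..})" by simp
    then show ?thesis
      by (rule has_vector_derivative_transform[rotated 2]) (use eq t in auto)
  qed
  have tested: "(tau *\<^sub>R ((1 / tau) *\<^sub>R (- alpha *\<^sub>R K (udd t) - yos e (h t))) + alpha *\<^sub>R K (udd t) - 0) \<bullet> K y
       + flux (\<lambda>t. yos e (u t)) (\<lambda>t. yos e (ud t)) t \<bullet> yos e y = 0" if "t \<ge> 0" for t y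
    using tau_pos by (simp add: fl[OF that]) (simp add: K_def J_sym)
  have nJ: "norm (J x) \<le> (lam0 + 1) * norm x" for x
    using J_norm[of x] by (simp add: distrib_right add_increasing2)
  have Kx: "J (yos e x) = K x" for x by (simp add: K_def)
  have fx: "c\<^sup>2 *\<^sub>R yos e (u t) + b *\<^sub>R yos e (ud t) - conv g (\<lambda>s. lam *\<^sub>R yos e (u s) + yos e (ud s)) t =
      flux (\<lambda>t. yos e (u t)) (\<lambda>t. yos e (ud t)) t" for t by (simp add: flux_def)
  show ?thesis
    unfolding strong_sol_def Kx h_def[symmetric] fx
  proof (intro conjI allI impI)
    fix t :: real assume t: "0 \<le> t"
    show "((\<lambda>t. K (u t)) has_vector_derivative K (ud t)) (at t within {0..})"
      "((\<lambda>t. K (ud t)) has_vector_derivative K (udd t)) (at t within {0..})"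
      by (intro bounded_linear.has_vector_derivative[OF K] W t)+
    show "((\<lambda>t. K (udd t)) has_vector_derivative (1 / tau) *\<^sub>R (- alpha *\<^sub>R K (udd t) - yos e (h t))) (at t within {0..})"
      by (rule vdd[OF t])
    show "((\<lambda>t. yos e (u t)) has_vector_derivative yos e (ud t)) (at t within {0..})"
      "((\<lambda>t. yos e (ud t)) has_vector_derivative yos e (udd t)) (at t within {0..})"
      by (intro bounded_linear.has_vector_derivative[OF B] W t)+
    show "norm (K (ud t)) \<le> (lam0 + 1) * norm (yos e (ud t))" unfolding K_def by (rule nJ)
    have "lam *\<^sub>R K (u t) + K (ud t) = J (lam *\<^sub>R yos e (u t) + yos e (ud t))" by (simp add: K_def J_lin)
    then show "norm (lam *\<^sub>R K (u t) + K (ud t)) \<le> (lam0 + 1) * norm (lam *\<^sub>R yos e (u t) + yos e (ud t))"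
      using nJ by simp
    show "(tau *\<^sub>R ((1 / tau) *\<^sub>R (- alpha *\<^sub>R K (udd t) - yos e (h t))) + alpha *\<^sub>R K (udd t) - 0) \<bullet> (lam *\<^sub>R K (ud t) + K (udd t))
       + flux (\<lambda>t. yos e (u t)) (\<lambda>t. yos e (ud t)) t \<bullet> (lam *\<^sub>R yos e (ud t) + yos e (udd t)) = 0"
      using tested[OF t, of "lam *\<^sub>R ud t + udd t"] by (simp only: linear_simps[OF K] linear_simps[OF B])
    show "(tau *\<^sub>R ((1 / tau) *\<^sub>R (- alpha *\<^sub>R K (udd t) - yos e (h t))) + alpha *\<^sub>R K (udd t) - 0) \<bullet> (lam *\<^sub>R K (u t) + K (ud t))
       + flux (\<lambda>t. yos e (u t)) (\<lambda>t. yos e (ud t)) t \<bullet> (lam *\<^sub>R yos e (u t) + yos e (ud t)) = 0"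
      using tested[OF t, of "lam *\<^sub>R u t + ud t"] by (simp only: linear_simps[OF K] linear_simps[OF B])
  next
    show "continuous_on {0..} (\<lambda>t. yos e (udd t))" by (intro bounded_linear.continuous_on[OF B] W)
  qed
qed

text \<open>Contractivity bounds the regularised integrands by the original one, which serves as the
  dominating function.\<close>

lemma memory_J_yos_tendsto:
  assumes q: "continuous_on {0..} q" and e: "\<And>n. e n > 0" "e \<longlonglongrightarrow> 0"
  shows "(\<lambda>n. memory (\<lambda>s. J (yos (e n) (q s))) t) \<longlonglongrightarrow> memory q t"
  unfolding memory_def
proof (rule dominated_convergence(2))
  have bl: "bounded_linear (\<lambda>x. J (yos (e n) x))" for n
    by (rule bounded_linear_compose[OF J_bl yos_bl[OF e(1)]])
  have eq: "J (yos (e n) x) - J (yos (e n) y) = J (yos (e n) (x - y))" for n x y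
    by (simp add: linear_simps[OF bl])
  show "(\<lambda>s. g (t - s) * (norm (J (yos (e n) (q t)) - J (yos (e n) (q s))))\<^sup>2) integrable_on {0..t}" for n
    unfolding real_scaleR_def[symmetric]
    by (intro integrable_conv g_cont continuous_intros bounded_linear.continuous_on[OF bl] q)
  show "(\<lambda>s. g (t - s) * (norm (q t - q s))\<^sup>2) integrable_on {0..t}"
    unfolding real_scaleR_def[symmetric] by (intro integrable_conv g_cont continuous_intros q)
  show "norm (g (t - s) * (norm (J (yos (e n) (q t)) - J (yos (e n) (q s))))\<^sup>2) \<le> g (t - s) * (norm (q t - q s))\<^sup>2"
    if "s \<in> {0..t}" for n s
    unfolding eq using g_nonneg[of "t - s"] that norm_J_yos_le[OF e(1), of n "q t - q s"]
    by (auto simp: abs_mult intro!: mult_left_mono power_mono)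
  show "(\<lambda>n. g (t - s) * (norm (J (yos (e n) (q t)) - J (yos (e n) (q s))))\<^sup>2) \<longlonglongrightarrow> g (t - s) * (norm (q t - q s))\<^sup>2"
    if "s \<in> {0..t}" for s
    by (intro tendsto_intros J_yos_tendsto e)
qed

text \<open>Regularisation is a contraction, so it does not increase the initial energy, and the
  constants do not depend on \<open>e\<close>. Strong convergence recovers the energy at time
  \<open>t\<close> in the limit.\<close>

lemma weak_sol_decay:
  "\<exists>C>0. \<exists>\<omega>>0. \<forall>u0 u1 u2 u ud udd. wsol u0 u1 u2 u ud udd \<longrightarrow>
     (\<forall>t\<ge>0. F3 S lam g u ud udd t \<le> C * F3 S lam g u ud udd 0 * exp (- \<omega> * t))"
proof -
  have "lam0 + 1 > 0" using lam0_pos by simp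
  from energy_estimate[OF this, where 'a = 'a] obtain C \<omega> where C: "C > 0" "\<omega> > 0"
    and est: "\<forall>(f::real \<Rightarrow> 'a) M v vd vdd vddd p pd pdd.
    strong_sol (lam0 + 1) f v vd vdd vddd p pd pdd \<longrightarrow> (\<forall>t\<ge>0. norm (f t) \<le> M) \<longrightarrow>
    (\<forall>t\<ge>0. energy p pd vdd t \<le> C * (energy p pd vdd 0 * exp (- \<omega> * t) + M\<^sup>2))" by blast
  have "F3 S lam g u ud udd t \<le> C * F3 S lam g u ud udd 0 * exp (- \<omega> * t)"
    if w: "wsol u0 u1 u2 u ud udd" and t: "t \<ge> 0" for u0 u1 u2 u ud udd t
  proof -
    note W = weak_solD[OF w]
    define p pd where "p = (\<lambda>t. S (u t))" and "pd = (\<lambda>t. S (ud t))"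
    define e where "e = (\<lambda>n. inverse (real (Suc n)))"
    have e: "\<And>n. e n > 0" "e \<longlonglongrightarrow> 0" unfolding e_def using LIMSEQ_inverse_real_of_nat by auto
    have K: "yos (e n) (u s) = J (yos (e n) (p s))" "yos (e n) (ud s) = J (yos (e n) (pd s))" if "s \<ge> 0" for n s
      using arg_cong[OF W(4)[OF that], of "yos (e n)"] arg_cong[OF W(5)[OF that], of "yos (e n)"]
      by (simp_all add: p_def pd_def yos_J[OF e(1)])
    define q where "q = (\<lambda>s. lam *\<^sub>R p s + pd s)"
    have qc: "continuous_on {0..} q" unfolding q_def p_def pd_def by (intro continuous_intros W)
    have mem: "memory (\<lambda>s. lam *\<^sub>R yos (e n) (u s) + yos (e n) (ud s)) r = memory (\<lambda>s. J (yos (e n) (q s))) r"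
      if "r \<ge> 0" for n r
      unfolding memory_def
      by (rule integral_cong) (use that in \<open>simp add: K q_def J_lin linear_simps[OF yos_bl[OF e(1)]]\<close>)
    define E where "E = (\<lambda>n. energy (\<lambda>t. yos (e n) (u t)) (\<lambda>t. yos (e n) (ud t)) (\<lambda>t. J (yos (e n) (udd t))))"
    have Eeq: "E n r = (norm (J (yos (e n) (pd r))))\<^sup>2 + (norm (J (yos (e n) (p r))))\<^sup>2 + (norm (J (yos (e n) (udd r))))\<^sup>2
       + memory (\<lambda>s. J (yos (e n) (q s))) r" if "r \<ge> 0" for n r
      using that by (simp add: E_def energy_def mem K)
    have lim: "(\<lambda>n. E n t) \<longlonglongrightarrow> energy p pd udd t"
      unfolding Eeq[OF t] energy_def q_def[symmetric]
      by (intro tendsto_intros J_yos_tendsto memory_J_yos_tendsto qc e)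
    have "E n t \<le> C * (energy p pd udd 0 * exp (- \<omega> * t))" for n
    proof -
      have "E n 0 \<le> energy p pd udd 0"
        unfolding Eeq[OF order_refl] energy_def
        using norm_J_yos_le[OF e(1)[of n]] by (intro add_mono power_mono) (auto simp: memory_def)
      then have "C * (E n 0 * exp (- \<omega> * t)) \<le> C * (energy p pd udd 0 * exp (- \<omega> * t))"
        using C by (intro mult_left_mono mult_right_mono) auto
      moreover have "E n t \<le> C * (E n 0 * exp (- \<omega> * t) + 0\<^sup>2)"
        unfolding E_def
        by (rule est[rule_format, OF strong_sol_yosida[OF w e(1)[of n]]]) (use t in auto)
      ultimately show ?thesis by simp
    qed
    then have "energy p pd udd t \<le> C * (energy p pd udd 0 * exp (- \<omega> * t))"
      by (intro LIMSEQ_le_const2[OF lim]) auto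
    then show ?thesis
      using F3_eq_energy[OF w t] F3_eq_energy[OF w order_refl] by (simp add: p_def pd_def mult.assoc)
  qed
  then show ?thesis using C by blast
qed

end

section \<open>Existence of weak solutions\<close>

context mgt_hilbert
begin

text \<open>Classical solutions of the problem in which the bounded operator \<open>yos e\<close> replaces \<open>S\<close>, with
  forcing \<open>f\<close>.\<close>

definition bsol :: "real \<Rightarrow> (real \<Rightarrow> 'a) \<Rightarrow> (real \<Rightarrow> 'a) \<Rightarrow> (real \<Rightarrow> 'a) \<Rightarrow> (real \<Rightarrow> 'a) \<Rightarrow> bool" where
  "bsol e f u ud udd \<longleftrightarrow> (\<forall>t\<ge>0.
     (u has_vector_derivative ud t) (at t within {0..}) \<and>
     (ud has_vector_derivative udd t) (at t within {0..}) \<and>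
     (udd has_vector_derivative (1 / tau) *\<^sub>R (f t - alpha *\<^sub>R udd t - yos e (yos e (flux u ud t)))) (at t within {0..}))"

lemma bsol_continuous:
  assumes "bsol e f u ud udd"
  shows "continuous_on {0..} u" "continuous_on {0..} ud" "continuous_on {0..} udd"
proof -
  note d = assms[unfolded bsol_def, rule_format]
  show "continuous_on {0..} u"
    by (rule continuous_on_vector_derivative_atLeast[of u ud]) (use d in blast)
  show "continuous_on {0..} ud"
    by (rule continuous_on_vector_derivative_atLeast[of ud udd]) (use d in blast)
  show "continuous_on {0..} udd"
    by (rule continuous_on_vector_derivative_atLeast[OF d[THEN conjunct2, THEN conjunct2]])
qed

text \<open>First-order form in \<open>X = (u, u', u'')\<close>: \<open>L\<close> collects the local
  terms and \<open>M\<close> what stands under the convolution. Linearity of the convolution then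
  turns the third component into the required equation.\<close>

lemma bsol_exists:
  assumes e: "e > 0"
  shows "\<exists>u ud udd. bsol e (\<lambda>_. 0) u ud udd \<and> u 0 = x0 \<and> ud 0 = x1 \<and> udd 0 = x2"
proof -
  let ?B = "\<lambda>x. yos e (yos e x)"
  have B: "bounded_linear ?B" by (rule bounded_linear_compose[OF yos_bl[OF e] yos_bl[OF e]])
  define L where "L = (\<lambda>X::'a \<times> 'a \<times> 'a. (fst (snd X), snd (snd X),
     (1 / tau) *\<^sub>R (- alpha *\<^sub>R snd (snd X) - ?B (c\<^sup>2 *\<^sub>R fst X + b *\<^sub>R fst (snd X)))))"
  define M where "M = (\<lambda>X::'a \<times> 'a \<times> 'a. (0::'a, 0::'a, (1 / tau) *\<^sub>R ?B (lam *\<^sub>R fst X + fst (snd X))))"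
  note bls = bounded_linear_Pair bounded_linear_zero bounded_linear_compose[OF bounded_linear_scaleR_right]
    bounded_linear_add bounded_linear_sub bounded_linear_compose[OF B]
    bounded_linear_fst bounded_linear_snd bounded_linear_compose[OF bounded_linear_fst]
    bounded_linear_compose[OF bounded_linear_snd]
  have L: "bounded_linear L" unfolding L_def by (intro bls)
  have M: "bounded_linear M" unfolding M_def by (intro bls)
  from volterra_exists[OF L M, of "(x0, x1, x2)"] obtain X where X0: "X 0 = (x0, x1, x2)"
    and X: "\<And>t. t \<ge> 0 \<Longrightarrow> (X has_vector_derivative (L (X t) + conv g (\<lambda>s. M (X s)) t)) (at t within {0..})"
    by blast
  define u ud udd where "u = (\<lambda>t. fst (X t))" and "ud = (\<lambda>t. fst (snd (X t)))" and "udd = (\<lambda>t. snd (snd (X t)))"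
  have Xc: "continuous_on {0..} X" using X by (rule continuous_on_vector_derivative_atLeast)
  have uc: "continuous_on {0..} u" "continuous_on {0..} ud" unfolding u_def ud_def by (intro continuous_intros Xc)+
  have XM: "conv g (\<lambda>s. M (X s)) t = M (conv g X t)" for t by (rule conv_linear[OF g_cont Xc M])
  have cX: "fst (conv g X t) = conv g u t" "fst (snd (conv g X t)) = conv g ud t" for t
    using conv_linear[OF g_cont Xc bounded_linear_fst, of t]
      conv_linear[OF g_cont Xc bounded_linear_compose[OF bounded_linear_fst bounded_linear_snd], of t]
    by (simp_all add: u_def ud_def)
  have cq: "conv g (\<lambda>s. lam *\<^sub>R u s + ud s) t = lam *\<^sub>R conv g u t + conv g ud t" for t
  proof -
    have "conv g (\<lambda>s. lam *\<^sub>R u s + ud s) t = conv g (\<lambda>s. lam *\<^sub>R u s) t + conv g ud t"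
      by (intro conv_add g_cont continuous_intros uc)
    also have "conv g (\<lambda>s. lam *\<^sub>R u s) t = lam *\<^sub>R conv g u t"
      by (rule conv_linear[OF g_cont uc(1) bounded_linear_scaleR_right])
    finally show ?thesis .
  qed
  have D: "((\<lambda>t. T (X t)) has_vector_derivative T (L (X t) + M (conv g X t))) (at t within {0..})"
    if "bounded_linear T" "t \<ge> 0" for T :: "'a \<times> 'a \<times> 'a \<Rightarrow> 'a" and t
    using bounded_linear.has_vector_derivative[OF that(1) X[OF that(2)]] by (simp only: XM)
  have "bsol e (\<lambda>_. 0) u ud udd"
    unfolding bsol_def
  proof (intro allI impI conjI)
    fix t :: real assume t: "0 \<le> t"
    show "(u has_vector_derivative ud t) (at t within {0..})"
      using D[OF bounded_linear_fst t] by (simp add: u_def ud_def L_def M_def)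
    show "(ud has_vector_derivative udd t) (at t within {0..})"
      using D[OF bounded_linear_compose[OF bounded_linear_fst bounded_linear_snd] t] by (simp add: ud_def udd_def L_def M_def)
    have "(1 / tau) *\<^sub>R (0 - alpha *\<^sub>R udd t - ?B (flux u ud t)) = snd (snd (L (X t) + M (conv g X t)))"
    proof -
      have uX: "fst (X t) = u t" "fst (snd (X t)) = ud t" "snd (snd (X t)) = udd t"
        by (simp_all add: u_def ud_def udd_def)
      show ?thesis
        unfolding flux_def cq L_def M_def uX
        by (simp add: linear_simps[OF B] cX algebra_simps)
    qed
    then show "(udd has_vector_derivative (1 / tau) *\<^sub>R (0 - alpha *\<^sub>R udd t - ?B (flux u ud t))) (at t within {0..})"
      using D[OF bounded_linear_compose[OF bounded_linear_snd bounded_linear_snd] t] by (simp add: udd_def)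
  qed
  moreover have "u 0 = x0" "ud 0 = x1" "udd 0 = x2" by (simp_all add: u_def ud_def udd_def X0)
  ultimately show ?thesis by blast
qed

lemma bsol_diff:
  assumes e: "e > 0" and s: "bsol e f u ud udd" and s': "bsol e f' u' ud' udd'"
  shows "bsol e (\<lambda>t. f t - f' t) (\<lambda>t. u t - u' t) (\<lambda>t. ud t - ud' t) (\<lambda>t. udd t - udd' t)"
  unfolding bsol_def
proof (intro allI impI conjI)
  fix t :: real assume t: "0 \<le> t"
  note c = bsol_continuous[OF s] bsol_continuous[OF s']
  note d = s[unfolded bsol_def, rule_format, OF t] s'[unfolded bsol_def, rule_format, OF t]
  show "((\<lambda>t. u t - u' t) has_vector_derivative ud t - ud' t) (at t within {0..})"
    "((\<lambda>t. ud t - ud' t) has_vector_derivative udd t - udd' t) (at t within {0..})"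
    using d by (auto intro: has_vector_derivative_diff)
  have "((\<lambda>t. udd t - udd' t) has_vector_derivative
    (1 / tau) *\<^sub>R (f t - alpha *\<^sub>R udd t - yos e (yos e (flux u ud t)))
    - (1 / tau) *\<^sub>R (f' t - alpha *\<^sub>R udd' t - yos e (yos e (flux u' ud' t)))) (at t within {0..})"
    using d by (auto intro: has_vector_derivative_diff)
  moreover have "(1 / tau) *\<^sub>R (f t - alpha *\<^sub>R udd t - yos e (yos e (flux u ud t)))
    - (1 / tau) *\<^sub>R (f' t - alpha *\<^sub>R udd' t - yos e (yos e (flux u' ud' t))) =
    (1 / tau) *\<^sub>R (f t - f' t - alpha *\<^sub>R (udd t - udd' t) - yos e (yos e (flux (\<lambda>t. u t - u' t) (\<lambda>t. ud t - ud' t) t)))"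
    unfolding flux_diff[OF c(1,2,4,5)] linear_simps[OF yos_bl[OF e]] by (simp add: algebra_simps)
  ultimately show "((\<lambda>t. udd t - udd' t) has_vector_derivative
    (1 / tau) *\<^sub>R (f t - f' t - alpha *\<^sub>R (udd t - udd' t) - yos e (yos e (flux (\<lambda>t. u t - u' t) (\<lambda>t. ud t - ud' t) t))))
    (at t within {0..})" by simp
qed

text \<open>The point at which commutation matters: differences of Yosida approximations may be
  applied to a solution, and the result solves the same equation with new data.\<close>

lemma bsol_linear:
  assumes s: "bsol e (\<lambda>_. 0) u ud udd" and T: "bounded_linear T" and Te: "\<And>x. T (yos e x) = yos e (T x)"
  shows "bsol e (\<lambda>_. 0) (\<lambda>t. T (u t)) (\<lambda>t. T (ud t)) (\<lambda>t. T (udd t))"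
  unfolding bsol_def
proof (intro allI impI conjI)
  fix t :: real assume t: "0 \<le> t"
  note c = bsol_continuous[OF s]
  note d = s[unfolded bsol_def, rule_format, OF t]
  show "((\<lambda>t. T (u t)) has_vector_derivative T (ud t)) (at t within {0..})"
    "((\<lambda>t. T (ud t)) has_vector_derivative T (udd t)) (at t within {0..})"
    using d by (auto intro: bounded_linear.has_vector_derivative[OF T])
  have "((\<lambda>t. T (udd t)) has_vector_derivative T ((1 / tau) *\<^sub>R (0 - alpha *\<^sub>R udd t - yos e (yos e (flux u ud t)))))
      (at t within {0..})"
    using d by (auto intro: bounded_linear.has_vector_derivative[OF T])
  moreover have "T ((1 / tau) *\<^sub>R (0 - alpha *\<^sub>R udd t - yos e (yos e (flux u ud t)))) =
    (1 / tau) *\<^sub>R (0 - alpha *\<^sub>R T (udd t) - yos e (yos e (flux (\<lambda>t. T (u t)) (\<lambda>t. T (ud t)) t)))"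
    unfolding flux_linear[OF c(1,2) T] by (simp add: linear_simps[OF T] Te)
  ultimately show "((\<lambda>t. T (udd t)) has_vector_derivative
    (1 / tau) *\<^sub>R (0 - alpha *\<^sub>R T (udd t) - yos e (yos e (flux (\<lambda>t. T (u t)) (\<lambda>t. T (ud t)) t)))) (at t within {0..})"
    by simp
qed

text \<open>The restriction \<open>e \<le> 1\<close> yields a Poincare constant
  \<open>lam0 + 1\<close> independent of \<open>e\<close>, hence estimates uniform in the
  approximation.\<close>

lemma bsol_strong:
  assumes e: "e > 0" "e \<le> 1" and s: "bsol e f u ud udd"
  shows "strong_sol (lam0 + 1) f u ud udd
    (\<lambda>t. (1 / tau) *\<^sub>R (f t - alpha *\<^sub>R udd t - yos e (yos e (flux u ud t))))
    (\<lambda>t. yos e (u t)) (\<lambda>t. yos e (ud t)) (\<lambda>t. yos e (udd t))"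
proof -
  note B = yos_bl[OF e(1)]
  note c = bsol_continuous[OF s]
  have fx: "c\<^sup>2 *\<^sub>R yos e (u t) + b *\<^sub>R yos e (ud t) - conv g (\<lambda>s. lam *\<^sub>R yos e (u s) + yos e (ud s)) t =
      yos e (flux u ud t)" for t using flux_linear[OF c(1,2) B, of t] by (simp add: flux_def)
  have tested: "(tau *\<^sub>R ((1 / tau) *\<^sub>R (f t - alpha *\<^sub>R udd t - yos e (yos e (flux u ud t)))) + alpha *\<^sub>R udd t - f t) \<bullet> y
       + yos e (flux u ud t) \<bullet> yos e y = 0" for t y
    using tau_pos yos_sym[OF e(1), of "yos e (flux u ud t)" y] by simp
  have k: "norm x \<le> (lam0 + 1) * norm (yos e x)" for x
    using norm_le_yos[OF e(1), of x] mult_right_mono[of "lam0 + e" "lam0 + 1" "norm (yos e x)"] e(2) by simp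
  show ?thesis
    unfolding strong_sol_def fx
  proof (intro conjI allI impI)
    fix t :: real assume t: "0 \<le> t"
    note d = s[unfolded bsol_def, rule_format, OF t]
    show "(u has_vector_derivative ud t) (at t within {0..})" "(ud has_vector_derivative udd t) (at t within {0..})"
      "(udd has_vector_derivative (1 / tau) *\<^sub>R (f t - alpha *\<^sub>R udd t - yos e (yos e (flux u ud t)))) (at t within {0..})"
      using d by auto
    show "((\<lambda>t. yos e (u t)) has_vector_derivative yos e (ud t)) (at t within {0..})"
      "((\<lambda>t. yos e (ud t)) has_vector_derivative yos e (udd t)) (at t within {0..})"
      using d by (auto intro: bounded_linear.has_vector_derivative[OF B])
    show "norm (ud t) \<le> (lam0 + 1) * norm (yos e (ud t))" by (rule k)
    show "norm (lam *\<^sub>R u t + ud t) \<le> (lam0 + 1) * norm (lam *\<^sub>R yos e (u t) + yos e (ud t))"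
      using k[of "lam *\<^sub>R u t + ud t"] by (simp only: linear_simps[OF B])
    show "(tau *\<^sub>R ((1 / tau) *\<^sub>R (f t - alpha *\<^sub>R udd t - yos e (yos e (flux u ud t)))) + alpha *\<^sub>R udd t - f t) \<bullet> (lam *\<^sub>R ud t + udd t)
       + yos e (flux u ud t) \<bullet> (lam *\<^sub>R yos e (ud t) + yos e (udd t)) = 0"
      using tested[of t "lam *\<^sub>R ud t + udd t"] linear_simps[OF B] by simp
    show "(tau *\<^sub>R ((1 / tau) *\<^sub>R (f t - alpha *\<^sub>R udd t - yos e (yos e (flux u ud t)))) + alpha *\<^sub>R udd t - f t) \<bullet> (lam *\<^sub>R u t + ud t)
       + yos e (flux u ud t) \<bullet> (lam *\<^sub>R yos e (u t) + yos e (ud t)) = 0"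
      using tested[of t "lam *\<^sub>R u t + ud t"] linear_simps[OF B] by simp
  next
    show "continuous_on {0..} (\<lambda>t. yos e (udd t))" by (intro bounded_linear.continuous_on[OF B] c)
  qed
qed

text \<open>Comparable to the square root of the energy without its memory part; being subadditive
  and homogeneous, it is the convenient measure for differences of solutions.\<close>

definition size3 :: "real \<Rightarrow> (real \<Rightarrow> 'a) \<Rightarrow> (real \<Rightarrow> 'a) \<Rightarrow> (real \<Rightarrow> 'a) \<Rightarrow> real \<Rightarrow> real" where
  "size3 e u ud udd t = norm (yos e (u t)) + norm (yos e (ud t)) + norm (udd t)"

lemma size3_nonneg: "0 \<le> size3 e u ud udd t" by (simp add: size3_def)

abbreviation
  "size3_bound C \<equiv> \<forall>e f M u ud udd. 0 < e \<longrightarrow> e \<le> 1 \<longrightarrow> bsol e f u ud udd \<longrightarrow> (\<forall>t\<ge>0. norm (f t) \<le> M) \<longrightarrow>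
    (\<forall>t\<ge>0. size3 e u ud udd t \<le> C * (size3 e u ud udd 0 + M))"

text \<open>Square root of the energy estimate. The memory part is zero initially and nonnegative
  afterwards, so it drops out on both sides; the factor 3 counts the three norms.\<close>

lemma bsol_estimate: "\<exists>C>0. size3_bound C"
proof -
  have "lam0 + 1 > 0" using lam0_pos by simp
  from energy_estimate[OF this, where 'a = 'a] obtain C \<omega> where C: "C > 0" "\<omega> > 0"
    and est: "\<forall>(f::real \<Rightarrow> 'a) M v vd vdd vddd p pd pdd.
    strong_sol (lam0 + 1) f v vd vdd vddd p pd pdd \<longrightarrow> (\<forall>t\<ge>0. norm (f t) \<le> M) \<longrightarrow>
    (\<forall>t\<ge>0. energy p pd vdd t \<le> C * (energy p pd vdd 0 * exp (- \<omega> * t) + M\<^sup>2))" by blast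
  have "size3 e u ud udd t \<le> (3 * sqrt C) * (size3 e u ud udd 0 + M)"
    if e: "0 < e" "e \<le> 1" and s: "bsol e f u ud udd" and M: "\<forall>t\<ge>0. norm (f t) \<le> M" and t: "t \<ge> 0"
    for e f M u ud udd t
  proof -
    define E where "E = energy (\<lambda>t. yos e (u t)) (\<lambda>t. yos e (ud t)) udd"
    define R where "R = size3 e u ud udd 0 + M"
    have M0: "0 \<le> M" using M norm_ge_zero[of "f 0"] by (metis order_refl order_trans)
    have R0: "0 \<le> R" using size3_nonneg M0 by (simp add: R_def)
    have mem: "0 \<le> memory (\<lambda>s. lam *\<^sub>R yos e (u s) + yos e (ud s)) t"
      by (intro memory_nonneg continuous_intros bounded_linear.continuous_on[OF yos_bl[OF e(1)]] bsol_continuous[OF s])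
    have E0: "E 0 + M\<^sup>2 \<le> R\<^sup>2"
    proof -
      have "x\<^sup>2 + y\<^sup>2 + z\<^sup>2 + w\<^sup>2 \<le> (y + x + z + w)\<^sup>2" if "0 \<le> x" "0 \<le> y" "0 \<le> z" "0 \<le> w" for x y z w :: real
        using that by (simp add: power2_eq_square algebra_simps)
      then show ?thesis using M0 by (simp add: E_def energy_def memory_def R_def size3_def)
    qed
    have "E t \<le> C * (E 0 * exp (- \<omega> * t) + M\<^sup>2)"
      unfolding E_def by (rule est[rule_format, OF bsol_strong[OF e s]]) (use M t in auto)
    also have "\<dots> \<le> C * (E 0 * 1 + M\<^sup>2)"
      using C t by (intro mult_left_mono add_mono order_refl) (auto simp: E_def energy_def memory_def)
    also have "\<dots> \<le> C * R\<^sup>2" using E0 C by (intro mult_left_mono) auto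
    finally have "E t \<le> (sqrt C * R)\<^sup>2" using C by (simp add: power_mult_distrib)
    moreover have "(norm (yos e (u t)))\<^sup>2 \<le> E t" "(norm (yos e (ud t)))\<^sup>2 \<le> E t" "(norm (udd t))\<^sup>2 \<le> E t"
      using mem by (simp_all add: E_def energy_def)
    moreover have "0 \<le> sqrt C * R" using C R0 by simp
    ultimately have "norm (yos e (u t)) \<le> sqrt C * R" "norm (yos e (ud t)) \<le> sqrt C * R" "norm (udd t) \<le> sqrt C * R"
      by (meson order_trans power2_le_imp_le)+
    then show ?thesis by (simp add: size3_def R_def)
  qed
  moreover have "3 * sqrt C > 0" using C by simp
  ultimately show ?thesis by blast
qed

end

section \<open>Uniform limits on the half-line\<close>

lemma integral_uniform_limit_atLeast:
  fixes f :: "nat \<Rightarrow> real \<Rightarrow> 'a::banach"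
  assumes "uniform_limit {0..} f l sequentially" "\<And>n. continuous_on {0..} (f n)"
  shows "(\<lambda>n. integral {0..t} (f n)) \<longlonglongrightarrow> integral {0..t} l"
proof -
  have "uniform_limit {0..t} f l sequentially" by (rule uniform_limit_on_subset[OF assms(1)]) auto
  moreover have "continuous_on {0..t} (f n)" for n by (rule continuous_on_subset[OF assms(2)]) auto
  ultimately obtain I K where I: "\<And>n. (f n has_integral I n) {0..t}" "(l has_integral K) {0..t}" "I \<longlonglongrightarrow> K"
    by (rule uniform_limit_integral[where F=sequentially]) auto
  have "integral {0..t} (f n) = I n" for n by (rule integral_unique[OF I(1)])
  then show ?thesis using I(3) by (simp only: integral_unique[OF I(2)])
qed

text \<open>Limit passage in the integral representation of \<open>v n\<close>: uniform convergence
  is asked of the derivatives, pointwise convergence suffices for the functions.\<close>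

lemma has_vector_derivative_uniform_limit:
  fixes v vd :: "nat \<Rightarrow> real \<Rightarrow> 'a::banach"
  assumes v: "\<And>n t. t \<ge> 0 \<Longrightarrow> (v n has_vector_derivative vd n t) (at t within {0..})"
    and vc: "\<And>n. continuous_on {0..} (vd n)"
    and lim: "\<And>t. t \<ge> 0 \<Longrightarrow> (\<lambda>n. v n t) \<longlonglongrightarrow> w t" and ul: "uniform_limit {0..} vd wd sequentially"
    and t: "t \<ge> 0"
  shows "(w has_vector_derivative wd t) (at t within {0..})"
proof -
  have wc: "continuous_on {0..} wd"
    by (rule uniform_limit_theorem[OF _ ul]) (use vc in auto)
  have eq: "w t = w 0 + integral {0..t} wd" if "t \<ge> 0" for t
  proof (rule LIMSEQ_unique[OF lim[OF that]])
    have "v n t = v n 0 + integral {0..t} (vd n)" for n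
      using integral_unique[OF integral_derivative_atLeast[OF v that, of n]] by simp
    then show "(\<lambda>n. v n t) \<longlonglongrightarrow> w 0 + integral {0..t} wd"
      by (simp only:) (intro tendsto_add lim integral_uniform_limit_atLeast ul vc order_refl)
  qed
  have "((\<lambda>t. w 0 + integral {0..t} wd) has_vector_derivative 0 + wd t) (at t within {0..})"
    by (intro has_vector_derivative_add has_vector_derivative_const has_vector_derivative_integral_atLeast wc t)
  then have "((\<lambda>t. w 0 + integral {0..t} wd) has_vector_derivative wd t) (at t within {0..})" by simp
  then show ?thesis
    by (rule has_vector_derivative_transform[rotated 2]) (use t in simp, rule eq, simp)
qed

section \<open>Yosida approximations on smooth vectors\<close>

context positive_operator
begin

abbreviation "J4 x \<equiv> J (J (J (J x)))"

lemma norm_yos_J_le: "e > 0 \<Longrightarrow> norm (yos e (J x)) \<le> norm x"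
  by (simp add: yos_J norm_J_yos_le)

text \<open>Each \<open>yos\<close> factor is paired with one \<open>J\<close> to form a
  contraction; the at most two unpaired \<open>J\<close> cost \<open>lam0 + 1\<close> each. Up to
  four factors occur: three from the difference of squared approximations and one from the norm in
  which it is measured.\<close>

lemma norm_yos_J4_le:
  assumes e: "e > 0" "d > 0" "h > 0" "k > 0"
  shows "norm (yos e (yos d (J4 a))) \<le> (lam0 + 1)\<^sup>2 * norm a"
    "norm (yos e (yos d (yos h (J4 a)))) \<le> (lam0 + 1)\<^sup>2 * norm a"
    "norm (yos e (yos d (yos h (yos k (J4 a))))) \<le> (lam0 + 1)\<^sup>2 * norm a"
proof -
  note K = norm_J_yos_le
  have J1: "norm (J x) \<le> (lam0 + 1) * norm x" for x
    using J_norm[of x] by (simp add: distrib_right add_increasing2)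
  have J2: "norm (J (J x)) \<le> (lam0 + 1)\<^sup>2 * norm x" for x
    using order_trans[OF J1[of "J x"] mult_left_mono[OF J1[of x], of "lam0 + 1"]] lam0_pos
    by (simp add: power2_eq_square mult.assoc)
  have l1: "lam0 + 1 \<le> (lam0 + 1)\<^sup>2" "1 \<le> (lam0 + 1)\<^sup>2" using lam0_pos by (simp_all add: power2_eq_square algebra_simps)
  have "yos e (yos d (J4 a)) = J (yos e (J (yos d (J (J a)))))"
    by (simp add: yos_J e)
  then have "norm (yos e (yos d (J4 a))) \<le> norm (J (J a))"
    using order_trans[OF K[OF e(1)] K[OF e(2)]] by simp
  then show "norm (yos e (yos d (J4 a))) \<le> (lam0 + 1)\<^sup>2 * norm a"
    using J2[of a] by linarith
  have "yos e (yos d (yos h (J4 a))) = J (yos e (J (yos d (J (yos h (J a))))))"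
    by (simp add: yos_J e)
  then have "norm (yos e (yos d (yos h (J4 a)))) \<le> norm (J a)"
    using order_trans[OF K[OF e(1)] order_trans[OF K[OF e(2)] K[OF e(3)]]] by simp
  then show "norm (yos e (yos d (yos h (J4 a)))) \<le> (lam0 + 1)\<^sup>2 * norm a"
    using J1[of a] mult_right_mono[OF l1(1) norm_ge_zero[of a]] by linarith
  have "yos e (yos d (yos h (yos k (J4 a)))) = J (yos e (J (yos d (J (yos h (J (yos k a)))))))"
    by (simp add: yos_J e)
  then have "norm (yos e (yos d (yos h (yos k (J4 a))))) \<le> norm a"
    using order_trans[OF K[OF e(1)] order_trans[OF K[OF e(2)] order_trans[OF K[OF e(3)] K[OF e(4)]]]] by simp
  then show "norm (yos e (yos d (yos h (yos k (J4 a))))) \<le> (lam0 + 1)\<^sup>2 * norm a"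
    using mult_right_mono[OF l1(2) norm_ge_zero[of a]] by simp
qed

text \<open>Telescoping with the resolvent identity; the squares are the bounded replacements of
  \<open>A\<close>.\<close>

lemma yos_sq_diff:
  assumes e: "e > 0" and d: "d > 0"
  shows "yos e (yos e x) - yos d (yos d x) = (d - e) *\<^sub>R (yos e (yos e (yos d x)) + yos e (yos d (yos d x)))"
proof -
  have "yos e (yos e x) - yos d (yos d x) = yos e (yos e x - yos d x) + (yos e (yos d x) - yos d (yos d x))"
    by (simp add: linear_simps[OF yos_bl[OF e]])
  also have "\<dots> = (d - e) *\<^sub>R (yos e (yos e (yos d x)) + yos e (yos d (yos d x)))"
    unfolding yos_diff[OF e d] by (simp add: linear_simps[OF yos_bl[OF e]] scaleR_add_right)
  finally show ?thesis .
qed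

end

section \<open>Convergence of the approximate solutions\<close>

context mgt_hilbert
begin

text \<open>The solution for \<open>d\<close> solves the problem for \<open>e\<close> with forcing
  \<open>Q\<close> of its flux, where \<open>Q\<close> is the difference of the squared
  approximations. \<open>Q\<close> commutes with \<open>yos d\<close>, so \<open>Q\<close> applied
  to this solution solves the problem for \<open>d\<close> again, with initial data of order
  \<open>\<bar>d - e\<bar>\<close> because they lie in the range of \<open>J4\<close>. The estimate
  for that solution thus bounds the forcing by a multiple of \<open>\<bar>d - e\<bar>\<close>
  uniformly in time.\<close>

lemma bsol_cauchy_regular:
  "\<exists>R\<ge>0. \<forall>e d u ud udd u' ud' udd' t. 0 < e \<longrightarrow> e \<le> 1 \<longrightarrow> 0 < d \<longrightarrow> d \<le> 1 \<longrightarrow> 0 \<le> t \<longrightarrow>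
     bsol e (\<lambda>_. 0) u ud udd \<longrightarrow> bsol d (\<lambda>_. 0) u' ud' udd' \<longrightarrow>
     u 0 = J4 a0 \<longrightarrow> ud 0 = J4 a1 \<longrightarrow> udd 0 = J4 a2 \<longrightarrow>
     u' 0 = J4 a0 \<longrightarrow> ud' 0 = J4 a1 \<longrightarrow> udd' 0 = J4 a2 \<longrightarrow>
     norm (yos e (u t) - yos d (u' t)) \<le> R * \<bar>d - e\<bar> \<and> norm (yos e (ud t) - yos d (ud' t)) \<le> R * \<bar>d - e\<bar> \<and>
     norm (udd t - udd' t) \<le> R * \<bar>d - e\<bar>"
proof -
  obtain C where C: "C > 0" and est: "size3_bound C" using bsol_estimate by blast
  define k where "k = lam0 + 1"
  define N where "N = k\<^sup>2 * (norm a0 + norm a1 + norm a2)"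
  define cf where "cf = c\<^sup>2 + b + Gam * (lam + 1)"
  \<comment> \<open>The first summand estimates the difference of the two solutions through the
    forcing, the second the change of operator acting on one solution. \<open>k\<close> undoes a
    \<open>yos\<close> by the Poincare inequality, and the 2 counts the terms in
    \<open>yos_sq_diff\<close>.\<close>
  define R where "R = C * (cf * (k * (C * (2 * N)))) + k * (C * N)"
  have k: "k > 0" using lam0_pos by (simp add: k_def)
  have N0: "0 \<le> N" by (simp add: N_def)
  have b0: "b > 0" using b_gt const_pos(4) by simp
  have cf: "cf > 0" unfolding cf_def using b0 Gam_nonneg lam_pos by (intro add_pos_nonneg add_nonneg_pos) auto
  have R0: "0 \<le> R" using C k N0 cf by (simp add: R_def)
  have main: "norm (yos e (u t) - yos d (u' t)) \<le> R * \<bar>d - e\<bar> \<and> norm (yos e (ud t) - yos d (ud' t)) \<le> R * \<bar>d - e\<bar> \<and>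
     norm (udd t - udd' t) \<le> R * \<bar>d - e\<bar>"
    if e: "0 < e" "e \<le> 1" and d: "0 < d" "d \<le> 1" and t: "0 \<le> t"
      and s: "bsol e (\<lambda>_. 0) u ud udd" and s': "bsol d (\<lambda>_. 0) u' ud' udd'"
      and i: "u 0 = J4 a0" "ud 0 = J4 a1" "udd 0 = J4 a2"
      and i': "u' 0 = J4 a0" "ud' 0 = J4 a1" "udd' 0 = J4 a2"
    for e d u ud udd u' ud' udd' t
  proof -
    note c' = bsol_continuous[OF s']
    note n4 = norm_yos_J4_le[folded k_def]
    have kd: "norm x \<le> k * norm (yos d x)" for x
      using norm_le_yos[OF d(1), of x] mult_right_mono[of "lam0 + d" k "norm (yos d x)"] d(2) by (simp add: k_def)
    define P where "P = (\<lambda>x. yos e x - yos d x)"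
    define Q where "Q = (\<lambda>x. yos e (yos e x) - yos d (yos d x))"
    have P: "bounded_linear P" unfolding P_def by (intro bounded_linear_sub yos_bl e d)
    have Q: "bounded_linear Q" unfolding Q_def
      by (intro bounded_linear_sub bounded_linear_compose[OF yos_bl[OF e(1)] yos_bl[OF e(1)]]
          bounded_linear_compose[OF yos_bl[OF d(1)] yos_bl[OF d(1)]])
    have Pd: "P (yos d x) = yos d (P x)" for x
      by (simp add: P_def linear_simps[OF yos_bl[OF d(1)]] yos_commute[OF e(1) d(1)])
    have Od: "Q (yos d x) = yos d (Q x)" for x
      by (simp add: Q_def linear_simps[OF yos_bl[OF d(1)]] yos_commute[OF e(1) d(1)])
    have Pb: "norm (yos d (P (J4 a))) \<le> \<bar>d - e\<bar> * (k\<^sup>2 * norm a)"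
      "norm (P (J4 a)) \<le> \<bar>d - e\<bar> * (k\<^sup>2 * norm a)" for a
      unfolding P_def yos_diff[OF e(1) d(1)] linear_simps[OF yos_bl[OF d(1)]] norm_scaleR
      by (intro mult_left_mono abs_ge_zero n4(1)[OF e(1) d(1) d(1) d(1)] n4(2)[OF d(1) e(1) d(1) d(1)])+
    have Ob: "norm (yos d (Q (J4 a))) \<le> \<bar>d - e\<bar> * (2 * (k\<^sup>2 * norm a))"
      "norm (Q (J4 a)) \<le> \<bar>d - e\<bar> * (2 * (k\<^sup>2 * norm a))" for a
    proof -
      have tr: "norm (x + y) \<le> 2 * (k\<^sup>2 * norm a)" if "norm x \<le> k\<^sup>2 * norm a" "norm y \<le> k\<^sup>2 * norm a" for x y :: 'a
        using norm_triangle_mono[OF that] by linarith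
      show "norm (yos d (Q (J4 a))) \<le> \<bar>d - e\<bar> * (2 * (k\<^sup>2 * norm a))"
        "norm (Q (J4 a)) \<le> \<bar>d - e\<bar> * (2 * (k\<^sup>2 * norm a))"
        unfolding Q_def yos_sq_diff[OF e(1) d(1)] linear_simps[OF yos_bl[OF d(1)]] norm_scaleR
        by (intro mult_left_mono abs_ge_zero tr n4(3)[OF d(1) e(1) e(1) d(1)] n4(3)[OF d(1) e(1) d(1) d(1)]
          n4(2)[OF e(1) e(1) d(1) d(1)] n4(2)[OF e(1) d(1) d(1) d(1)])+
    qed
    have zero: "\<forall>t\<ge>0. norm ((\<lambda>_. 0::'a) t) \<le> 0" by simp
    define r where "r = C * (\<bar>d - e\<bar> * (2 * N))"
    have sO: "bsol d (\<lambda>_. 0) (\<lambda>t. Q (u' t)) (\<lambda>t. Q (ud' t)) (\<lambda>t. Q (udd' t))"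
      by (rule bsol_linear[OF s' Q Od])
    have "size3 d (\<lambda>t. Q (u' t)) (\<lambda>t. Q (ud' t)) (\<lambda>t. Q (udd' t)) 0 \<le> \<bar>d - e\<bar> * (2 * N)"
      using add_mono[OF add_mono[OF Ob(1)[of a0] Ob(1)[of a1]] Ob(2)[of a2]]
      by (simp add: size3_def i' N_def distrib_left)
    then have r0: "C * (size3 d (\<lambda>t. Q (u' t)) (\<lambda>t. Q (ud' t)) (\<lambda>t. Q (udd' t)) 0 + 0) \<le> r"
      unfolding r_def using C by simp
    have rO: "size3 d (\<lambda>t. Q (u' t)) (\<lambda>t. Q (ud' t)) (\<lambda>t. Q (udd' t)) t \<le> r" if "t \<ge> 0" for t
      by (rule order_trans[OF est[rule_format, OF d sO _ that] r0]) simp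
    have yO: "norm (Q (u' t)) \<le> k * r" "norm (Q (ud' t)) \<le> k * r" if "t \<ge> 0" for t
    proof -
      have "norm (yos d (Q (u' t))) \<le> r" "norm (yos d (Q (ud' t))) \<le> r"
        using rO[OF that] norm_ge_zero[of "yos d (Q (u' t))"] norm_ge_zero[of "yos d (Q (ud' t))"]
          norm_ge_zero[of "Q (udd' t)"] unfolding size3_def by linarith+
      from this[THEN mult_left_mono[OF _ less_imp_le[OF k]]]
      show "norm (Q (u' t)) \<le> k * r" "norm (Q (ud' t)) \<le> k * r"
        using kd[of "Q (u' t)"] kd[of "Q (ud' t)"] by linarith+
    qed
    define f where "f = (\<lambda>t. Q (flux u' ud' t))"
    have fle: "norm (f t) \<le> cf * (k * r)" if "t \<ge> 0" for t
    proof -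
      have "norm (flux (\<lambda>t. Q (u' t)) (\<lambda>t. Q (ud' t)) t) \<le> cf * (k * r)"
        unfolding cf_def
        by (rule norm_flux_le) (use yO that c' in \<open>auto intro!: bounded_linear.continuous_on[OF Q]\<close>)
      then show ?thesis by (simp only: f_def flux_linear[OF c'(1,2) Q])
    qed
    \<comment> \<open>The forcing is exactly the error made by replacing \<open>yos d\<close> by
      \<open>yos e\<close> in the equation.\<close>
    have "bsol e f u' ud' udd'"
    proof -
      have "f t - alpha *\<^sub>R udd' t - yos e (yos e (flux u' ud' t)) = 0 - alpha *\<^sub>R udd' t - yos d (yos d (flux u' ud' t))" for t
        by (simp add: f_def Q_def)
      then show ?thesis using s' by (simp only: bsol_def)
    qed
    then have sz: "bsol e (\<lambda>t. 0 - f t) (\<lambda>t. u t - u' t) (\<lambda>t. ud t - ud' t) (\<lambda>t. udd t - udd' t)"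
      by (rule bsol_diff[OF e(1) s])
    have z0: "size3 e (\<lambda>t. u t - u' t) (\<lambda>t. ud t - ud' t) (\<lambda>t. udd t - udd' t) 0 = 0"
      by (simp add: size3_def i i' linear_simps[OF yos_bl[OF e(1)]])
    have z: "size3 e (\<lambda>t. u t - u' t) (\<lambda>t. ud t - ud' t) (\<lambda>t. udd t - udd' t) t \<le> C * (cf * (k * r))"
      using est[rule_format, OF e sz _ t, of "cf * (k * r)"] fle by (simp add: z0)
    have sP: "bsol d (\<lambda>_. 0) (\<lambda>t. P (u' t)) (\<lambda>t. P (ud' t)) (\<lambda>t. P (udd' t))"
      by (rule bsol_linear[OF s' P Pd])
    have "size3 d (\<lambda>t. P (u' t)) (\<lambda>t. P (ud' t)) (\<lambda>t. P (udd' t)) 0 \<le> \<bar>d - e\<bar> * N"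
      using add_mono[OF add_mono[OF Pb(1)[of a0] Pb(1)[of a1]] Pb(2)[of a2]]
      by (simp add: size3_def i' N_def distrib_left)
    then have r0': "C * (size3 d (\<lambda>t. P (u' t)) (\<lambda>t. P (ud' t)) (\<lambda>t. P (udd' t)) 0 + 0) \<le> C * (\<bar>d - e\<bar> * N)"
      using C by simp
    have rP: "size3 d (\<lambda>t. P (u' t)) (\<lambda>t. P (ud' t)) (\<lambda>t. P (udd' t)) t \<le> C * (\<bar>d - e\<bar> * N)"
      by (rule order_trans[OF est[rule_format, OF d sP _ t] r0']) simp
    have yP: "norm (P (u' t)) \<le> k * (C * (\<bar>d - e\<bar> * N))" "norm (P (ud' t)) \<le> k * (C * (\<bar>d - e\<bar> * N))"
    proof -
      have "norm (yos d (P (u' t))) \<le> C * (\<bar>d - e\<bar> * N)" "norm (yos d (P (ud' t))) \<le> C * (\<bar>d - e\<bar> * N)"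
        using rP norm_ge_zero[of "yos d (P (u' t))"] norm_ge_zero[of "yos d (P (ud' t))"]
          norm_ge_zero[of "P (udd' t)"] unfolding size3_def by linarith+
      from this[THEN mult_left_mono[OF _ less_imp_le[OF k]]]
      show "norm (P (u' t)) \<le> k * (C * (\<bar>d - e\<bar> * N))" "norm (P (ud' t)) \<le> k * (C * (\<bar>d - e\<bar> * N))"
        using kd[of "P (u' t)"] kd[of "P (ud' t)"] by linarith+
    qed
    have Req: "R * \<bar>d - e\<bar> = C * (cf * (k * r)) + k * (C * (\<bar>d - e\<bar> * N))"
      by (simp add: R_def r_def algebra_simps)
    have z3: "norm (yos e (u t - u' t)) \<le> C * (cf * (k * r))" "norm (yos e (ud t - ud' t)) \<le> C * (cf * (k * r))"
      "norm (udd t - udd' t) \<le> C * (cf * (k * r))"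
      using z norm_ge_zero[of "yos e (u t - u' t)"] norm_ge_zero[of "yos e (ud t - ud' t)"]
        norm_ge_zero[of "udd t - udd' t"] unfolding size3_def by linarith+
    \<comment> \<open>Difference of the solutions under one operator, plus difference of the
      operators on one solution.\<close>
    have split: "yos e x - yos d y = yos e (x - y) + P y" for x y
      by (simp add: P_def linear_simps[OF yos_bl[OF e(1)]])
    have "0 \<le> k * (C * (\<bar>d - e\<bar> * N))" using k C N0 by simp
    then show ?thesis
      unfolding split Req using norm_triangle_mono[OF z3(1) yP(1)] norm_triangle_mono[OF z3(2) yP(2)] z3(3) by simp
  qed
  show ?thesis using R0 main by blast
qed


text \<open>Three-term argument. Replacing the data by smooth ones costs little, uniformly in
  \<open>n\<close> and \<open>t\<close>; on the fixed smooth data the rate \<open>R\<close> may be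
  large, but it multiplies \<open>\<bar>e n - e m\<bar>\<close>.\<close>

lemma bsol_cauchy:
  assumes e: "\<And>n. 0 < e n" "\<And>n. e n \<le> 1" "e \<longlonglongrightarrow> 0"
    and s: "\<And>n. bsol (e n) (\<lambda>_. 0) (u n) (ud n) (udd n)"
    and i: "\<And>n. u n 0 = J p0" "\<And>n. ud n 0 = J p1" "\<And>n. udd n 0 = x2"
  shows "uniformly_Cauchy_on {0..} (\<lambda>n t. yos (e n) (u n t))"
    "uniformly_Cauchy_on {0..} (\<lambda>n t. yos (e n) (ud n t))"
    "uniformly_Cauchy_on {0..} udd"
proof -
  obtain C where C: "C > 0" and est: "size3_bound C" using bsol_estimate by blast
  have main: "\<exists>N. \<forall>t\<ge>0. \<forall>m\<ge>N. \<forall>n\<ge>N. norm (yos (e m) (u m t) - yos (e n) (u n t)) < r \<and>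
      norm (yos (e m) (ud m t) - yos (e n) (ud n t)) < r \<and> norm (udd m t - udd n t) < r" if r: "r > 0" for r
  proof -
    \<comment> \<open>Three components, each perturbed by at most \<open>r'\<close> and amplified by
      \<open>C\<close>, add up to \<open>r / 3\<close>.\<close>
    define r' where "r' = r / (9 * C)"
    have r': "r' > 0" using r C by (simp add: r'_def)
    \<comment> \<open>Three powers suffice for the first two data, which already carry one
      \<open>J\<close>: their difference from smooth data is \<open>J\<close> of a small vector, and
      \<open>yos e\<close> after \<open>J\<close> is a contraction. The third datum needs all
      four.\<close>
    obtain a0 where a0: "norm (p0 - J (J (J a0))) < r'"
      using J_power_approx[OF r', of p0 3] by (auto simp: numeral_3_eq_3)
    obtain a1 where a1: "norm (p1 - J (J (J a1))) < r'"
      using J_power_approx[OF r', of p1 3] by (auto simp: numeral_3_eq_3)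
    obtain a2 where a2: "norm (x2 - J4 a2) < r'"
      using J_power_approx[OF r', of x2 4] by (auto simp: eval_nat_numeral)
    have "\<forall>n. \<exists>w wd wdd. bsol (e n) (\<lambda>_. 0) w wd wdd \<and> w 0 = J4 a0 \<and> wd 0 = J4 a1 \<and> wdd 0 = J4 a2"
      using bsol_exists[OF e(1)] by blast
    then obtain w wd wdd where w: "\<And>n. bsol (e n) (\<lambda>_. 0) (w n) (wd n) (wdd n)"
      "\<And>n. w n 0 = J4 a0" "\<And>n. wd n 0 = J4 a1" "\<And>n. wdd n 0 = J4 a2"
      by metis
    have close: "norm (yos (e n) (u n t) - yos (e n) (w n t)) \<le> r / 3 \<and> norm (yos (e n) (ud n t) - yos (e n) (wd n t)) \<le> r / 3 \<and>
       norm (udd n t - wdd n t) \<le> r / 3" if t: "t \<ge> 0" for n t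
    proof -
      note yl = linear_simps[OF yos_bl[OF e(1)[of n]]]
      have sd: "bsol (e n) (\<lambda>t. 0 - 0) (\<lambda>t. u n t - w n t) (\<lambda>t. ud n t - wd n t) (\<lambda>t. udd n t - wdd n t)"
        by (rule bsol_diff[OF e(1) s w(1)])
      have "norm (yos (e n) (u n 0 - w n 0)) \<le> r'"
        using order_trans[OF norm_yos_J_le[OF e(1)[of n], of "p0 - J (J (J a0))"] less_imp_le[OF a0]]
        by (simp only: i w J_lin)
      moreover have "norm (yos (e n) (ud n 0 - wd n 0)) \<le> r'"
        using order_trans[OF norm_yos_J_le[OF e(1)[of n], of "p1 - J (J (J a1))"] less_imp_le[OF a1]]
        by (simp only: i w J_lin)
      moreover have "norm (udd n 0 - wdd n 0) \<le> r'" using a2 by (simp add: i w)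
      ultimately have "size3 (e n) (\<lambda>t. u n t - w n t) (\<lambda>t. ud n t - wd n t) (\<lambda>t. udd n t - wdd n t) 0 + 0 \<le> 3 * r'"
        unfolding size3_def by linarith
      then have "C * (size3 (e n) (\<lambda>t. u n t - w n t) (\<lambda>t. ud n t - wd n t) (\<lambda>t. udd n t - wdd n t) 0 + 0) \<le> C * (3 * r')"
        using C by (intro mult_left_mono) auto
      also have "\<dots> = r / 3" using C by (simp add: r'_def)
      finally have b: "C * (size3 (e n) (\<lambda>t. u n t - w n t) (\<lambda>t. ud n t - wd n t) (\<lambda>t. udd n t - wdd n t) 0 + 0) \<le> r / 3" .
      have "size3 (e n) (\<lambda>t. u n t - w n t) (\<lambda>t. ud n t - wd n t) (\<lambda>t. udd n t - wdd n t) t \<le> r / 3"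
        by (rule order_trans[OF est[rule_format, OF e(1) e(2) sd _ t] b]) simp
      then show ?thesis
        unfolding size3_def yl
        using norm_ge_zero[of "yos (e n) (u n t) - yos (e n) (w n t)"] norm_ge_zero[of "yos (e n) (ud n t) - yos (e n) (wd n t)"]
          norm_ge_zero[of "udd n t - wdd n t"] by linarith
    qed
    obtain R where R: "R \<ge> 0" and reg: "\<forall>e d u ud udd u' ud' udd' t. 0 < e \<longrightarrow> e \<le> 1 \<longrightarrow> 0 < d \<longrightarrow> d \<le> 1 \<longrightarrow> 0 \<le> t \<longrightarrow>
     bsol e (\<lambda>_. 0) u ud udd \<longrightarrow> bsol d (\<lambda>_. 0) u' ud' udd' \<longrightarrow>
     u 0 = J4 a0 \<longrightarrow> ud 0 = J4 a1 \<longrightarrow> udd 0 = J4 a2 \<longrightarrow>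
     u' 0 = J4 a0 \<longrightarrow> ud' 0 = J4 a1 \<longrightarrow> udd' 0 = J4 a2 \<longrightarrow>
     norm (yos e (u t) - yos d (u' t)) \<le> R * \<bar>d - e\<bar> \<and> norm (yos e (ud t) - yos d (ud' t)) \<le> R * \<bar>d - e\<bar> \<and>
     norm (udd t - udd' t) \<le> R * \<bar>d - e\<bar>"
      using bsol_cauchy_regular[of a0 a1 a2] by blast
    have "r / (3 * (R + 1)) > 0" using r R by simp
    then have "\<forall>\<^sub>F n in sequentially. e n < r / (3 * (R + 1))" by (rule order_tendstoD(2)[OF e(3)])
    then obtain N where N: "\<And>n. n \<ge> N \<Longrightarrow> e n < r / (3 * (R + 1))" by (auto simp: eventually_sequentially)
    have "norm (yos (e m) (u m t) - yos (e n) (u n t)) < r \<and>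
      norm (yos (e m) (ud m t) - yos (e n) (ud n t)) < r \<and> norm (udd m t - udd n t) < r"
      if t: "t \<ge> 0" and mn: "m \<ge> N" "n \<ge> N" for t m n
    proof -
      have "\<bar>e n - e m\<bar> < r / (3 * (R + 1))" using N[OF mn(1)] N[OF mn(2)] e(1)[of m] e(1)[of n] by linarith
      then have "(R + 1) * \<bar>e n - e m\<bar> < (R + 1) * (r / (3 * (R + 1)))" using R by (intro mult_strict_left_mono) auto
      also have "\<dots> = r / 3"
      proof -
        have "x \<noteq> 0 \<Longrightarrow> x * (r / (3 * x)) = r / 3" for x by simp
        from this[of "R + 1"] show ?thesis using R by linarith
      qed
      finally have "(R + 1) * \<bar>e n - e m\<bar> < r / 3" .
      then have small: "R * \<bar>e n - e m\<bar> < r / 3"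
        using mult_right_mono[of R "R + 1" "\<bar>e n - e m\<bar>"] by simp
      note rg = reg[rule_format, OF e(1) e(2) e(1) e(2) t w(1) w(1) w(2) w(3) w(4) w(2) w(3) w(4), of m n]
      have tri: "norm (x - y) < r" if "norm (x - x') \<le> r / 3" "norm (x' - y') \<le> R * \<bar>e n - e m\<bar>" "norm (y - y') \<le> r / 3" for x y x' y' :: 'a
      proof -
        have "x - y = (x - x') + (x' - y') + (y' - y)" by simp
        then have "norm (x - y) \<le> norm (x - x') + norm (x' - y') + norm (y' - y)"
          by (metis norm_triangle_ineq norm_triangle_mono order_refl)
        then show ?thesis using that small by (simp add: norm_minus_commute)
      qed
      show ?thesis using close[OF t, of m] close[OF t, of n] rg by (auto intro: tri)
    qed
    then show ?thesis by blast
  qed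
  show "uniformly_Cauchy_on {0..} (\<lambda>n t. yos (e n) (u n t))" "uniformly_Cauchy_on {0..} (\<lambda>n t. yos (e n) (ud n t))"
    "uniformly_Cauchy_on {0..} udd"
    unfolding uniformly_Cauchy_on_def dist_norm using main by (meson atLeast_iff)+
qed

text \<open>\<open>J + e\<close> inverts \<open>yos e\<close>, so applying it removes one of the two
  Yosida factors in the equation, and the other passes into the flux. The result is the vector
  identity of weak solutions up to terms with a factor \<open>e\<close>.\<close>

lemma bsol_integrated:
  assumes e: "e > 0" and s: "bsol e (\<lambda>_. 0) u ud udd" and t: "t \<ge> 0"
  shows "tau *\<^sub>R (J (udd t - udd 0) + e *\<^sub>R (udd t - udd 0)) + alpha *\<^sub>R (J (ud t - ud 0) + e *\<^sub>R (ud t - ud 0))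
    = - integral {0..t} (flux (\<lambda>t. yos e (u t)) (\<lambda>t. yos e (ud t)))"
proof -
  note c = bsol_continuous[OF s]
  define T where "T = (\<lambda>x. J x + e *\<^sub>R x)"
  have T: "bounded_linear T" unfolding T_def by (intro bounded_linear_add J_bl bounded_linear_scaleR_right)
  have TB: "T (yos e x) = x" for x by (simp add: T_def J_yos[OF e])
  define F where "F = (\<lambda>t. tau *\<^sub>R T (udd t) + alpha *\<^sub>R T (ud t))"
  have "(F has_vector_derivative - flux (\<lambda>t. yos e (u t)) (\<lambda>t. yos e (ud t)) t) (at t within {0..})" if t: "t \<ge> 0" for t
  proof -
    note d = s[unfolded bsol_def, rule_format, OF t]
    have "(F has_vector_derivative tau *\<^sub>R T ((1 / tau) *\<^sub>R (0 - alpha *\<^sub>R udd t - yos e (yos e (flux u ud t)))) + alpha *\<^sub>R T (udd t))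
       (at t within {0..})"
      unfolding F_def
      by (intro has_vector_derivative_add bounded_linear.has_vector_derivative[OF bounded_linear_scaleR_right]
          bounded_linear.has_vector_derivative[OF T]) (use d in auto)
    moreover have "tau *\<^sub>R T ((1 / tau) *\<^sub>R (0 - alpha *\<^sub>R udd t - yos e (yos e (flux u ud t)))) + alpha *\<^sub>R T (udd t) =
      - flux (\<lambda>t. yos e (u t)) (\<lambda>t. yos e (ud t)) t"
      unfolding flux_linear[OF c(1,2) yos_bl[OF e]] using tau_pos by (simp add: linear_simps[OF T] TB)
    ultimately show ?thesis by simp
  qed
  from integral_unique[OF integral_derivative_atLeast[OF this t]]
  have "F t - F 0 = - integral {0..t} (flux (\<lambda>t. yos e (u t)) (\<lambda>t. yos e (ud t)))" by simp
  moreover have "tau *\<^sub>R T (udd t - udd 0) + alpha *\<^sub>R T (ud t - ud 0) = F t - F 0"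
    by (simp add: F_def linear_simps[OF T] algebra_simps)
  ultimately show ?thesis by (simp add: T_def)
qed

lemma flux_uniform_limit:
  assumes p: "uniform_limit {0..} p lp sequentially" "\<And>n. continuous_on {0..} (p n)"
    and pd: "uniform_limit {0..} pd lpd sequentially" "\<And>n. continuous_on {0..} (pd n)"
  shows "uniform_limit {0..} (\<lambda>n. flux (p n) (pd n)) (flux lp lpd) sequentially"
proof (rule uniform_limitI)
  fix r :: real assume r: "r > 0"
  have lc: "continuous_on {0..} lp" "continuous_on {0..} lpd"
    using uniform_limit_theorem[OF _ p(1)] uniform_limit_theorem[OF _ pd(1)] p(2) pd(2) by auto
  define cf where "cf = c\<^sup>2 + b + Gam * (lam + 1)"
  have b0: "b > 0" using b_gt const_pos(4) by simp
  have cf: "cf > 0" unfolding cf_def using b0 Gam_nonneg lam_pos by (intro add_pos_nonneg add_nonneg_pos) auto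
  define r' where "r' = r / (2 * cf)"
  have r': "r' > 0" using r cf by (simp add: r'_def)
  show "\<forall>\<^sub>F n in sequentially. \<forall>t\<in>{0..}. dist (flux (p n) (pd n) t) (flux lp lpd t) < r"
    using uniform_limitD[OF p(1) r'] uniform_limitD[OF pd(1) r']
  proof eventually_elim
    case (elim n)
    show ?case
    proof
      fix t :: real assume "t \<in> {0..}"
      then have t: "t \<ge> 0" by simp
      have "norm (flux (\<lambda>t. p n t - lp t) (\<lambda>t. pd n t - lpd t) t) \<le> cf * r'"
        unfolding cf_def
      proof (rule norm_flux_le)
        show "norm (p n s - lp s) \<le> r'" "norm (pd n s - lpd s) \<le> r'" if "s \<ge> 0" for s
          using elim that by (auto simp: dist_norm intro: less_imp_le)
      qed (intro continuous_intros p pd lc t)+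
      also have "\<dots> < r" using cf r by (simp add: r'_def)
      finally show "dist (flux (p n) (pd n) t) (flux lp lpd t) < r"
        by (simp add: dist_norm flux_diff[OF p(2) pd(2) lc])
    qed
  qed
qed

text \<open>Limits are taken of the images \<open>yos e u\<close> and \<open>yos e u'\<close>.
  Defining \<open>u = J p\<close> from the limit \<open>p\<close> then places \<open>u\<close> in
  \<open>DS\<close> and makes \<open>S u = p\<close> continuous; the vector identity survives
  because the flux converges uniformly.\<close>

lemma weak_sol_exists:
  assumes u0: "u0 \<in> DS" and u1: "u1 \<in> DS"
  shows "\<exists>u ud udd. wsol u0 u1 u2 u ud udd"
proof -
  define e where "e = (\<lambda>n. inverse (real (Suc n)))"
  have e: "\<And>n. 0 < e n" "\<And>n. e n \<le> 1" "e \<longlonglongrightarrow> 0"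
    unfolding e_def using LIMSEQ_inverse_real_of_nat by (auto simp: field_simps)
  have i0: "u0 = J (S u0)" "u1 = J (S u1)" using J_S u0 u1 by auto
  have "\<forall>n. \<exists>w wd wdd. bsol (e n) (\<lambda>_. 0) w wd wdd \<and> w 0 = J (S u0) \<and> wd 0 = J (S u1) \<and> wdd 0 = u2"
    using bsol_exists[OF e(1)] by blast
  then obtain w wd wdd where w: "\<And>n. bsol (e n) (\<lambda>_. 0) (w n) (wd n) (wdd n)"
    "\<And>n. w n 0 = J (S u0)" "\<And>n. wd n 0 = J (S u1)" "\<And>n. wdd n 0 = u2" by metis
  define P PD where "P = (\<lambda>n t. yos (e n) (w n t))" and "PD = (\<lambda>n t. yos (e n) (wd n t))"
  have wc: "continuous_on {0..} (w n)" "continuous_on {0..} (wd n)" "continuous_on {0..} (wdd n)" for n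
    using bsol_continuous[OF w(1)] by auto
  have Pc: "continuous_on {0..} (P n)" "continuous_on {0..} (PD n)" for n
    unfolding P_def PD_def by (intro bounded_linear.continuous_on[OF yos_bl[OF e(1)]] wc)+
  note cau = bsol_cauchy[OF e w, folded P_def PD_def]
  obtain p where p: "uniform_limit {0..} P p sequentially"
    using cau(1) unfolding uniformly_convergent_eq_Cauchy[symmetric] uniformly_convergent_on_def by blast
  obtain pd where pd: "uniform_limit {0..} PD pd sequentially"
    using cau(2) unfolding uniformly_convergent_eq_Cauchy[symmetric] uniformly_convergent_on_def by blast
  obtain udd where udd: "uniform_limit {0..} wdd udd sequentially"
    using cau(3) unfolding uniformly_convergent_eq_Cauchy[symmetric] uniformly_convergent_on_def by blast
  have cont: "continuous_on {0..} p" "continuous_on {0..} pd" "continuous_on {0..} udd"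
    using uniform_limit_theorem[OF _ p] uniform_limit_theorem[OF _ pd] uniform_limit_theorem[OF _ udd] Pc wc by auto
  define u ud where "u = (\<lambda>t. J (p t))" and "ud = (\<lambda>t. J (pd t))"
  \<comment> \<open>Inverting \<open>yos\<close> expresses the solutions through their images, so
    convergence of the images carries over.\<close>
  have wP: "w n t = J (P n t) + e n *\<^sub>R P n t" "wd n t = J (PD n t) + e n *\<^sub>R PD n t" for n t
    by (simp_all add: P_def PD_def J_yos[OF e(1)])
  have limT: "(\<lambda>n. J (x n) + e n *\<^sub>R x n) \<longlonglongrightarrow> J l" if "x \<longlonglongrightarrow> l" for x l
    using tendsto_add[OF bounded_linear.tendsto[OF J_bl that] tendsto_scaleR[OF e(3) that]] by simp
  have lim_u: "(\<lambda>n. w n t) \<longlonglongrightarrow> u t" if "t \<ge> 0" for t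
    unfolding wP u_def by (rule limT, rule tendsto_uniform_limitI[OF p]) (use that in simp)
  have lim_ud: "(\<lambda>n. wd n t) \<longlonglongrightarrow> ud t" if "t \<ge> 0" for t
    unfolding wP ud_def by (rule limT, rule tendsto_uniform_limitI[OF pd]) (use that in simp)
  have lim_udd: "(\<lambda>n. wdd n t) \<longlonglongrightarrow> udd t" if "t \<ge> 0" for t
    by (rule tendsto_uniform_limitI[OF udd]) (use that in simp)
  obtain C where C: "C > 0" and est: "size3_bound C" using bsol_estimate by blast
  define R where "R = C * (norm (S u0) + norm (S u1) + norm u2)"
  \<comment> \<open>A bound uniform in \<open>n\<close> and \<open>t\<close>, so that
    \<open>e n *\<^sub>R PD n t\<close> tends to 0 uniformly and the first derivatives converge
    uniformly.\<close>
  have PDb: "norm (PD n t) \<le> R" if t: "t \<ge> 0" for n t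
  proof -
    have "size3 (e n) (w n) (wd n) (wdd n) 0 + 0 \<le> norm (S u0) + norm (S u1) + norm u2"
      unfolding size3_def w using norm_yos_J_le[OF e(1)[of n]] by (simp add: add_mono)
    then have "C * (size3 (e n) (w n) (wd n) (wdd n) 0 + 0) \<le> R"
      unfolding R_def using C by (intro mult_left_mono) auto
    moreover have "size3 (e n) (w n) (wd n) (wdd n) t \<le> C * (size3 (e n) (w n) (wd n) (wdd n) 0 + 0)"
      by (rule est[rule_format, OF e(1) e(2) w(1) _ t]) simp
    ultimately show ?thesis
      unfolding size3_def PD_def using norm_ge_zero[of "yos (e n) (w n t)"] norm_ge_zero[of "wdd n t"] by linarith
  qed
  have ul_ud: "uniform_limit {0..} wd ud sequentially"
  proof -
    have "uniform_limit {0..} (\<lambda>n t. e n *\<^sub>R PD n t) (\<lambda>_. 0) sequentially"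
    proof (rule uniform_limitI)
      fix r :: real assume "r > 0"
      have "(\<lambda>n. e n * R) \<longlonglongrightarrow> 0 * R" by (intro tendsto_intros e)
      then have "\<forall>\<^sub>F n in sequentially. e n * R < r"
        using \<open>r > 0\<close> by (intro order_tendstoD(2)[where y=0]) auto
      then show "\<forall>\<^sub>F n in sequentially. \<forall>t\<in>{0..}. dist (e n *\<^sub>R PD n t) 0 < r"
      proof eventually_elim
        case (elim n)
        show ?case
        proof
          fix t :: real assume "t \<in> {0..}"
          then have "e n * norm (PD n t) \<le> e n * R" using PDb[of t n] e(1)[of n] by (intro mult_left_mono) auto
          moreover have "dist (e n *\<^sub>R PD n t) 0 = e n * norm (PD n t)" using e(1)[of n] by simp
          ultimately show "dist (e n *\<^sub>R PD n t) 0 < r" using elim by linarith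
        qed
      qed
    qed
    from uniform_limit_add[OF bounded_linear.uniform_limit[OF J_bl pd] this]
    have "uniform_limit {0..} (\<lambda>n t. J (PD n t) + e n *\<^sub>R PD n t) ud sequentially" by (simp add: ud_def)
    moreover have "wd = (\<lambda>n t. J (PD n t) + e n *\<^sub>R PD n t)" by (intro ext) (rule wP)
    ultimately show ?thesis by simp
  qed
  have du: "(u has_vector_derivative ud t) (at t within {0..})" if "t \<ge> 0" for t
    by (rule has_vector_derivative_uniform_limit[OF _ wc(2) lim_u ul_ud that])
       (use w(1) in \<open>simp_all add: bsol_def\<close>)
  have dud: "(ud has_vector_derivative udd t) (at t within {0..})" if "t \<ge> 0" for t
    by (rule has_vector_derivative_uniform_limit[OF _ wc(3) lim_ud udd that])
       (use w(1) in \<open>simp_all add: bsol_def\<close>)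
  have init: "u 0 = u0" "ud 0 = u1" "udd 0 = u2"
    using LIMSEQ_unique[OF lim_u[OF order_refl]] LIMSEQ_unique[OF lim_ud[OF order_refl]] LIMSEQ_unique[OF lim_udd[OF order_refl]]
    by (simp_all add: w i0[symmetric])
  have vec: "tau *\<^sub>R J (udd t - u2) + alpha *\<^sub>R J (ud t - u1) = - integral {0..t} (flux p pd)" if t: "t \<ge> 0" for t
  proof (rule LIMSEQ_unique)
    show "(\<lambda>n. tau *\<^sub>R (J (wdd n t - u2) + e n *\<^sub>R (wdd n t - u2)) + alpha *\<^sub>R (J (wd n t - u1) + e n *\<^sub>R (wd n t - u1)))
      \<longlonglongrightarrow> tau *\<^sub>R J (udd t - u2) + alpha *\<^sub>R J (ud t - u1)"
      by (intro tendsto_add tendsto_scaleR tendsto_const limT tendsto_diff lim_ud lim_udd t)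
    have "tau *\<^sub>R (J (wdd n t - u2) + e n *\<^sub>R (wdd n t - u2)) + alpha *\<^sub>R (J (wd n t - u1) + e n *\<^sub>R (wd n t - u1))
      = - integral {0..t} (flux (P n) (PD n))" for n
      using bsol_integrated[OF e(1) w(1) t, of n] by (simp only: w i0[symmetric] P_def PD_def)
    moreover have "(\<lambda>n. - integral {0..t} (flux (P n) (PD n))) \<longlonglongrightarrow> - integral {0..t} (flux p pd)"
      by (intro tendsto_minus integral_uniform_limit_atLeast flux_uniform_limit p pd Pc continuous_on_flux)
    ultimately show "(\<lambda>n. tau *\<^sub>R (J (wdd n t - u2) + e n *\<^sub>R (wdd n t - u2)) + alpha *\<^sub>R (J (wd n t - u1) + e n *\<^sub>R (wd n t - u1)))
      \<longlonglongrightarrow> - integral {0..t} (flux p pd)" by simp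
  qed
  have "wsol u0 u1 u2 u ud udd"
    unfolding weak_sol_def
  proof (intro conjI)
    show "\<forall>t\<ge>0. u t \<in> DS \<and> ud t \<in> DS" by (simp add: u_def ud_def J_DS)
    show "\<forall>t\<ge>0. (u has_vector_derivative ud t) (at t within {0..})" using du by blast
    show "\<forall>t\<ge>0. (ud has_vector_derivative udd t) (at t within {0..})" using dud by blast
    show "continuous_on {0..} (\<lambda>t. S (u t))" "continuous_on {0..} (\<lambda>t. S (ud t))"
      using cont by (simp_all add: u_def ud_def S_J)
    show "continuous_on {0..} udd" by (rule cont)
    show "\<forall>v\<in>DS. \<forall>t\<ge>0.
        tau * (udd t \<bullet> v) + alpha * (ud t \<bullet> v)
        = tau * (u2 \<bullet> v) + alpha * (u1 \<bullet> v)
          - integral {0..t} (\<lambda>s. c\<^sup>2 * (S (u s) \<bullet> S v) + b * (S (ud s) \<bullet> S v)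
                - integral {0..s} (\<lambda>r. g (s - r) * (S (lam *\<^sub>R u r + ud r) \<bullet> S v)))"
      by (subst weak_form_iff[OF cont(1,2)]) (use vec in \<open>auto simp: u_def ud_def\<close>)
  qed (use init in auto)
  then show ?thesis by blast
qed

text \<open>Linearity is used on the vector identity, from which \<open>weak_form_iff\<close>
  returns to the weak form for the difference. Its \<open>F3\<close> vanishes initially, hence
  always, and nonnegativity of every summand gives \<open>S (u t - v t) = 0\<close>.\<close>

lemma weak_sol_unique:
  assumes w: "wsol u0 u1 u2 u ud udd"
    and w': "wsol u0 u1 u2 v vd vdd" and t: "t \<ge> 0"
  shows "u t = v t"
proof -
  note W = weak_solD[OF w] and V = weak_solD[OF w']
  define p pd where "p = (\<lambda>t. S (u t) - S (v t))" and "pd = (\<lambda>t. S (ud t) - S (vd t))"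
  have pc: "continuous_on {0..} p" "continuous_on {0..} pd"
    unfolding p_def pd_def by (intro continuous_intros W V)+
  have z: "u t - v t = J (p t)" "ud t - vd t = J (pd t)" if "t \<ge> 0" for t
    using W(4,5)[OF that] V(4,5)[OF that] by (simp_all add: p_def pd_def J_lin)
  have Sz: "S (u t - v t) = p t" "S (ud t - vd t) = pd t" if "t \<ge> 0" for t
    by (simp_all add: z[OF that] S_J)
  have vec: "tau *\<^sub>R J ((udd t - vdd t) - 0) + alpha *\<^sub>R J ((ud t - vd t) - 0) = - integral {0..t} (flux p pd)" if "t \<ge> 0" for t
  proof -
    have "flux p pd = (\<lambda>t. flux (\<lambda>t. S (u t)) (\<lambda>t. S (ud t)) t - flux (\<lambda>t. S (v t)) (\<lambda>t. S (vd t)) t)"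
      unfolding p_def pd_def by (rule ext) (intro flux_diff W V)
    then have "integral {0..t} (flux p pd) = integral {0..t} (flux (\<lambda>t. S (u t)) (\<lambda>t. S (ud t)))
       - integral {0..t} (flux (\<lambda>t. S (v t)) (\<lambda>t. S (vd t)))"
      using integral_diff[OF flux_integrable[OF W(1,2)] flux_integrable[OF V(1,2)], of t] by simp
    moreover have "tau *\<^sub>R J ((udd t - vdd t) - 0) + alpha *\<^sub>R J ((ud t - vd t) - 0) =
      (tau *\<^sub>R J (udd t - u2) + alpha *\<^sub>R J (ud t - u1)) - (tau *\<^sub>R J (vdd t - u2) + alpha *\<^sub>R J (vd t - u1))"
      by (simp add: J_lin algebra_simps)
    ultimately show ?thesis unfolding W(11)[OF that] V(11)[OF that] by simp
  qed
  have wz: "wsol 0 0 0 (\<lambda>t. u t - v t) (\<lambda>t. ud t - vd t) (\<lambda>t. udd t - vdd t)"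
    unfolding weak_sol_def
  proof (intro conjI)
    show "\<forall>t\<ge>0. u t - v t \<in> DS \<and> ud t - vd t \<in> DS" by (simp add: z J_DS)
    show "\<forall>t\<ge>0. ((\<lambda>t. u t - v t) has_vector_derivative ud t - vd t) (at t within {0..})"
      "\<forall>t\<ge>0. ((\<lambda>t. ud t - vd t) has_vector_derivative udd t - vdd t) (at t within {0..})"
      using W(6,7) V(6,7) by (auto intro: has_vector_derivative_diff)
    show "continuous_on {0..} (\<lambda>t. S (u t - v t))" "continuous_on {0..} (\<lambda>t. S (ud t - vd t))"
      by (rule continuous_on_eq[OF pc(1)], simp add: Sz) (rule continuous_on_eq[OF pc(2)], simp add: Sz)
    show "continuous_on {0..} (\<lambda>t. udd t - vdd t)" by (intro continuous_intros W V)
    show "\<forall>x\<in>DS. \<forall>t\<ge>0.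
        tau * ((udd t - vdd t) \<bullet> x) + alpha * ((ud t - vd t) \<bullet> x)
        = tau * (0 \<bullet> x) + alpha * (0 \<bullet> x)
          - integral {0..t} (\<lambda>s. c\<^sup>2 * (S (u s - v s) \<bullet> S x) + b * (S (ud s - vd s) \<bullet> S x)
                - integral {0..s} (\<lambda>r. g (s - r) * (S (lam *\<^sub>R (u r - v r) + (ud r - vd r)) \<bullet> S x)))"
      by (subst weak_form_iff[OF pc z]) (use vec in auto)
  qed (simp_all add: W(8-10) V(8-10))
  obtain C \<omega> where "F3 S lam g (\<lambda>t. u t - v t) (\<lambda>t. ud t - vd t) (\<lambda>t. udd t - vdd t) t
     \<le> C * F3 S lam g (\<lambda>t. u t - v t) (\<lambda>t. ud t - vd t) (\<lambda>t. udd t - vdd t) 0 * exp (- \<omega> * t)"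
    using weak_sol_decay wz t by blast
  moreover have "p 0 = 0" "pd 0 = 0" "udd 0 - vdd 0 = 0"
    by (simp_all add: p_def pd_def W(8-10) V(8-10))
  then have "F3 S lam g (\<lambda>t. u t - v t) (\<lambda>t. ud t - vd t) (\<lambda>t. udd t - vdd t) 0 = 0"
    using Sz[OF order_refl] by (simp add: F3_def)
  ultimately have "F3 S lam g (\<lambda>t. u t - v t) (\<lambda>t. ud t - vd t) (\<lambda>t. udd t - vdd t) t \<le> 0" by simp
  then have "energy (\<lambda>t. S (u t - v t)) (\<lambda>t. S (ud t - vd t)) (\<lambda>t. udd t - vdd t) t \<le> 0"
    by (simp only: F3_eq_energy[OF wz t])
  moreover have "0 \<le> memory (\<lambda>s. lam *\<^sub>R S (u s - v s) + S (ud s - vd s)) t"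
    by (intro memory_nonneg continuous_intros weak_solD[OF wz])
  moreover have "0 \<le> (norm (S (ud t - vd t)))\<^sup>2" "0 \<le> (norm (udd t - vdd t))\<^sup>2" by simp_all
  ultimately have "(norm (S (u t - v t)))\<^sup>2 \<le> 0" unfolding energy_def by linarith
  then have "S (u t - v t) = 0" by simp
  then have "p t = 0" using Sz(1)[OF t] by simp
  then have "u t - v t = 0" using z(1)[OF t] J_lin by simp
  then show ?thesis by simp
qed

end

text \<open>The function \<open>exp (c0 * t) * g t\<close> is nonincreasing, so \<open>g\<close>
  decays exponentially. Integrability has to be established because \<open>integral {0..} g\<close>
  would otherwise be the default value 0, and the mass condition would then say nothing about
  \<open>g\<close>.\<close>

lemma decaying_kernel_integrable:
  fixes g :: "real \<Rightarrow> real"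
  assumes g_cont: "continuous_on {0..} g"
    and g_deriv: "\<forall>t>0. (g has_real_derivative g' t) (at t)"
    and g_nonneg: "\<forall>t\<ge>0. g t \<ge> 0"
    and c0_pos: "c0 > 0"
    and g_decay: "\<forall>t>0. g' t \<le> - c0 * g t"
  shows "g integrable_on {0..}"
proof -
  have bound: "g t \<le> g 0 * exp (- c0 * t)" if t: "t \<ge> 0" for t
  proof -
    define h where "h = (\<lambda>t. exp (c0 * t) * g t)"
    have "h 0 \<ge> h t"
    proof (rule DERIV_nonpos_imp_decreasing_open[OF t])
      fix s assume s: "0 < s" "s < t"
      have "((\<lambda>t. exp (c0 * t)) has_real_derivative exp (c0 * s) * c0) (at s)"
        by (auto intro!: derivative_eq_intros)
      from DERIV_mult[OF this g_deriv[rule_format, OF s(1)]]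
      have "(h has_real_derivative exp (c0 * s) * c0 * g s + g' s * exp (c0 * s)) (at s)" by (simp only: h_def)
      moreover have "exp (c0 * s) * c0 * g s + g' s * exp (c0 * s) = exp (c0 * s) * (c0 * g s + g' s)"
        by (simp add: algebra_simps)
      moreover have "\<dots> \<le> 0" using g_decay[rule_format, OF s(1)] by (intro mult_nonneg_nonpos) auto
      ultimately show "\<exists>y. (h has_real_derivative y) (at s) \<and> y \<le> 0" by metis
    next
      show "continuous_on {0..t} h"
        unfolding h_def by (intro continuous_intros continuous_on_subset[OF g_cont]) auto
    qed
    then have "exp (- c0 * t) * (exp (c0 * t) * g t) \<le> exp (- c0 * t) * g 0"
      by (intro mult_left_mono) (auto simp: h_def)
    moreover have "exp (- c0 * t) * (exp (c0 * t) * g t) = g t" by (simp flip: exp_add mult.assoc)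
    ultimately show ?thesis by (simp only: mult.commute)
  qed
  have m: "g \<in> borel_measurable (lebesgue_on {0..})"
    by (rule continuous_imp_measurable_on_sets_lebesgue[OF g_cont]) simp
  have "(\<lambda>t. g 0 * exp (- c0 * t)) integrable_on {0..}"
    using integrable_on_exp_minus_to_infinity[OF c0_pos, of 0] by (rule integrable_on_mult_right)
  from measurable_bounded_by_integrable_imp_absolutely_integrable[OF m _ this]
  have "g absolutely_integrable_on {0..}" using bound g_nonneg by simp
  then show ?thesis by (rule set_lebesgue_integral_eq_integral(1))
qed

text \<open>The Poincare inequality supplies the bounded inverse \<open>J\<close>, whose range is
  the dense domain \<open>DS\<close>. The kernel is nonnegative and integrable, so its partial
  masses are bounded by its total mass, the value given to \<open>Gam\<close>.\<close>

lemma mgt_memory_banach: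
  fixes DS :: "'a::{real_inner,banach} set" and S :: "'a \<Rightarrow> 'a"
  assumes sa: "pos_selfadj DS S"
    and lam0_pos: "lam0 > 0"
    and poincare: "\<forall>v\<in>DS. norm v \<le> lam0 * norm (S v)"
    and tau_pos: "tau > 0" and b_pos: "b > 0" and c_pos: "c > 0"
    and g_cont: "continuous_on {0..} g"
    and g_deriv: "\<forall>t>0. (g has_real_derivative g' t) (at t)"
    and g_nonneg: "\<forall>t\<ge>0. g t \<ge> 0"
    and c0_pos: "c0 > 0"
    and g_decay: "\<forall>t>0. g' t \<le> - c0 * g t"
    and lam_range: "c\<^sup>2 / b < lam" "lam < alpha / tau"
    and G_inf: "integral {0..} g < c\<^sup>2 / lam"
  shows "\<forall>u0\<in>DS. \<forall>u1\<in>DS. \<forall>u2. \<exists>u ud udd. weak_sol DS S tau alpha b c lam g u0 u1 u2 u ud udd"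
    and "weak_sol DS S tau alpha b c lam g u0 u1 u2 u ud udd \<Longrightarrow>
         weak_sol DS S tau alpha b c lam g u0 u1 u2 v vd vdd \<Longrightarrow> t \<ge> 0 \<Longrightarrow> u t = v t"
    and "\<exists>C>0. \<exists>\<omega>>0. \<forall>u0 u1 u2 u ud udd. weak_sol DS S tau alpha b c lam g u0 u1 u2 u ud udd \<longrightarrow>
         (\<forall>t\<ge>0. F3 S lam g u ud udd t \<le> C * F3 S lam g u ud udd 0 * exp (- \<omega> * t))"
proof -
  have "\<And>v. v \<in> DS \<Longrightarrow> norm v \<le> lam0 * norm (S v)" using poincare by blast
  from selfadjoint_inverse[OF sa this] obtain J where
    h: "bounded_linear J \<and> (\<forall>x. J x \<in> DS \<and> S (J x) = x \<and> 0 \<le> J x \<bullet> x \<and> norm (J x) \<le> lam0 * norm x) \<and>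
    (\<forall>v\<in>DS. J (S v) = v) \<and> (\<forall>x y. J x \<bullet> y = x \<bullet> J y)" ..
  note J1 = h[THEN conjunct2, THEN conjunct1, rule_format]
  have J: "bounded_linear J" "\<And>x. J x \<in> DS" "\<And>x. S (J x) = x" "\<And>x. 0 \<le> J x \<bullet> x"
    "\<And>x. norm (J x) \<le> lam0 * norm x" "\<And>v. v \<in> DS \<Longrightarrow> J (S v) = v" "\<And>x y. J x \<bullet> y = x \<bullet> J y"
    by (use h in blast, (use J1 in blast)+, use h in blast, use h in blast)
  have "range J = DS"
  proof
    show "range J \<subseteq> DS" using J(2) by blast
    show "DS \<subseteq> range J"
    proof
      fix v assume "v \<in> DS"
      then have "v = J (S v)" using J(6) by simp
      then show "v \<in> range J" by (rule range_eqI)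
    qed
  qed
  moreover have "closure DS = UNIV" using sa unfolding pos_selfadj_def by blast
  ultimately have dense: "closure (range J) = UNIV" by simp
  have lam: "lam > 0"
    by (rule less_trans[OF _ lam_range(1)]) (use b_pos c_pos in simp)
  have int: "g integrable_on {0..}"
    by (rule decaying_kernel_integrable[OF g_cont g_deriv g_nonneg c0_pos g_decay])
  have Gle: "integral {0..t} g \<le> integral {0..} g" for t
  proof (rule integral_subset_le)
    show "g integrable_on {0..t}"
      by (rule integrable_continuous_real, rule continuous_on_subset[OF g_cont]) auto
  qed (use int g_nonneg in simp_all)
  have bgt: "c\<^sup>2 / lam < b" using lam_range(1)
    unfolding pos_divide_less_eq[OF lam] pos_divide_less_eq[OF b_pos] by (simp only: mult.commute)
  have lt: "lam * tau < alpha" using lam_range(2) unfolding pos_less_divide_eq[OF tau_pos] .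
  interpret mgt_hilbert g g' c0 "integral {0..} g" tau alpha b c lam J lam0 DS S
  proof unfold_locales
    show "(g has_real_derivative g' t) (at t)" "g' t \<le> - c0 * g t" if "t > 0" for t
      using g_deriv g_decay that by blast+
    show "0 \<le> g t" if "t \<ge> 0" for t using g_nonneg that by blast
    show "J (S v) = v" if "v \<in> DS" for v using J(6) that .
  qed (rule g_cont c0_pos Gle tau_pos lam lt bgt G_inf linear_add[OF bounded_linear.linear[OF J(1)]]
      linear_scale[OF bounded_linear.linear[OF J(1)]] bounded_linear.bounded[OF J(1)] J(2-5,7) dense lam0_pos)+
  show "\<forall>u0\<in>DS. \<forall>u1\<in>DS. \<forall>u2. \<exists>u ud udd. weak_sol DS S tau alpha b c lam g u0 u1 u2 u ud udd"
    using weak_sol_exists by blast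
  show "weak_sol DS S tau alpha b c lam g u0 u1 u2 u ud udd \<Longrightarrow>
         weak_sol DS S tau alpha b c lam g u0 u1 u2 v vd vdd \<Longrightarrow> t \<ge> 0 \<Longrightarrow> u t = v t"
    by (rule weak_sol_unique)
  show "\<exists>C>0. \<exists>\<omega>>0. \<forall>u0 u1 u2 u ud udd. weak_sol DS S tau alpha b c lam g u0 u1 u2 u ud udd \<longrightarrow>
         (\<forall>t\<ge>0. F3 S lam g u ud udd t \<le> C * F3 S lam g u ud udd 0 * exp (- \<omega> * t))"
    by (rule weak_sol_decay)
qed

section \<open>An isometric copy in class \<open>banach\<close>\<close>

text \<open>A type variable of sort \<open>{real_inner, complete_space}\<close> is not recognised as an instance of class
  \<open>banach\<close>, which the integration library requires. The copy below is one, and the theorem is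
  transported along the isometry.\<close>

typedef 'a hil = "UNIV :: 'a set" morphisms of_hil to_hil ..

lemmas hil_inv [simp] = of_hil_inverse to_hil_inverse[OF UNIV_I]

lemma to_hil_eq_iff [simp]: "to_hil x = to_hil y \<longleftrightarrow> x = y"
  by (simp add: to_hil_inject)

instantiation hil :: (real_inner) real_inner
begin

definition zero_hil :: "'a hil" where "0 = to_hil 0"
definition plus_hil :: "'a hil \<Rightarrow> 'a hil \<Rightarrow> 'a hil" where "x + y = to_hil (of_hil x + of_hil y)"
definition minus_hil :: "'a hil \<Rightarrow> 'a hil \<Rightarrow> 'a hil" where "x - y = to_hil (of_hil x - of_hil y)"
definition uminus_hil :: "'a hil \<Rightarrow> 'a hil" where "- x = to_hil (- of_hil x)"
definition scaleR_hil :: "real \<Rightarrow> 'a hil \<Rightarrow> 'a hil" where "r *\<^sub>R x = to_hil (r *\<^sub>R of_hil x)"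
definition norm_hil :: "'a hil \<Rightarrow> real" where "norm x = norm (of_hil x)"
definition dist_hil :: "'a hil \<Rightarrow> 'a hil \<Rightarrow> real" where "dist x y = dist (of_hil x) (of_hil y)"
definition sgn_hil :: "'a hil \<Rightarrow> 'a hil" where "sgn x = to_hil (sgn (of_hil x))"
definition inner_hil :: "'a hil \<Rightarrow> 'a hil \<Rightarrow> real" where "x \<bullet> y = of_hil x \<bullet> of_hil y"
definition uniformity_hil :: "('a hil \<times> 'a hil) filter" where
  "uniformity_hil = (INF e\<in>{0 <..}. principal {(x, y). dist x y < e})"
definition open_hil :: "'a hil set \<Rightarrow> bool" where
  "open_hil U \<longleftrightarrow> (\<forall>x\<in>U. eventually (\<lambda>(x', y). x' = x \<longrightarrow> y \<in> U) uniformity)"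

instance
proof
  fix x y z :: "'a hil" and r s :: real
  show "x + y + z = x + (y + z)" "x + y = y + x" "0 + x = x" "- x + x = 0" "x - y = x + - y"
    "r *\<^sub>R (x + y) = r *\<^sub>R x + r *\<^sub>R y" "(r + s) *\<^sub>R x = r *\<^sub>R x + s *\<^sub>R x" "r *\<^sub>R s *\<^sub>R x = (r * s) *\<^sub>R x" "1 *\<^sub>R x = x"
    by (simp_all add: zero_hil_def plus_hil_def minus_hil_def uminus_hil_def scaleR_hil_def algebra_simps)
  show "sgn x = inverse (norm x) *\<^sub>R x" by (simp add: sgn_hil_def scaleR_hil_def norm_hil_def sgn_div_norm)
  show "dist x y = norm (x - y)" by (simp add: dist_hil_def norm_hil_def minus_hil_def dist_norm)
  show "x \<bullet> y = y \<bullet> x" by (simp add: inner_hil_def inner_commute)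
  show "(x + y) \<bullet> z = x \<bullet> z + y \<bullet> z" "(r *\<^sub>R x) \<bullet> y = r * (x \<bullet> y)" "0 \<le> x \<bullet> x"
    "norm x = sqrt (x \<bullet> x)"
    by (simp_all add: inner_hil_def plus_hil_def scaleR_hil_def norm_hil_def inner_add_left norm_eq_sqrt_inner)
  show "x \<bullet> x = 0 \<longleftrightarrow> x = 0"
    using to_hil_eq_iff[of "of_hil x" 0] by (simp add: inner_hil_def zero_hil_def)
  show "uniformity = (INF e\<in>{0 <..}. principal {(x :: 'a hil, y). dist x y < e})" by (rule uniformity_hil_def)
  fix U :: "'a hil set"
  show "open U \<longleftrightarrow> (\<forall>x\<in>U. eventually (\<lambda>(x', y). x' = x \<longrightarrow> y \<in> U) uniformity)" by (rule open_hil_def)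
qed

end

lemma to_hil_simps:
  "to_hil x + to_hil y = to_hil (x + y)" "to_hil x - to_hil y = to_hil (x - y)" "r *\<^sub>R to_hil x = to_hil (r *\<^sub>R x)"
  "norm (to_hil x) = norm x" "to_hil x \<bullet> to_hil y = x \<bullet> y"
  for x y :: "'a::real_inner"
  by (simp_all add: plus_hil_def minus_hil_def scaleR_hil_def norm_hil_def inner_hil_def)

lemma bounded_linear_to_hil: "bounded_linear (to_hil :: 'a::real_inner \<Rightarrow> 'a hil)"
  by (rule bounded_linear_intro[where K=1]) (simp_all add: to_hil_simps)

lemma bounded_linear_of_hil: "bounded_linear (of_hil :: 'a::real_inner hil \<Rightarrow> 'a)"
  by (rule bounded_linear_intro[where K=1]) (simp_all add: plus_hil_def scaleR_hil_def norm_hil_def)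

instance hil :: ("{real_inner,complete_space}") complete_space
proof
  fix X :: "nat \<Rightarrow> 'a hil" assume "Cauchy X"
  then have "Cauchy (\<lambda>n. of_hil (X n))" unfolding Cauchy_def by (simp add: dist_hil_def)
  then obtain l where "(\<lambda>n. of_hil (X n)) \<longlonglongrightarrow> l" using Cauchy_convergent convergent_def by blast
  from bounded_linear.tendsto[OF bounded_linear_to_hil this] have "X \<longlonglongrightarrow> to_hil l" by simp
  then show "convergent X" by (auto simp: convergent_def)
qed

instance hil :: ("{real_inner,complete_space}") banach ..

section \<open>Transport of solutions and operators along the isometry\<close>

lemma has_vector_derivative_to_hil_iff:
  "((\<lambda>t. to_hil (f t)) has_vector_derivative to_hil d) F \<longleftrightarrow> (f has_vector_derivative d) F"
  for f :: "real \<Rightarrow> 'a::real_inner"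
  using bounded_linear.has_vector_derivative[OF bounded_linear_to_hil, of f d F]
    bounded_linear.has_vector_derivative[OF bounded_linear_of_hil, of "\<lambda>t. to_hil (f t)" "to_hil d" F] by auto

lemma continuous_on_to_hil_iff:
  "continuous_on A (\<lambda>t. to_hil (f t)) \<longleftrightarrow> continuous_on A f"
  for f :: "real \<Rightarrow> 'a::real_inner"
  using bounded_linear.continuous_on[OF bounded_linear_to_hil, of A f]
    bounded_linear.continuous_on[OF bounded_linear_of_hil, of A "\<lambda>t. to_hil (f t)"] by auto

text \<open>The weak form contains integrals of real functions only, so apart from derivatives and
  continuity just the vector operations and inner products have to be transported.\<close>

lemma weak_sol_to_hil_iff:
  "weak_sol (to_hil ` DS) (\<lambda>x. to_hil (S (of_hil x))) tau alpha b c lam g (to_hil u0) (to_hil u1) (to_hil u2)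
     (\<lambda>t. to_hil (u t)) (\<lambda>t. to_hil (ud t)) (\<lambda>t. to_hil (udd t)) \<longleftrightarrow>
   weak_sol DS S tau alpha b c lam g u0 u1 u2 u ud udd"
  for DS :: "'a::{real_inner,complete_space} set"
proof -
  have "to_hil x \<in> to_hil ` DS \<longleftrightarrow> x \<in> DS" for x by auto
  then show ?thesis
    unfolding weak_sol_def
    by (simp add: to_hil_simps has_vector_derivative_to_hil_iff continuous_on_to_hil_iff)
qed

lemma F3_to_hil:
  "F3 (\<lambda>x. to_hil (S (of_hil x))) lam g (\<lambda>t. to_hil (u t)) (\<lambda>t. to_hil (ud t)) (\<lambda>t. to_hil (udd t)) t =
   F3 S lam g u ud udd t"
  for u :: "real \<Rightarrow> 'a::{real_inner,complete_space}"
  unfolding F3_def by (simp add: to_hil_simps)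

lemma pos_selfadj_to_hil:
  fixes DS :: "'a::{real_inner,complete_space} set"
  assumes "pos_selfadj DS S"
  shows "pos_selfadj (to_hil ` DS) (\<lambda>x. to_hil (S (of_hil x)))"
proof -
  note s = assms[unfolded pos_selfadj_def]
  have lin: "linear (to_hil :: 'a \<Rightarrow> 'a hil)" using bounded_linear_to_hil by (rule bounded_linear.linear)
  show ?thesis
    unfolding pos_selfadj_def
  proof (intro conjI)
    show "subspace (to_hil ` DS)" by (rule linear_subspace_image[OF lin s[THEN conjunct1]])
    show "closure (to_hil ` DS) = UNIV"
    proof -
      have "to_hil ` closure DS \<subseteq> closure (to_hil ` DS)"
        by (intro image_closure_subset linear_continuous_on bounded_linear_to_hil closed_closure closure_subset)
      moreover have "closure DS = UNIV" using s by blast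
      moreover have "x \<in> range to_hil" for x :: "'a hil" by (rule range_eqI[of _ _ "of_hil x"]) simp
      ultimately show ?thesis by auto
    qed
    show "\<forall>y z. (\<forall>x\<in>to_hil ` DS. to_hil (S (of_hil x)) \<bullet> y = x \<bullet> z) \<longrightarrow> y \<in> to_hil ` DS"
    proof (intro allI impI)
      fix y z :: "'a hil" assume a: "\<forall>x\<in>to_hil ` DS. to_hil (S (of_hil x)) \<bullet> y = x \<bullet> z"
      have "\<forall>x\<in>DS. S x \<bullet> of_hil y = x \<bullet> of_hil z"
      proof
        fix x assume "x \<in> DS"
        then show "S x \<bullet> of_hil y = x \<bullet> of_hil z" using a[rule_format, of "to_hil x"] by (simp add: inner_hil_def)
      qed
      then have "of_hil y \<in> DS" using s by blast
      then have "to_hil (of_hil y) \<in> to_hil ` DS" by (rule imageI)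
      then show "y \<in> to_hil ` DS" by simp
    qed
    have "\<forall>x\<in>DS. 0 \<le> S x \<bullet> x" using s by blast
    then show "\<forall>x\<in>to_hil ` DS. 0 \<le> to_hil (S (of_hil x)) \<bullet> x" by (simp add: to_hil_simps)
    have "\<forall>x\<in>DS. \<forall>y\<in>DS. S x \<bullet> y = x \<bullet> S y" using s by blast
    then show "\<forall>x\<in>to_hil ` DS. \<forall>y\<in>to_hil ` DS. to_hil (S (of_hil x)) \<bullet> y = x \<bullet> to_hil (S (of_hil y))"
      by (simp add: to_hil_simps)
    have "\<forall>x\<in>DS. \<forall>y\<in>DS. S (x + y) = S x + S y" using s by blast
    then show "\<forall>x\<in>to_hil ` DS. \<forall>y\<in>to_hil ` DS. to_hil (S (of_hil (x + y))) = to_hil (S (of_hil x)) + to_hil (S (of_hil y))"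
      by (simp add: to_hil_simps)
    have "\<forall>x\<in>DS. \<forall>r. S (r *\<^sub>R x) = r *\<^sub>R S x" using s by blast
    then show "\<forall>x\<in>to_hil ` DS. \<forall>r. to_hil (S (of_hil (r *\<^sub>R x))) = r *\<^sub>R to_hil (S (of_hil x))"
      by (simp add: to_hil_simps)
  qed
qed

theorem theorem3:
  fixes D DS :: "'a::{real_inner,complete_space} set"
    and A S :: "'a \<Rightarrow> 'a"
    and lam0 tau b c alpha lam c0 :: real
    and g g' g'' :: "real \<Rightarrow> real"
  assumes A_psa: "pos_selfadj D A"
    and S_sqrt: "is_op_sqrt D A DS S"
    and lam0_pos: "lam0 > 0"
    and poincare: "\<forall>v\<in>DS. norm v \<le> lam0 * norm (S v)"
    and tau_pos: "tau > 0" and b_pos: "b > 0" and c_pos: "c > 0"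
    and gamma_pos: "alpha - c\<^sup>2 * tau / b > 0"
    and g_cont: "continuous_on {0..} g"
    and g_deriv: "\<forall>t>0. (g has_real_derivative g' t) (at t)"
    and g'_cont: "continuous_on {0<..} g'"
    and g'_deriv: "\<forall>t>0. (g' has_real_derivative g'' t) (at t)"
    and g_nonneg: "\<forall>t\<ge>0. g t \<ge> 0"
    and g'_nonpos: "\<forall>t>0. g' t \<le> 0"
    and g''_nonneg: "\<forall>t>0. g'' t \<ge> 0"
    and c0_pos: "c0 > 0"
    and g_decay: "\<forall>t>0. g' t \<le> - c0 * g t"
    and lam_range: "c\<^sup>2 / b < lam" "lam < alpha / tau"
    and G_inf: "integral {0..} g < c\<^sup>2 / lam"
  shows "(\<forall>u0\<in>DS. \<forall>u1\<in>DS. \<forall>u2.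
            (\<exists>u ud udd. weak_sol DS S tau alpha b c lam g u0 u1 u2 u ud udd) \<and>
            (\<forall>u ud udd v vd vdd.
               weak_sol DS S tau alpha b c lam g u0 u1 u2 u ud udd \<longrightarrow>
               weak_sol DS S tau alpha b c lam g u0 u1 u2 v vd vdd \<longrightarrow>
               (\<forall>t\<ge>0. u t = v t))) \<and>
         (\<exists>C>0. \<exists>\<omega>>0. \<forall>u0\<in>DS. \<forall>u1\<in>DS. \<forall>u2. \<forall>u ud udd.
            weak_sol DS S tau alpha b c lam g u0 u1 u2 u ud udd \<longrightarrow>
            (\<forall>t>0. F3 S lam g u ud udd t \<le> C * F3 S lam g u ud udd 0 * exp (- \<omega> * t)))"
proof -
  define T :: "'a hil \<Rightarrow> 'a hil" where "T = (\<lambda>x. to_hil (S (of_hil x)))"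
  have "pos_selfadj DS S" using S_sqrt unfolding is_op_sqrt_def by blast
  then have sa: "pos_selfadj (to_hil ` DS) T" unfolding T_def by (rule pos_selfadj_to_hil)
  have po: "\<forall>v\<in>to_hil ` DS. norm v \<le> lam0 * norm (T v)"
    using poincare by (simp add: T_def to_hil_simps)
  note main = mgt_memory_banach[OF sa lam0_pos po tau_pos b_pos c_pos g_cont g_deriv g_nonneg c0_pos g_decay lam_range G_inf]
  note iff = weak_sol_to_hil_iff[of DS S tau alpha b c lam g, folded T_def]
  have ex: "\<exists>u ud udd. weak_sol DS S tau alpha b c lam g u0 u1 u2 u ud udd" if u: "u0 \<in> DS" "u1 \<in> DS" for u0 u1 u2
  proof -
    obtain u ud udd where "weak_sol (to_hil ` DS) T tau alpha b c lam g (to_hil u0) (to_hil u1) (to_hil u2) u ud udd"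
      using main(1)[rule_format, OF imageI[OF u(1)] imageI[OF u(2)]] by blast
    then have "weak_sol DS S tau alpha b c lam g u0 u1 u2 (\<lambda>t. of_hil (u t)) (\<lambda>t. of_hil (ud t)) (\<lambda>t. of_hil (udd t))"
      using iff[of u0 u1 u2 "\<lambda>t. of_hil (u t)" "\<lambda>t. of_hil (ud t)" "\<lambda>t. of_hil (udd t)"] by simp
    then show ?thesis by blast
  qed
  have un: "u t = v t" if "weak_sol DS S tau alpha b c lam g u0 u1 u2 u ud udd"
    "weak_sol DS S tau alpha b c lam g u0 u1 u2 v vd vdd" "t \<ge> 0" for u0 u1 u2 u ud udd v vd vdd t
    using main(2)[OF iff[THEN iffD2, OF that(1)] iff[THEN iffD2, OF that(2)] that(3)] by simp
  obtain C \<omega> where C: "C > 0" "\<omega> > 0"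
    and dec: "\<forall>u0 u1 u2 u ud udd. weak_sol (to_hil ` DS) T tau alpha b c lam g u0 u1 u2 u ud udd \<longrightarrow>
         (\<forall>t\<ge>0. F3 T lam g u ud udd t \<le> C * F3 T lam g u ud udd 0 * exp (- \<omega> * t))"
    using main(3) by blast
  have "F3 S lam g u ud udd t \<le> C * F3 S lam g u ud udd 0 * exp (- \<omega> * t)"
    if "weak_sol DS S tau alpha b c lam g u0 u1 u2 u ud udd" "t > 0" for u0 u1 u2 u ud udd t
    using dec[rule_format, OF iff[THEN iffD2, OF that(1)] less_imp_le[OF that(2)]]
    by (simp only: T_def F3_to_hil)
  then show ?thesis using ex un C by blast
qed

end
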